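(* Let $X$ be a natural quasi-Banach space and suppose $0<p\le\infty$. Let $G$ be a compact abelian group with dual group $\Gamma$. Then every Sidon set $E\subset\Gamma$ has property $\mathcal C_p(X)$.
   Context: All spaces are over $\mathbb C$. Every quasi-Banach space $X$ is assumed to carry a quasinorm which is an $r$-norm for some $0<r<1$, i.e. $\|x+y\|^r\le\|x\|^r+\|y\|^r$ for all $x,y\in X$ (so the quasinorm is continuous). A quasi-Banach space is natural if it is linearly isomorphic to a closed linear subspace of a (complex) quasi-Banach lattice $Y$ which is $q$-convex for some $q>0$, i.e. such that for a suitable constant $C$ one has $\|(\sum_{k=1}^n|y_k|^q)^{1/q}\|\le C(\sum_{k=1}^n\|y_k\|^q)^{1/q}$ for all $n$ and all $y_1,\dots,y_n\in Y$. A set $E\subset\Gamma$ is a Sidon set if there is a constant $M$ such that for every finitely nonzero map $a:E\to\mathbb C$, $\sum_{\gamma\in E}|a(\gamma)|\le M\max_{g\in G}|\sum_{\gamma\in E}a(\gamma)\gamma(g)|$. For a compact abelian group $G$, $\mu_G$ is normalized Haar measure, and for a Borel map $\phi:G\to X$, $\|\phi\|_p=(\int_G\|\phi(g)\|^p\,d\mu_G(g))^{1/p}$ if $0<p<\infty$ and $\|\phi\|_\infty=\operatorname{ess\,sup}_{g\in G}\|\phi(g)\|$. Let $\Delta=\{\pm1\}^{\mathbb N}$ be the Cantor group (a compact abelian group) and let $\epsilon_k(t)$ denote the $k$-th coordinate of $t\in\Delta$. Property $\mathcal C_p(X)$: a set $E\subset\Gamma$ has property $\mathcal C_p(X)$ if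 there is a constant $M$ such that for every finite subset $\{\gamma_1,\dots,\gamma_n\}$ of $E$ (distinct elements) and all $x_1,\dots,x_n\in X$, $$M^{-1}\Big\|\sum_{k=1}^n x_k\epsilon_k\Big\|_p\le\Big\|\sum_{k=1}^n x_k\gamma_k\Big\|_p\le M\Big\|\sum_{k=1}^n x_k\epsilon_k\Big\|_p,$$ where the outer norms are taken over $\Delta$ and the middle one over $G$. *)

theory Defs
  imports "HOL-Probability.Probability"
begin

section \<open>Quasi-Banach spaces\<close>

text \<open>
  The library has no class of complex vector spaces, so a space is a type \<open>'x\<close> of class
  \<^class>\<open>ab_group_add\<close> together with a scalar multiplication \<open>s\<close> and a quasinorm \<open>N\<close>. The scalar
  field is a parameter because real lattices are needed as well. The \<open>r\<close>-norm inequality is part of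
  the definition of a quasi-Banach space.
\<close>

definition quasinorm_Cauchy :: "('x::ab_group_add \<Rightarrow> real) \<Rightarrow> (nat \<Rightarrow> 'x) \<Rightarrow> bool" where
  "quasinorm_Cauchy N u \<longleftrightarrow> (\<forall>e>0. \<exists>K. \<forall>m\<ge>K. \<forall>n\<ge>K. N (u m - u n) < e)"

definition quasinorm_tendsto :: "('x::ab_group_add \<Rightarrow> real) \<Rightarrow> (nat \<Rightarrow> 'x) \<Rightarrow> 'x \<Rightarrow> bool" where
  "quasinorm_tendsto N u l \<longleftrightarrow> (\<lambda>n. N (u n - l)) \<longlonglongrightarrow> 0"

definition quasi_banach ::
    "('k::real_normed_field \<Rightarrow> 'x::ab_group_add \<Rightarrow> 'x) \<Rightarrow> ('x \<Rightarrow> real) \<Rightarrow> bool" where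
  "quasi_banach s N \<longleftrightarrow>
     vector_space s \<and>
     (\<forall>x. 0 \<le> N x) \<and>
     (\<forall>x. N x = 0 \<longleftrightarrow> x = 0) \<and>
     (\<forall>c x. N (s c x) = norm c * N x) \<and>
     (\<exists>r. 0 < r \<and> r < 1 \<and> (\<forall>x y. N (x + y) powr r \<le> N x powr r + N y powr r)) \<and>
     (\<forall>u. quasinorm_Cauchy N u \<longrightarrow> (\<exists>l. quasinorm_tendsto N u l))"


section \<open>Complex quasi-Banach lattices and \<open>q\<close>-convexity\<close>

text \<open>
  A type of sort \<open>{ordered_real_vector, lattice}\<close> is a real vector lattice. A complex
  quasi-Banach lattice is the complexification \<open>'y \<times> 'y\<close> of a real quasi-Banach lattice \<open>'y\<close>,
  the pair \<open>(x, y)\<close> standing for \<open>x + i y\<close>.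
\<close>

definition lattice_abs :: "'y::{ordered_real_vector,lattice} \<Rightarrow> 'y" where
  "lattice_abs x = sup x (- x)"

definition quasi_banach_lattice :: "('y::{ordered_real_vector,lattice} \<Rightarrow> real) \<Rightarrow> bool" where
  "quasi_banach_lattice N \<longleftrightarrow>
     quasi_banach ((*\<^sub>R) :: real \<Rightarrow> 'y \<Rightarrow> 'y) N \<and>
     (\<forall>x y. lattice_abs x \<le> lattice_abs y \<longrightarrow> N x \<le> N y)"

definition complexification_scale ::
    "complex \<Rightarrow> 'y::real_vector \<times> 'y \<Rightarrow> 'y \<times> 'y" where
  "complexification_scale c z =
     (Re c *\<^sub>R fst z - Im c *\<^sub>R snd z, Im c *\<^sub>R fst z + Re c *\<^sub>R snd z)"

text \<open>
  The modulus of \<open>x + i y\<close> is the supremum of \<open>cos t x + sin t y\<close> over all real \<open>t\<close>. The supremum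
  exists because quasi-Banach lattices are uniformly complete.
\<close>

definition modulus :: "'y::{ordered_real_vector,lattice} \<times> 'y \<Rightarrow> 'y" where
  "modulus z = (LEAST u. \<forall>t::real. cos t *\<^sub>R fst z + sin t *\<^sub>R snd z \<le> u)"

definition complexification_norm ::
    "('y::{ordered_real_vector,lattice} \<Rightarrow> real) \<Rightarrow> 'y \<times> 'y \<Rightarrow> real" where
  "complexification_norm N z = N (modulus z)"

text \<open>
  \<open>(\<Sum>|y\<^sub>k|\<^sup>q)\<^bsup>1/q\<^esup>\<close> is meant in the sense of Krivine's functional calculus: the unique linear lattice
  homomorphism from the continuous positively homogeneous functions on \<open>\<real>\<^sup>n\<close> to the lattice which
  sends the \<open>k\<close>-th coordinate function to \<open>y\<^sub>k\<close>. A continuous function on \<open>\<real>\<^sup>n\<close> is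
  encoded as a continuous function on \<open>\<real>\<^sup>\<nat>\<close> (product topology) that depends only on the
  coordinates \<open>0, \<dots>, n - 1\<close>.
\<close>

definition homogeneous_functions :: "nat \<Rightarrow> ((nat \<Rightarrow> real) \<Rightarrow> real) set" where
  "homogeneous_functions n =
     {f. continuous_on UNIV f \<and>
         (\<forall>v w. (\<forall>k<n. v k = w k) \<longrightarrow> f v = f w) \<and>
         (\<forall>c v. 0 \<le> c \<longrightarrow> f (\<lambda>k. c * v k) = c * f v)}"

definition krivine_calculus ::
    "nat \<Rightarrow> (nat \<Rightarrow> 'y) \<Rightarrow> (((nat \<Rightarrow> real) \<Rightarrow> real) \<Rightarrow> 'y::{ordered_real_vector,lattice}) \<Rightarrow> bool"
  where
  "krivine_calculus n y \<tau> \<longleftrightarrow>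
     (\<forall>f \<in> homogeneous_functions n. \<forall>g \<in> homogeneous_functions n.
        \<tau> (\<lambda>v. f v + g v) = \<tau> f + \<tau> g \<and>
        \<tau> (\<lambda>v. max (f v) (g v)) = sup (\<tau> f) (\<tau> g)) \<and>
     (\<forall>c. \<forall>f \<in> homogeneous_functions n. \<tau> (\<lambda>v. c * f v) = c *\<^sub>R \<tau> f) \<and>
     (\<forall>k<n. \<tau> (\<lambda>v. v k) = y k)"

definition lattice_lq_sum ::
    "real \<Rightarrow> nat \<Rightarrow> (nat \<Rightarrow> 'y::{ordered_real_vector,lattice}) \<Rightarrow> 'y" where
  "lattice_lq_sum q n y =
     (THE w. \<exists>\<tau>. krivine_calculus n y \<tau> \<and> w = \<tau> (\<lambda>v. (\<Sum>k<n. \<bar>v k\<bar> powr q) powr (1 / q)))"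

definition q_convex :: "real \<Rightarrow> ('y::{ordered_real_vector,lattice} \<Rightarrow> real) \<Rightarrow> bool" where
  "q_convex q N \<longleftrightarrow>
     (\<exists>C. \<forall>n. \<forall>z :: nat \<Rightarrow> 'y \<times> 'y.
        N (lattice_lq_sum q n (\<lambda>k. modulus (z k)))
          \<le> C * (\<Sum>k<n. complexification_norm N (z k) powr q) powr (1 / q))"


section \<open>Natural quasi-Banach spaces\<close>

text \<open>
  HOL cannot quantify existentially over the type \<open>'y\<close> of the lattice, so naturality is stated
  relative to a lattice quasinorm \<open>NY\<close> on a type \<open>'y\<close>. As a hypothesis of a theorem in
  which \<open>'y\<close> and \<open>NY\<close> are free, this is the same as the existence of a suitable lattice.
\<close>

definition natural_via ::
    "('y::{ordered_real_vector,lattice} \<Rightarrow> real) \<Rightarrow>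
     (complex \<Rightarrow> 'x::ab_group_add \<Rightarrow> 'x) \<Rightarrow> ('x \<Rightarrow> real) \<Rightarrow> bool" where
  "natural_via NY s N \<longleftrightarrow>
     quasi_banach_lattice NY \<and> (\<exists>q>0. q_convex q NY) \<and>
     (\<exists>T :: 'x \<Rightarrow> 'y \<times> 'y.
        Vector_Spaces.linear s complexification_scale T \<and>
        (\<exists>c>0. \<exists>C. \<forall>x. c * N x \<le> complexification_norm NY (T x) \<and>
                       complexification_norm NY (T x) \<le> C * N x) \<and>
        (\<forall>u l. range u \<subseteq> range T \<and> quasinorm_tendsto (complexification_norm NY) u l
           \<longrightarrow> l \<in> range T))"


section \<open>Compact abelian groups, Haar measure and Sidon sets\<close>

text \<open>
  Groups are written additively. For compact groups that are not metrizable, a translation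
  invariant probability measure on the Borel sets has to be regular to be the Haar measure.
\<close>

definition normalized_haar :: "'g::{topological_ab_group_add,t2_space} measure \<Rightarrow> bool" where
  "normalized_haar \<mu> \<longleftrightarrow>
     prob_space \<mu> \<and> sets \<mu> = sets borel \<and>
     (\<forall>a. distr \<mu> borel (\<lambda>x. a + x) = \<mu>) \<and>
     (\<forall>A \<in> sets borel. emeasure \<mu> A = (SUP K \<in> {K. compact K \<and> K \<subseteq> A}. emeasure \<mu> K))"

definition dual_group :: "('g::{topological_ab_group_add,t2_space} \<Rightarrow> complex) set" where
  "dual_group =
     {\<gamma>. continuous_on UNIV \<gamma> \<and> (\<forall>x y. \<gamma> (x + y) = \<gamma> x * \<gamma> y) \<and> (\<forall>x. cmod (\<gamma> x) = 1)}"

text \<open>The supremum below is a maximum because the group is compact.\<close>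

definition sidon_set :: "('g::{topological_ab_group_add,t2_space} \<Rightarrow> complex) set \<Rightarrow> bool" where
  "sidon_set E \<longleftrightarrow>
     E \<subseteq> dual_group \<and>
     (\<exists>M. \<forall>a :: ('g \<Rightarrow> complex) \<Rightarrow> complex. finite {\<gamma> \<in> E. a \<gamma> \<noteq> 0} \<longrightarrow>
        (\<Sum>\<gamma> | \<gamma> \<in> E \<and> a \<gamma> \<noteq> 0. cmod (a \<gamma>))
          \<le> M * (SUP g. cmod (\<Sum>\<gamma> | \<gamma> \<in> E \<and> a \<gamma> \<noteq> 0. a \<gamma> * \<gamma> g)))"


section \<open>The Cantor group\<close>

text \<open>
  The Haar measure of the multiplicative group \<open>{-1, 1}\<^sup>\<nat>\<close> is the product of the uniform measures on
  the factors. The lemmas below confirm this: it is a translation invariant probability measure on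
  the Borel sets of \<open>{-1, 1}\<^sup>\<nat>\<close> (which is metrizable, so that regularity is automatic).
\<close>

definition cantor_group :: "(nat \<Rightarrow> real) set" where
  "cantor_group = (UNIV :: nat set) \<rightarrow>\<^sub>E {-1, 1}"

definition cantor_haar :: "(nat \<Rightarrow> real) measure" where
  "cantor_haar = PiM UNIV (\<lambda>_. uniform_count_measure {-1, 1})"

lemma space_cantor_haar: "space cantor_haar = cantor_group"
  by (simp add: cantor_haar_def cantor_group_def space_PiM space_uniform_count_measure)

lemma prob_space_cantor_haar: "prob_space cantor_haar"
  unfolding cantor_haar_def
  by (intro prob_space_PiM prob_space_uniform_count_measure) auto

lemma sets_cantor_haar: "sets cantor_haar = sets (restrict_space borel cantor_group)"
proof
  have sp: "space (restrict_space borel cantor_group) = cantor_group"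
    by (simp add: space_restrict_space)
  show "sets cantor_haar \<subseteq> sets (restrict_space borel cantor_group)"
    unfolding cantor_haar_def
  proof (rule sets_PiM_in_sets)
    show "space (restrict_space borel cantor_group)
        = (\<Pi>\<^sub>E i\<in>UNIV. space (uniform_count_measure {-1, 1}))"
      unfolding sp by (simp add: cantor_group_def space_uniform_count_measure)
    fix i :: nat and A :: "real set"
    assume "A \<in> sets (uniform_count_measure {-1, 1})"
    then have "finite A"
      by (auto simp: sets_uniform_count_measure intro: finite_subset)
    then have "closed A"
      by (rule finite_imp_closed)
    then have "closed ((\<lambda>x :: nat \<Rightarrow> real. x i) -` A)"
      by (intro closed_vimage continuous_on_product_coordinates)
    then have "(\<lambda>x :: nat \<Rightarrow> real. x i) -` A \<in> sets borel"
      by (rule borel_closed)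
    moreover have "{x \<in> cantor_group. x i \<in> A} = cantor_group \<inter> (\<lambda>x. x i) -` A"
      by auto
    ultimately show "{x \<in> space (restrict_space borel cantor_group). x i \<in> A}
        \<in> sets (restrict_space borel cantor_group)"
      unfolding sp sets_restrict_space by auto
  qed
  show "sets (restrict_space borel cantor_group) \<subseteq> sets cantor_haar"
  proof
    fix A assume "A \<in> sets (restrict_space borel cantor_group)"
    then obtain B where B: "B \<in> sets borel" "A = cantor_group \<inter> B"
      by (auto simp: sets_restrict_space)
    have "(\<lambda>t. t i) \<in> borel_measurable cantor_haar" for i
    proof -
      have "(\<lambda>t. t i) \<in> measurable cantor_haar (uniform_count_measure {-1, 1})"
        unfolding cantor_haar_def by (rule measurable_component_singleton) simp
      moreover have "(\<lambda>x. x) \<in> borel_measurable (uniform_count_measure {-1, 1 :: real})"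
        by (auto simp: measurable_def space_uniform_count_measure sets_uniform_count_measure)
      ultimately show ?thesis
        by (rule measurable_compose)
    qed
    then have "(\<lambda>t. t) \<in> borel_measurable cantor_haar"
      by (rule measurable_coordinatewise_then_product)
    from measurable_sets[OF this B(1)] show "A \<in> sets cantor_haar"
      by (simp add: B(2) space_cantor_haar Int_commute)
  qed
qed

lemma cantor_haar_invariant:
  assumes "s \<in> cantor_group"
  shows "distr cantor_haar cantor_haar (\<lambda>t k. s k * t k) = cantor_haar"
proof -
  let ?U = "uniform_count_measure {-1, 1::real}"
  interpret product_prob_space "\<lambda>_::nat. ?U" UNIV
    by (intro product_prob_spaceI prob_space_uniform_count_measure) auto
  have s: "s k = -1 \<or> s k = 1" for k
    using assms by (auto simp: cantor_group_def)
  have meas: "(\<lambda>t k. s k * t k) \<in> measurable cantor_haar cantor_haar"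
  proof -
    have "(\<lambda>t. s k * t k) \<in> measurable cantor_haar ?U" for k
    proof -
      have 1: "(\<lambda>t. t k) \<in> measurable cantor_haar ?U"
        unfolding cantor_haar_def by (rule measurable_component_singleton) simp
      have 2: "(\<lambda>x. s k * x) \<in> measurable ?U ?U"
        using s[of k]
        by (auto simp: measurable_def space_uniform_count_measure sets_uniform_count_measure)
      show ?thesis using measurable_compose[OF 1 2] .
    qed
    moreover have "s k * t k = 1" if "t \<in> UNIV \<rightarrow>\<^sub>E {-1, 1}" "s k * t k \<noteq> -1" for t k
      using that s[of k] by (fastforce simp: PiE_iff)
    ultimately show ?thesis
      unfolding cantor_haar_def
      by (intro measurable_PiM_single') (auto simp: space_PiM space_uniform_count_measure)
  qed
  show ?thesis
    unfolding cantor_haar_def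
  proof (rule PiM_eq)
    fix J and F :: "nat \<Rightarrow> real set"
    assume J: "finite J" and F: "\<And>j. j \<in> J \<Longrightarrow> F j \<in> sets ?U"
    define F' where "F' j = {x \<in> {-1, 1}. s j * x \<in> F j}" for j
    have F': "F' j \<in> sets ?U" for j
      by (auto simp: F'_def sets_uniform_count_measure)
    have "emeasure ?U (F' j) = emeasure ?U (F j)" if "j \<in> J" for j
    proof -
      have sub: "F j \<subseteq> {-1, 1}"
        using F[OF that] by (simp add: sets_uniform_count_measure)
      have "bij_betw (\<lambda>x. s j * x) (F' j) (F j)"
        using s[of j] sub by (intro bij_betw_byWitness[where f' = "\<lambda>x. s j * x"]) (auto simp: F'_def)
      then have "card (F' j) = card (F j)"
        by (rule bij_betw_same_card)
      moreover have "F' j \<subseteq> {-1, 1}"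
        by (auto simp: F'_def)
      ultimately show ?thesis
        using sub by (simp add: emeasure_uniform_count_measure)
    qed
    then have prod: "(\<Prod>j\<in>J. emeasure ?U (F' j)) = (\<Prod>j\<in>J. emeasure ?U (F j))"
      by (rule prod.cong[OF refl])
    have emb: "(\<lambda>t k. s k * t k) -` prod_emb UNIV (\<lambda>_. ?U) J (Pi\<^sub>E J F) \<inter> space cantor_haar
        = prod_emb UNIV (\<lambda>_. ?U) J (Pi\<^sub>E J F')"
    proof (intro set_eqI)
      fix t
      have "s k * t k \<in> {-1, 1}" if "t k \<in> {-1, 1}" for k
        using that s[of k] by auto
      then show "t \<in> (\<lambda>t k. s k * t k) -` prod_emb UNIV (\<lambda>_. ?U) J (Pi\<^sub>E J F) \<inter> space cantor_haar
        \<longleftrightarrow> t \<in> prod_emb UNIV (\<lambda>_. ?U) J (Pi\<^sub>E J F')"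
        unfolding space_cantor_haar cantor_group_def F'_def
        by (simp add: prod_emb_def space_uniform_count_measure PiE_iff) blast
    qed
    have "prod_emb UNIV (\<lambda>_. ?U) J (Pi\<^sub>E J F) \<in> sets cantor_haar"
      unfolding cantor_haar_def using J F by (intro sets_PiM_I) auto
    then have "emeasure (distr cantor_haar cantor_haar (\<lambda>t k. s k * t k))
          (prod_emb UNIV (\<lambda>_. ?U) J (Pi\<^sub>E J F))
        = emeasure cantor_haar (prod_emb UNIV (\<lambda>_. ?U) J (Pi\<^sub>E J F'))"
      using meas emb by (simp add: emeasure_distr)
    also have "\<dots> = (\<Prod>j\<in>J. emeasure ?U (F' j))"
      unfolding cantor_haar_def using J F' by (intro emeasure_PiM_emb) auto
    finally show "emeasure (distr (PiM UNIV (\<lambda>_. ?U)) (PiM UNIV (\<lambda>_. ?U)) (\<lambda>t k. s k * t k))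
          (prod_emb UNIV (\<lambda>_. ?U) J (Pi\<^sub>E J F))
        = (\<Prod>j\<in>J. emeasure ?U (F j))"
      unfolding prod cantor_haar_def .
  qed simp
qed


section \<open>The property \<open>C\<^sub>p(X)\<close>\<close>

text \<open>
  The value is in \<^typ>\<open>ennreal\<close>, so that it is infinite when the integral diverges.
\<close>

definition Lp_quasinorm :: "ennreal \<Rightarrow> 'g measure \<Rightarrow> ('x \<Rightarrow> real) \<Rightarrow> ('g \<Rightarrow> 'x) \<Rightarrow> ennreal" where
  "Lp_quasinorm p \<mu> N \<phi> =
     (if p = \<infinity> then esssup \<mu> (\<lambda>g. ennreal (N (\<phi> g)))
      else let I = (\<integral>\<^sup>+ g. ennreal (N (\<phi> g) powr enn2real p) \<partial>\<mu>)
           in if I = \<infinity> then \<infinity> else ennreal (enn2real I powr (1 / enn2real p)))"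

definition property_C ::
    "ennreal \<Rightarrow> 'g::{topological_ab_group_add,t2_space} measure \<Rightarrow>
     (complex \<Rightarrow> 'x::ab_group_add \<Rightarrow> 'x) \<Rightarrow> ('x \<Rightarrow> real) \<Rightarrow> ('g \<Rightarrow> complex) set \<Rightarrow> bool" where
  "property_C p \<mu> s N E \<longleftrightarrow>
     (\<exists>M::real. 0 < M \<and>
       (\<forall>(n::nat) (\<gamma> :: nat \<Rightarrow> 'g \<Rightarrow> complex) (x :: nat \<Rightarrow> 'x).
          inj_on \<gamma> {..<n} \<and> \<gamma> ` {..<n} \<subseteq> E \<longrightarrow>
          ennreal (inverse M) *
              Lp_quasinorm p cantor_haar N (\<lambda>t. \<Sum>k<n. s (complex_of_real (t k)) (x k))
            \<le> Lp_quasinorm p \<mu> N (\<lambda>g. \<Sum>k<n. s (\<gamma> k g) (x k)) \<and>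
          Lp_quasinorm p \<mu> N (\<lambda>g. \<Sum>k<n. s (\<gamma> k g) (x k))
            \<le> ennreal M *
              Lp_quasinorm p cantor_haar N (\<lambda>t. \<Sum>k<n. s (complex_of_real (t k)) (x k))))"

end

theory Submission
  imports Defs
begin

text \<open>
  Why the theorem holds. Let \<open>\<gamma>\<^sub>1, \<dots>, \<gamma>\<^sub>n\<close> be characters in a Sidon set and let \<open>w\<^sub>1, \<dots>, w\<^sub>n\<close> be complex numbers of
  modulus at most one. There are finitely many points \<open>e\<^sub>d\<close> of \<open>G\<close> such that \<open>\<Sum>\<^sub>k |\<xi>\<^sub>k|\<close> is at most a constant times the maximum
  over \<open>d\<close> of \<open>|\<Sum>\<^sub>k \<gamma>\<^sub>k(e\<^sub>d) \<xi>\<^sub>k|\<close> (\<open>sidon_norming\<close>). The heart of the proof is a scalar inequality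
  (\<open>norming_matrix_domination\<close>): for each \<open>q\<close> in \<open>(0, 1]\<close> there are weights \<open>m\<^sub>d \<ge> 0\<close> of sum one, depending on \<open>w\<close> only, with
  
    \<open>|\<Sum>\<^sub>k w\<^sub>k \<xi>\<^sub>k|\<^sup>q \<le> C \<Sum>\<^sub>d m\<^sub>d |\<Sum>\<^sub>k \<gamma>\<^sub>k(e\<^sub>d) \<xi>\<^sub>k|\<^sup>q\<close> for all complex \<open>\<xi>\<^sub>1, \<dots>, \<xi>\<^sub>n\<close>,
  
  where \<open>C\<close> depends only on \<open>q\<close> and the Sidon constant. For \<open>q = 1\<close> this is duality. For \<open>q < 1\<close> it combines two ideas: operators
  from \<open>l\<^sub>1\<close> to a Hilbert space are absolutely summing (Grothendieck), and absolutely summing operators can be extrapolated to smaller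
  exponents (Maurey). Both are carried out at once, by improving the constant of a single inequality (\<open>l2_dominated_improve\<close>), and
  a minimax theorem (\<open>domination_minimax\<close>) yields the weights.
  
  Both sides of the inequality are \<open>q\<close>-th powers of positively homogeneous functions of \<open>\<xi>\<close>, so Krivine's calculus carries it over to vectors
  \<open>x\<^sub>k\<close> in the complexification of a lattice, and convexity of the lattice gives, for vectors of a natural space and all small \<open>q\<close>,
  
    \<open>N(\<Sum>\<^sub>k w\<^sub>k x\<^sub>k)\<^sup>q \<le> C \<Sum>\<^sub>d m\<^sub>d N(\<Sum>\<^sub>k \<gamma>\<^sub>k(e\<^sub>d) x\<^sub>k)\<^sup>q\<close>
  
  (\<open>natural_domination\<close>). The calculus is obtained from the lattice homomorphisms of principal ideals to the reals, of which there are enough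
  to separate points (\<open>lattice_state_exists\<close>).
  
  Replacing \<open>x\<^sub>k\<close> by \<open>\<gamma>\<^sub>k(g) x\<^sub>k\<close> makes the right-hand side an average of translates of \<open>N(\<Sum>\<^sub>k \<gamma>\<^sub>k(g) x\<^sub>k)\<^sup>q\<close>. Hence multiplying the \<open>x\<^sub>k\<close> by signs changes
  the \<open>L\<^sub>p\<close> quasinorm of \<open>\<Sum>\<^sub>k \<gamma>\<^sub>k x\<^sub>k\<close> at most by a constant factor. The sign functions are a Sidon set as well (\<open>signs_norming\<close>), so multiplying the \<open>x\<^sub>k\<close> by numbers
  of modulus one changes the \<open>L\<^sub>p\<close> quasinorm of \<open>\<Sum>\<^sub>k \<epsilon>\<^sub>k x\<^sub>k\<close> at most by a constant factor. Both sums are therefore comparable with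
  \<open>\<Sum>\<^sub>k \<epsilon>\<^sub>k \<gamma>\<^sub>k x\<^sub>k\<close> on \<open>\<Delta> \<times> G\<close> (\<open>Lp_comparison\<close>).
\<close>

section \<open>Domination by averages\<close>

text \<open>
  The ratios \<open>(1 - l) / l\<close> that work for a single \<open>a\<close> form an interval. It is bounded below by
  \<open>- f a / g a\<close> if \<open>f a < 0\<close>, and above by \<open>f a / - g a\<close> if \<open>g a < 0\<close>. If a lower bound exceeded an upper
  bound, \<open>f\<close> and \<open>g\<close> would both be negative at some \<open>t a + b\<close>, so the intervals have a common point.
\<close>

lemma cone_minimax_two:
  fixes C :: "'a set" and f g :: "'a \<Rightarrow> real"
  assumes add: "\<And>a b. a \<in> C \<Longrightarrow> b \<in> C \<Longrightarrow> \<exists>c\<in>C. f c = f a + f b \<and> g c = g a + g b"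
    and scale: "\<And>a t. a \<in> C \<Longrightarrow> t > 0 \<Longrightarrow> \<exists>c\<in>C. f c = t * f a \<and> g c = t * g a"
    and max: "\<And>a. a \<in> C \<Longrightarrow> 0 \<le> f a \<or> 0 \<le> g a"
  shows "\<exists>l. 0 \<le> l \<and> l \<le> 1 \<and> (\<forall>a\<in>C. 0 \<le> l * f a + (1 - l) * g a)"
proof -
  have cross: "f a * g b \<le> f b * g a" if a: "a \<in> C" "f a < 0" and b: "b \<in> C" "g b < 0" for a b
  proof (rule ccontr)
    assume neg: "\<not> f a * g b \<le> f b * g a"
    have ga: "0 \<le> g a" and fb: "0 \<le> f b" using max a b by force+
    \<comment> \<open>the two strict inequalities leave an interval of \<open>t\<close> for which \<open>t a + b\<close> violates \<open>max\<close>\<close>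
    have "\<exists>t>0. t * f a + f b < 0 \<and> t * g a + g b < 0"
    proof (cases "g a = 0")
      case True
      define t where "t = (f b + 1) / (- f a)"
      have "t > 0" using fb a(2) by (auto simp: t_def intro!: divide_pos_neg divide_pos_pos)
      moreover have "t * f a = - (f b + 1)" using a(2) by (simp add: t_def field_simps)
      ultimately show ?thesis using True b(2) by (intro exI[of _ t]) auto
    next
      case False
      then have ga': "g a > 0" using ga by simp
      have "f b / (- f a) < (- g b) / g a"
        using neg ga' a(2) by (simp add: field_simps)
      then obtain t where t: "f b / (- f a) < t" "t < (- g b) / g a" using dense by blast
      have "t > 0" using t(1) fb a(2)
        by (smt (verit) divide_nonneg_nonneg)
      moreover have "t * f a + f b < 0" using t(1) a(2) by (simp add: field_simps)
      moreover have "t * g a + g b < 0" using t(2) ga' by (simp add: field_simps)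
      ultimately show ?thesis by blast
    qed
    then obtain t where t: "t > 0" "t * f a + f b < 0" "t * g a + g b < 0" by blast
    obtain c where c: "c \<in> C" "f c = t * f a" "g c = t * g a" using scale[OF a(1) t(1)] by blast
    obtain e where "e \<in> C" "f e = f c + f b" "g e = g c + g b" using add[OF c(1) b(1)] by blast
    then show False using max[of e] c t by auto
  qed
  show ?thesis
  proof (cases "\<forall>b\<in>C. 0 \<le> g b")
    case True
    then show ?thesis by (intro exI[of _ 0]) auto
  next
    case False
    then obtain b0 where b0: "b0 \<in> C" "g b0 < 0" by force
    define R where "R = {f b / (- g b) | b. b \<in> C \<and> g b < 0}"
    define r where "r = Inf R"
    have Rne: "R \<noteq> {}" using b0 by (auto simp: R_def)
    have Rpos: "0 \<le> z" if zR: "z \<in> R" for z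
      
    proof -
      obtain b where b: "b \<in> C" "g b < 0" "z = f b / (- g b)" using zR unfolding R_def by blast
      then have "0 \<le> f b" using max[OF b(1)] by simp
      then show ?thesis using b by (simp add: divide_nonneg_neg)
    qed
    have bdd: "bdd_below R" using Rpos by (intro bdd_belowI[of _ 0])
    have r0: "0 \<le> r" unfolding r_def using Rne Rpos by (intro cInf_greatest)
    have main: "0 \<le> f a + r * g a" if a: "a \<in> C" for a
    proof (cases "g a < 0")
      case True
      then have "f a / (- g a) \<in> R" using a by (auto simp: R_def)
      then have "r \<le> f a / (- g a)" unfolding r_def using bdd by (rule cInf_lower)
      then show ?thesis using True by (simp add: field_simps)
    next
      case ga: False
      show ?thesis
      proof (cases "f a < 0")
        case False
        then show ?thesis using ga r0 by simp
      next
        case fa: True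
        have "g a \<noteq> 0"
        proof
          assume "g a = 0"
          then have "f a * g b0 \<le> 0" using cross[OF a fa b0] by simp
          then show False using fa b0 by (simp add: mult_le_0_iff)
        qed
        then have ga': "0 < g a" using ga by simp
        have "- f a / g a \<le> z" if "z \<in> R" for z
        proof -
          obtain b where b: "b \<in> C" "g b < 0" "z = f b / (- g b)" using \<open>z \<in> R\<close> unfolding R_def by blast
          have "(- f a) * (- g b) \<le> f b * g a" using cross[OF a fa b(1,2)] by simp
          then have "- f a / g a \<le> f b / (- g b)"
            using ga' b(2) mult_left_mono[of "(- f a) * (- g b)" "f b * g a" "1 / (g a * - g b)"]
            by (simp add: mult_pos_neg less_imp_le)
          then show ?thesis using b by simp
        qed
        then have "- f a / g a \<le> r" unfolding r_def using Rne by (intro cInf_greatest)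
        then show ?thesis using ga' by (simp add: field_simps)
      qed
    qed
    have "0 \<le> (1 / (1 + r)) * f a + (1 - 1 / (1 + r)) * g a" if "a \<in> C" for a
    proof -
      have "1 - 1 / (1 + r) = r / (1 + r)" using r0 by (simp add: diff_divide_eq_iff)
      then have "(1 / (1 + r)) * f a + (1 - 1 / (1 + r)) * g a = (f a + r * g a) / (1 + r)"
        by (simp add: add_divide_distrib)
      then show ?thesis using main[OF that] r0 by simp
    qed
    then show ?thesis using r0 by (intro exI[of _ "1 / (1 + r)"]) auto
  qed
qed

text \<open>
  A minimax theorem for cones, proved without a separation theorem so that the index set can be any
  finite set. In the induction step the members of the cone where \<open>f e\<close> is negative form a cone on
  which the remaining functions have a nonnegative maximum. The average found for that smaller cone
  and \<open>f e\<close> are then two functions with a nonnegative maximum on the whole cone.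
\<close>

lemma cone_minimax:
  fixes C :: "'a set" and f :: "'d \<Rightarrow> 'a \<Rightarrow> real"
  assumes "finite D" "D \<noteq> {}"
    and "\<And>a b. a \<in> C \<Longrightarrow> b \<in> C \<Longrightarrow> \<exists>c\<in>C. \<forall>d\<in>D. f d c = f d a + f d b"
    and "\<And>a t. a \<in> C \<Longrightarrow> t > 0 \<Longrightarrow> \<exists>c\<in>C. \<forall>d\<in>D. f d c = t * f d a"
    and "\<And>a. a \<in> C \<Longrightarrow> \<exists>d\<in>D. 0 \<le> f d a"
  shows "\<exists>m. (\<forall>d\<in>D. 0 \<le> m d) \<and> sum m D = 1 \<and> (\<forall>a\<in>C. 0 \<le> (\<Sum>d\<in>D. m d * f d a))"
  using assms
proof (induction D arbitrary: C rule: finite_ne_induct)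
  case (singleton x)
  then show ?case by (intro exI[of _ "\<lambda>_. 1"]) auto
next
  case (insert e D)
  define C' where "C' = {a \<in> C. f e a < 0}"
  have "\<exists>m. (\<forall>d\<in>D. 0 \<le> m d) \<and> sum m D = 1 \<and> (\<forall>a\<in>C'. 0 \<le> (\<Sum>d\<in>D. m d * f d a))"
  proof (rule insert.IH)
    fix a b assume "a \<in> C'" "b \<in> C'"
    then show "\<exists>c\<in>C'. \<forall>d\<in>D. f d c = f d a + f d b"
      using insert.prems(1)[of a b] unfolding C'_def by fastforce
  next
    fix a and t :: real assume "a \<in> C'" "t > 0"
    then obtain c where "c \<in> C" "\<forall>d\<in>insert e D. f d c = t * f d a"
      using insert.prems(2)[of a t] unfolding C'_def by auto
    then show "\<exists>c\<in>C'. \<forall>d\<in>D. f d c = t * f d a"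
      using \<open>a \<in> C'\<close> \<open>t > 0\<close> unfolding C'_def
      by (auto simp: mult_less_0_iff intro!: bexI[of _ c])
  next
    fix a assume "a \<in> C'"
    then show "\<exists>d\<in>D. 0 \<le> f d a" using insert.prems(3)[of a] unfolding C'_def by auto
  qed
  then obtain m where m: "\<forall>d\<in>D. 0 \<le> m d" "sum m D = 1"
    "\<forall>a\<in>C'. 0 \<le> (\<Sum>d\<in>D. m d * f d a)" by blast
  define g where "g a = (\<Sum>d\<in>D. m d * f d a)" for a
  have "\<exists>l. 0 \<le> l \<and> l \<le> 1 \<and> (\<forall>a\<in>C. 0 \<le> l * f e a + (1 - l) * g a)"
  proof (rule cone_minimax_two)
    fix a b assume "a \<in> C" "b \<in> C"
    from insert.prems(1)[OF this] obtain c where c: "c \<in> C" "\<forall>d\<in>insert e D. f d c = f d a + f d b"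
      by blast
    then show "\<exists>c\<in>C. f e c = f e a + f e b \<and> g c = g a + g b"
      by (auto simp: g_def sum.distrib algebra_simps intro!: bexI[of _ c])
  next
    fix a and t :: real assume "a \<in> C" "t > 0"
    from insert.prems(2)[OF this] obtain c where c: "c \<in> C" "\<forall>d\<in>insert e D. f d c = t * f d a"
      by blast
    then show "\<exists>c\<in>C. f e c = t * f e a \<and> g c = t * g a"
      by (auto simp: g_def sum_distrib_left algebra_simps intro!: bexI[of _ c])
  next
    fix a assume "a \<in> C"
    then show "0 \<le> f e a \<or> 0 \<le> g a" using m(3) unfolding C'_def g_def by force
  qed
  then obtain l where l: "0 \<le> l" "l \<le> 1" "\<forall>a\<in>C. 0 \<le> l * f e a + (1 - l) * g a" by blast
  define m' where "m' d = (if d = e then l else (1 - l) * m d)" for d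
  have eq: "(\<Sum>d\<in>D. m' d * h d) = (1 - l) * (\<Sum>d\<in>D. m d * h d)" for h
    unfolding sum_distrib_left using insert.hyps by (intro sum.cong) (auto simp: m'_def)
  show ?case
  proof (intro exI[of _ m'] conjI ballI)
    show "0 \<le> m' d" if "d \<in> insert e D" for d using that l m by (auto simp: m'_def)
    show "sum m' (insert e D) = 1"
      using insert.hyps eq[of "\<lambda>_. 1"] m(2) by (simp add: m'_def)
    show "0 \<le> (\<Sum>d\<in>insert e D. m' d * f d a)" if "a \<in> C" for a
      using insert.hyps eq[of "\<lambda>d. f d a"] l(3) that by (simp add: g_def m'_def)
  qed
qed

definition dominated_on_average ::
    "nat \<Rightarrow> real \<Rightarrow> (nat \<Rightarrow> 'x \<Rightarrow> real) \<Rightarrow> ('x \<Rightarrow> real) \<Rightarrow> bool" where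
  "dominated_on_average L C \<beta> \<alpha> \<longleftrightarrow>
     (\<exists>m. (\<forall>d<L. 0 \<le> m d) \<and> (\<Sum>d<L. m d) = 1 \<and> (\<forall>x. \<alpha> x \<le> C * (\<Sum>d<L. m d * \<beta> d x)))"

text \<open>
  Pietsch's domination theorem for finitely many points: an inequality between finite families and
  their maximum over \<open>d\<close> is the same as a pointwise inequality with an average over \<open>d\<close>. The sums of
  \<open>A * \<beta> d x - \<alpha> x\<close> over finite lists of points \<open>x\<close> form a cone, with concatenation as addition, and
  \<open>dom\<close> says that their maximum over \<open>d\<close> is nonnegative.
\<close>

lemma domination_minimax:
  fixes \<alpha> :: "'x \<Rightarrow> real" and \<beta> :: "nat \<Rightarrow> 'x \<Rightarrow> real"
  assumes L: "0 < L"
    and scale: "\<And>x t. t > 0 \<Longrightarrow> \<exists>y. \<alpha> y = t * \<alpha> x \<and> (\<forall>d<L. \<beta> d y = t * \<beta> d x)"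
    and dom: "\<And>(J::nat) x S. (\<And>d. d < L \<Longrightarrow> (\<Sum>j<J. \<beta> d (x j)) \<le> S) \<Longrightarrow> (\<Sum>j<J. \<alpha> (x j)) \<le> A * S"
    and A: "0 \<le> A"
  shows "dominated_on_average L A \<beta> \<alpha>"
proof -
  let ?f = "\<lambda>d xs. (\<Sum>x\<leftarrow>xs. A * \<beta> d x - \<alpha> x)"
  have "\<exists>m. (\<forall>d\<in>{..<L}. 0 \<le> m d) \<and> sum m {..<L} = 1 \<and>
          (\<forall>xs\<in>UNIV. 0 \<le> (\<Sum>d\<in>{..<L}. m d * ?f d xs))"
  proof (rule cone_minimax)
    show "\<exists>c\<in>UNIV. \<forall>d\<in>{..<L}. ?f d c = ?f d a + ?f d b" for a b
      by (intro bexI[of _ "a @ b"]) auto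
    show "\<exists>c\<in>UNIV. \<forall>d\<in>{..<L}. ?f d c = t * ?f d a" if t: "t > 0" for a t
    proof -
      obtain s where s: "\<And>x. \<alpha> (s x) = t * \<alpha> x \<and> (\<forall>d<L. \<beta> d (s x) = t * \<beta> d x)"
        using scale[OF t] by metis
      show ?thesis
        by (intro bexI[of _ "map s a"])
          (auto simp: s sum_list_const_mult[symmetric] o_def algebra_simps intro!: arg_cong[of _ _ sum_list])
    qed
    show "\<exists>d\<in>{..<L}. 0 \<le> ?f d xs" for xs
    proof (rule ccontr)
      assume "\<not> ?thesis"
      then have neg: "?f d xs < 0" if "d < L" for d using that by (meson not_le lessThan_iff)
      define x where "x j = xs ! j" for j
      have nth: "(\<Sum>y\<leftarrow>xs. h y) = (\<Sum>j<length xs. h (x j))" for h :: "'x \<Rightarrow> real"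
        by (simp add: sum_list_sum_nth x_def atLeast0LessThan)
      define S where "S = Max ((\<lambda>d. \<Sum>j<length xs. \<beta> d (x j)) ` {..<L})"
      have le: "(\<Sum>j<length xs. \<beta> d (x j)) \<le> S" if "d < L" for d
        unfolding S_def using that by (intro Max_ge) auto
      have "S \<in> (\<lambda>d. \<Sum>j<length xs. \<beta> d (x j)) ` {..<L}"
        unfolding S_def using L by (intro Max_in) auto
      then obtain d where d: "d < L" "S = (\<Sum>j<length xs. \<beta> d (x j))" by auto
      have "(\<Sum>j<length xs. \<alpha> (x j)) \<le> A * S" using le by (rule dom)
      moreover have "?f d xs = A * S - (\<Sum>j<length xs. \<alpha> (x j))"
        unfolding nth d(2) by (simp add: sum_subtractf sum_distrib_left)
      ultimately show False using neg[OF d(1)] by simp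
    qed
  qed (use L in auto)
  then obtain m where m: "\<forall>d<L. 0 \<le> m d" "(\<Sum>d<L. m d) = 1"
      "\<And>xs. 0 \<le> (\<Sum>d<L. m d * ?f d xs)" by auto
  have "\<alpha> x \<le> A * (\<Sum>d<L. m d * \<beta> d x)" for x
  proof -
    have "0 \<le> (\<Sum>d<L. A * (m d * \<beta> d x) - m d * \<alpha> x)"
      using m(3)[of "[x]"] by (simp add: algebra_simps)
    also have "\<dots> = A * (\<Sum>d<L. m d * \<beta> d x) - \<alpha> x"
      by (simp add: sum_subtractf sum_distrib_left sum_distrib_right[symmetric] m(2))
    finally show ?thesis by simp
  qed
  then show ?thesis unfolding dominated_on_average_def using m by blast
qed

section \<open>Power means\<close>

lemma powr_add_le:
  fixes a b q :: real
  assumes "0 \<le> a" "0 \<le> b" "0 < q" "q \<le> 1"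
  shows "(a + b) powr q \<le> a powr q + b powr q"
proof (cases "a + b = 0")
  case True
  then show ?thesis using assms by (simp add: add_nonneg_eq_0_iff)
next
  case False
  define s where "s = a + b"
  have s: "s > 0" using False assms by (simp add: s_def)
  have le: "x / s \<le> (x / s) powr q" if "0 \<le> x" "x \<le> s" for x
    using powr_mono'[of q 1 "x / s"] that assms s by (simp add: field_simps)
  have "1 = a / s + b / s" using s by (simp add: s_def add_divide_distrib[symmetric])
  also have "\<dots> \<le> (a / s) powr q + (b / s) powr q"
    using le[of a] le[of b] assms by (intro add_mono) (auto simp: s_def)
  also have "\<dots> = (a powr q + b powr q) / s powr q"
    using assms s by (simp add: powr_divide add_divide_distrib)
  finally show ?thesis using s by (simp add: s_def field_simps)
qed

lemma powr_jensen:
  fixes m y :: "'a \<Rightarrow> real"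
  assumes "\<And>i. i \<in> I \<Longrightarrow> 0 \<le> m i" "sum m I = 1" "\<And>i. i \<in> I \<Longrightarrow> 0 \<le> y i" "0 < s" "s \<le> 1"
  shows "(\<Sum>i\<in>I. m i * y i powr s) \<le> (\<Sum>i\<in>I. m i * y i) powr s"
proof -
  define b where "b = (\<Sum>i\<in>I. m i * y i)"
  have fin: "finite I" using assms(2) by (metis sum.infinite zero_neq_one)
  have b0: "0 \<le> b" unfolding b_def using assms by (intro sum_nonneg) auto
  show ?thesis
  proof (cases "b = 0")
    case True
    then have "m i * y i = 0" if "i \<in> I" for i
      using that assms fin unfolding b_def by (subst (asm) sum_nonneg_eq_0_iff) auto
    then have "m i * y i powr s = 0" if "i \<in> I" for i using that by fastforce
    then have "(\<Sum>i\<in>I. m i * y i powr s) = 0" by (intro sum.neutral) blast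
    then show ?thesis by simp
  next
    case False
    then have b: "b > 0" using b0 by simp
    have "y i powr s \<le> b powr s * (1 + s * (y i / b - 1))" if "i \<in> I" for i
    proof (cases "y i = 0")
      case True
      then show ?thesis using assms by simp
    next
      case False
      then have yi: "y i > 0" using assms(3)[OF that] by simp
      have "(y i / b) powr s * 1 powr (1 - s) \<le> s * (y i / b) + (1 - s) * 1"
        using assms yi b by (intro Youngs_inequality_0) auto
      then have "b powr s * (y i / b) powr s \<le> b powr s * (1 + s * (y i / b - 1))"
        by (intro mult_left_mono) (auto simp: algebra_simps)
      then show ?thesis using yi b by (simp add: powr_divide)
    qed
    then have "(\<Sum>i\<in>I. m i * y i powr s) \<le> (\<Sum>i\<in>I. m i * (b powr s * (1 + s * (y i / b - 1))))"
      using assms by (intro sum_mono mult_left_mono) auto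
    also have "\<dots> = b powr s * ((1 - s) * sum m I + s * (b / b))"
      unfolding b_def sum_distrib_left sum_divide_distrib sum.distrib[symmetric]
      by (intro sum.cong) (auto simp: algebra_simps)
    finally show ?thesis using b assms unfolding b_def by simp
  qed
qed

text \<open>
  The interpolation behind Maurey's extrapolation. If the first moment \<open>f\<close> is much smaller than the
  root of the second moment, the last term suffices. Otherwise the values above \<open>T = 2 * f / h\<^sup>2\<close>
  contribute at most \<open>f / 2\<close> to the first moment, and below \<open>T\<close> one has \<open>y \<le> T powr (1 - q) * y powr q\<close>.
  The point is that the factor \<open>\<eta>\<close> of the second moment can be made as small as desired.
\<close>

lemma L1_le_Lq_L2:
  fixes m y :: "'a \<Rightarrow> real"
  assumes m: "\<And>i. i \<in> I \<Longrightarrow> 0 \<le> m i" "sum m I = 1" and y: "\<And>i. i \<in> I \<Longrightarrow> 0 \<le> y i"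
    and q: "0 < q" "q \<le> 1" and \<eta>: "0 < \<eta>"
  defines "h \<equiv> \<eta> powr (1 / q)"
  shows "(\<Sum>i\<in>I. m i * y i) powr q
     \<le> 2 * (2 / h\<^sup>2) powr (1 - q) * (\<Sum>i\<in>I. m i * y i powr q) + \<eta> * (\<Sum>i\<in>I. m i * (y i)\<^sup>2) powr (q / 2)"
proof -
  define f where "f = (\<Sum>i\<in>I. m i * y i)"
  define a where "a = (\<Sum>i\<in>I. m i * y i powr q)"
  define b2 where "b2 = (\<Sum>i\<in>I. m i * (y i)\<^sup>2)"
  have nn: "0 \<le> f" "0 \<le> a" "0 \<le> b2" unfolding f_def a_def b2_def
    using assms by (auto intro!: sum_nonneg)
  have h: "h > 0" "h powr q = \<eta>" using \<eta> q by (auto simp: h_def powr_powr)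
  show ?thesis
  proof (cases "f \<le> h * sqrt b2")
    case True
    then have "f powr q \<le> (h * sqrt b2) powr q" using nn q by (intro powr_mono2) auto
    also have "\<dots> = \<eta> * b2 powr (q / 2)"
      using h nn by (simp add: powr_mult powr_half_sqrt[symmetric] powr_powr)
    finally show ?thesis using nn unfolding f_def a_def b2_def
      by (smt (verit) mult_nonneg_nonneg powr_ge_zero)
  next
    case False
    then have f: "f > 0" and b2: "b2 < (f / h)\<^sup>2"
    proof -
      show "f > 0" using False h nn by (smt (verit) mult_nonneg_nonneg real_sqrt_ge_zero)
      have "sqrt b2 < f / h" using False h by (simp add: field_simps)
      then have "(sqrt b2)\<^sup>2 < (f / h)\<^sup>2" using nn by (intro power_strict_mono) auto
      then show "b2 < (f / h)\<^sup>2" using nn by simp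
    qed
    define T where "T = 2 * f / h\<^sup>2"
    have T: "T > 0" using f h by (simp add: T_def)
    have pt: "y i \<le> T powr (1 - q) * y i powr q + (y i)\<^sup>2 / T" if "i \<in> I" for i
    proof (cases "y i \<le> T")
      case True
      show ?thesis
      proof (cases "y i = 0")
        case False
        then have "y i > 0" using y[OF that] by simp
        then have "y i = y i powr (1 - q) * y i powr q" by (simp add: powr_add[symmetric])
        also have "\<dots> \<le> T powr (1 - q) * y i powr q"
          using True y[OF that] q by (intro mult_right_mono powr_mono2) auto
        finally show ?thesis using T by (smt (verit) divide_nonneg_nonneg zero_le_power2)
      qed auto
    next
      case False
      then have "y i \<le> (y i)\<^sup>2 / T" using T y[OF that]
        by (simp add: field_simps power2_eq_square mult_right_mono)
      then show ?thesis by (smt (verit) mult_nonneg_nonneg powr_ge_zero)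
    qed
    have "f \<le> (\<Sum>i\<in>I. m i * (T powr (1 - q) * y i powr q + (y i)\<^sup>2 / T))"
      unfolding f_def using pt m by (intro sum_mono mult_left_mono) auto
    also have "\<dots> = T powr (1 - q) * a + b2 / T"
      unfolding a_def b2_def sum_distrib_left sum_divide_distrib sum.distrib[symmetric]
      by (intro sum.cong) (auto simp: algebra_simps)
    also have "b2 / T \<le> (f / h)\<^sup>2 / T" using b2 T by (intro divide_right_mono) auto
    also have "(f / h)\<^sup>2 / T = f / 2" using f h by (simp add: T_def power2_eq_square field_simps)
    finally have "f \<le> 2 * T powr (1 - q) * a" by simp
    also have "T powr (1 - q) = (2 / h\<^sup>2) powr (1 - q) * f powr (1 - q)"
      using f h powr_mult[of "2 / h\<^sup>2" f "1 - q"] by (simp add: T_def)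
    finally have "f powr (1 - q) * f powr q \<le> f powr (1 - q) * (2 * (2 / h\<^sup>2) powr (1 - q) * a)"
      using f by (simp add: powr_add[symmetric] algebra_simps)
    then have "f powr q \<le> 2 * (2 / h\<^sup>2) powr (1 - q) * a"
      using f by (simp add: mult_le_cancel_left)
    then show ?thesis unfolding f_def a_def b2_def using \<eta>
      by (smt (verit) mult_nonneg_nonneg powr_ge_zero)
  qed
qed

section \<open>Random signs\<close>

text \<open>
  A vector of signs is encoded by the set of the indices with sign \<open>1\<close>, so that the average over all
  sign vectors of length \<open>N\<close> is a sum over the subsets of \<open>{..<N}\<close>, divided by \<open>2 ^ N\<close>.
\<close>

definition sgn_of :: "nat set \<Rightarrow> nat \<Rightarrow> complex" where
  "sgn_of A i = (if i \<in> A then 1 else - 1)"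

lemma sum_Pow_Suc:
  fixes f :: "nat set \<Rightarrow> 'a::comm_monoid_add"
  shows "sum f (Pow {..<Suc N}) = (\<Sum>A\<in>Pow {..<N}. f A + f (insert N A))"
proof -
  have "Pow {..<Suc N} = Pow {..<N} \<union> insert N ` Pow {..<N}"
    by (simp add: lessThan_Suc Pow_insert)
  moreover have "Pow {..<N} \<inter> insert N ` Pow {..<N} = {}" by auto
  ultimately have "sum f (Pow {..<Suc N}) = sum f (Pow {..<N}) + sum f (insert N ` Pow {..<N})"
    by (simp add: sum.union_disjoint)
  also have "sum f (insert N ` Pow {..<N}) = (\<Sum>A\<in>Pow {..<N}. f (insert N A))"
    by (subst sum.reindex) (auto simp: inj_on_def dest!: insert_ident[THEN iffD1, rotated 2])
  finally show ?thesis by (simp add: sum.distrib)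
qed

definition sgn_sum :: "nat \<Rightarrow> (nat \<Rightarrow> complex) \<Rightarrow> nat set \<Rightarrow> complex" where
  "sgn_sum N h A = (\<Sum>i<N. h i * sgn_of A i)"

lemma sgn_sum_Suc:
  assumes "A \<in> Pow {..<N}"
  shows "sgn_sum (Suc N) h A = sgn_sum N h A - h N"
    "sgn_sum (Suc N) h (insert N A) = sgn_sum N h A + h N"
proof -
  have "N \<notin> A" using assms by auto
  then show "sgn_sum (Suc N) h A = sgn_sum N h A - h N" by (simp add: sgn_sum_def sgn_of_def)
  have "(\<Sum>i<N. h i * sgn_of (insert N A) i) = (\<Sum>i<N. h i * sgn_of A i)"
    by (intro sum.cong) (auto simp: sgn_of_def)
  then show "sgn_sum (Suc N) h (insert N A) = sgn_sum N h A + h N"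
    by (simp add: sgn_sum_def sgn_of_def)
qed

lemma cmod_add_sub_sq: "(cmod (z - w))\<^sup>2 + (cmod (z + w))\<^sup>2 = 2 * (cmod z)\<^sup>2 + 2 * (cmod w)\<^sup>2"
  unfolding cmod_power2 by (simp add: power2_eq_square algebra_simps)

lemma cmod_add_sub_pow4:
  "cmod (z - w) ^ 4 + cmod (z + w) ^ 4 \<le> 2 * cmod z ^ 4 + 12 * (cmod z)\<^sup>2 * (cmod w)\<^sup>2 + 2 * cmod w ^ 4"
proof -
  define r where "r = Re z * Re w + Im z * Im w"
  have sq: "(cmod (z - w))\<^sup>2 = (cmod z)\<^sup>2 + (cmod w)\<^sup>2 - 2 * r"
     "(cmod (z + w))\<^sup>2 = (cmod z)\<^sup>2 + (cmod w)\<^sup>2 + 2 * r"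
    unfolding cmod_power2 by (simp_all add: r_def power2_eq_square algebra_simps)
  have "r\<^sup>2 \<le> (cmod z)\<^sup>2 * (cmod w)\<^sup>2"
  proof -
    have "(cmod z)\<^sup>2 * (cmod w)\<^sup>2 - r\<^sup>2 = (Re z * Im w - Im z * Re w)\<^sup>2"
      unfolding cmod_power2 by (simp add: r_def power2_eq_square algebra_simps)
    then show ?thesis by (smt (verit) zero_le_power2)
  qed
  moreover have p4: "x ^ 4 = (x\<^sup>2)\<^sup>2" for x :: real by simp
  have "cmod (z - w) ^ 4 + cmod (z + w) ^ 4 = 2 * ((cmod z)\<^sup>2 + (cmod w)\<^sup>2)\<^sup>2 + 8 * r\<^sup>2"
    unfolding p4 sq by (simp add: power2_eq_square algebra_simps)
  ultimately show ?thesis unfolding p4 by (simp add: power2_sum algebra_simps)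
qed

lemma sgn_sum_second_moment:
  "(\<Sum>A\<in>Pow {..<N}. (cmod (sgn_sum N h A))\<^sup>2) = 2 ^ N * (\<Sum>i<N. (cmod (h i))\<^sup>2)"
proof (induction N)
  case 0 then show ?case by (simp add: sgn_sum_def)
next
  case (Suc N)
  have "(\<Sum>A\<in>Pow {..<Suc N}. (cmod (sgn_sum (Suc N) h A))\<^sup>2)
    = (\<Sum>A\<in>Pow {..<N}. 2 * (cmod (sgn_sum N h A))\<^sup>2 + 2 * (cmod (h N))\<^sup>2)"
    unfolding sum_Pow_Suc by (intro sum.cong) (auto simp: sgn_sum_Suc cmod_add_sub_sq)
  also have "\<dots> = 2 ^ Suc N * (\<Sum>i<Suc N. (cmod (h i))\<^sup>2)"
    by (simp add: sum.distrib sum_distrib_left[symmetric] Suc.IH card_Pow algebra_simps)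
  finally show ?case .
qed

lemma sgn_sum_fourth_moment:
  "(\<Sum>A\<in>Pow {..<N}. cmod (sgn_sum N h A) ^ 4) \<le> 2 ^ N * (3 * (\<Sum>i<N. (cmod (h i))\<^sup>2)\<^sup>2)"
proof (induction N)
  case 0 then show ?case by (simp add: sgn_sum_def)
next
  case (Suc N)
  define s where "s = (\<Sum>i<N. (cmod (h i))\<^sup>2)"
  define b where "b = (cmod (h N))\<^sup>2"
  have b4: "cmod (h N) ^ 4 = b\<^sup>2" by (simp add: b_def)
  have "(\<Sum>A\<in>Pow {..<Suc N}. cmod (sgn_sum (Suc N) h A) ^ 4)
    \<le> (\<Sum>A\<in>Pow {..<N}. 2 * cmod (sgn_sum N h A) ^ 4 + 12 * (cmod (sgn_sum N h A))\<^sup>2 * b + 2 * b\<^sup>2)"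
    unfolding sum_Pow_Suc b4[symmetric] unfolding b_def
    by (intro sum_mono) (simp only: sgn_sum_Suc cmod_add_sub_pow4)
  also have "\<dots> = 2 * (\<Sum>A\<in>Pow {..<N}. cmod (sgn_sum N h A) ^ 4) + 12 * b * (2 ^ N * s) + 2 * 2 ^ N * b\<^sup>2"
    unfolding s_def sgn_sum_second_moment[symmetric]
    by (simp add: sum.distrib sum_distrib_left sum_distrib_right card_Pow algebra_simps)
  also have "\<dots> \<le> 2 * (2 ^ N * (3 * s\<^sup>2)) + 12 * b * (2 ^ N * s) + 2 * 2 ^ N * b\<^sup>2"
    using Suc.IH by (simp add: s_def)
  also have "\<dots> = 2 ^ N * (6 * s\<^sup>2 + 12 * b * s + 2 * b\<^sup>2)" by (simp add: algebra_simps)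
  also have "\<dots> \<le> 2 ^ N * (6 * (s + b)\<^sup>2)"
    by (intro mult_left_mono) (auto simp: power2_sum algebra_simps)
  also have "\<dots> = 2 ^ Suc N * (3 * (\<Sum>i<Suc N. (cmod (h i))\<^sup>2)\<^sup>2)"
    by (simp add: s_def b_def)
  finally show ?case .
qed

text \<open>
  Khinchine's inequality. Since the fourth moment is at most three times the square of the second
  moment \<open>s\<close>, the values above \<open>T = sqrt (6 * s)\<close> carry at most half of the second moment, and below
  \<open>T\<close> one has \<open>y\<^sup>2 \<le> T powr (2 - q) * y powr q\<close>.
\<close>

lemma khinchine_lower:
  assumes q: "0 < q" "q \<le> 1"
  shows "2 ^ N * (\<Sum>i<N. (cmod (h i))\<^sup>2) powr (q / 2) \<le> 12 * (\<Sum>A\<in>Pow {..<N}. cmod (sgn_sum N h A) powr q)"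
proof -
  define s where "s = (\<Sum>i<N. (cmod (h i))\<^sup>2)"
  have s0: "0 \<le> s" unfolding s_def by (intro sum_nonneg) auto
  show ?thesis
  proof (cases "s = 0")
    case True
    then show ?thesis using q by (simp add: s_def[symmetric] sum_nonneg)
  next
    case False
    then have s: "s > 0" using s0 by simp
    define T where "T = sqrt (6 * s)"
    have T: "T > 0" "T\<^sup>2 = 6 * s" using s by (auto simp: T_def)
    have pt: "y\<^sup>2 \<le> T powr (2 - q) * y powr q + y ^ 4 / T\<^sup>2" if "0 \<le> y" for y
    proof (cases "y \<le> T")
      case True
      show ?thesis
      proof (cases "y = 0")
        case False
        then have y: "y > 0" using that by simp
        then have "y\<^sup>2 = y powr (2 - q) * y powr q" by (simp add: powr_add[symmetric])
        also have "\<dots> \<le> T powr (2 - q) * y powr q"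
          using True y q by (intro mult_right_mono powr_mono2) auto
        finally show ?thesis using T y by (smt (verit) divide_nonneg_nonneg zero_le_power)
      qed auto
    next
      case False
      then have "T\<^sup>2 * y\<^sup>2 \<le> y\<^sup>2 * y\<^sup>2" using T that by (intro mult_right_mono power_mono) auto
      moreover have "y\<^sup>2 * y\<^sup>2 = y ^ 4" by (simp add: power_add[symmetric])
      ultimately have "y\<^sup>2 \<le> y ^ 4 / T\<^sup>2" using T(1) by (simp add: pos_le_divide_eq mult.commute)
      then show ?thesis by (smt (verit) mult_nonneg_nonneg powr_ge_zero)
    qed
    let ?Z = "\<lambda>A. cmod (sgn_sum N h A)"
    have "2 ^ N * s \<le> (\<Sum>A\<in>Pow {..<N}. T powr (2 - q) * ?Z A powr q + ?Z A ^ 4 / T\<^sup>2)"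
      unfolding s_def sgn_sum_second_moment[symmetric] by (intro sum_mono pt) auto
    also have "\<dots> = T powr (2 - q) * (\<Sum>A\<in>Pow {..<N}. ?Z A powr q) + (\<Sum>A\<in>Pow {..<N}. ?Z A ^ 4) / T\<^sup>2"
      by (simp add: sum.distrib sum_distrib_left sum_divide_distrib)
    also have "(\<Sum>A\<in>Pow {..<N}. ?Z A ^ 4) / T\<^sup>2 \<le> 2 ^ N * (3 * s\<^sup>2) / T\<^sup>2"
      using sgn_sum_fourth_moment[of N h] unfolding s_def by (intro divide_right_mono) auto
    also have "\<dots> = 2 ^ N * s / 2" unfolding T(2) using s by (simp add: power2_eq_square)
    finally have 1: "2 ^ N * s \<le> 2 * (T powr (2 - q) * (\<Sum>A\<in>Pow {..<N}. ?Z A powr q))" by simp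
    have "T powr (2 - q) = (6 * s) powr ((2 - q) / 2)"
      using s by (simp add: T_def powr_half_sqrt[symmetric] powr_powr)
    also have "\<dots> = 6 powr ((2 - q) / 2) * s powr (1 - q / 2)"
      using s by (simp add: powr_mult diff_divide_distrib)
    also have "\<dots> \<le> 6 powr 1 * s powr (1 - q / 2)"
      using q by (intro mult_right_mono powr_mono) auto
    finally have "T powr (2 - q) \<le> 6 * s powr (1 - q / 2)" by simp
    then have "2 ^ N * s \<le> 2 * (6 * s powr (1 - q / 2) * (\<Sum>A\<in>Pow {..<N}. ?Z A powr q))"
      using 1 by (smt (verit) mult_right_mono sum_nonneg powr_ge_zero)
    moreover have "s = s powr (1 - q / 2) * s powr (q / 2)" using s by (simp add: powr_add[symmetric])
    ultimately have "s powr (1 - q / 2) * (2 ^ N * s powr (q / 2))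
        \<le> s powr (1 - q / 2) * (12 * (\<Sum>A\<in>Pow {..<N}. ?Z A powr q))"
      by (simp add: algebra_simps)
    then show ?thesis using s unfolding s_def[symmetric] by (simp add: mult_le_cancel_left)
  qed
qed

section \<open>A Grothendieck inequality for exponents at most one\<close>

lemma set_encode_less:
  assumes "A \<subseteq> {..<N}"
  shows "set_encode A < 2 ^ N"
proof -
  have "set_encode A \<le> (\<Sum>i<N. 2 ^ i)"
    unfolding set_encode_def using assms by (intro sum_mono2) auto
  also have "\<dots> = 2 ^ N - 1" using mask_eq_sum_exp_nat[of N] by (simp add: lessThan_def)
  also have "\<dots> < 2 ^ N" by simp
  finally show ?thesis .
qed

lemma bij_betw_set_decode_lessThan: "bij_betw set_decode {..<2 ^ N} (Pow {..<N})"
proof (rule bij_betw_byWitness[where f' = set_encode])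
  show "set_decode ` {..<2 ^ N} \<subseteq> Pow {..<N}"
  proof safe
    fix c i :: nat assume c: "c < 2 ^ N" "i \<in> set_decode c"
    show "i < N"
    proof (rule ccontr)
      assume "\<not> i < N"
      then have "(2::nat) ^ N \<le> 2 ^ i" by simp
      then have "c < 2 ^ i" using c(1) by linarith
      then have "c div 2 ^ i = 0" by (rule div_less)
      then show False using c by (simp add: set_decode_def)
    qed
  qed
  show "set_encode ` Pow {..<N} \<subseteq> {..<2 ^ N}"
    using set_encode_less by auto
qed (auto simp: finite_subset[OF _ finite_lessThan])

text \<open>
  The rows of the matrix stand for points of a group and the columns for characters. A Sidon set gives
  such matrices with \<open>M\<close> independent of the number \<open>n\<close> of characters, and the estimates of this section
  do not depend on \<open>n\<close> and \<open>L\<close> either.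
\<close>

locale norming_matrix =
  fixes n L :: nat and v :: "nat \<Rightarrow> nat \<Rightarrow> complex" and M :: real and q :: real
  assumes v_le: "d < L \<Longrightarrow> k < n \<Longrightarrow> cmod (v d k) \<le> 1"
    and norming: "\<exists>d<L. (\<Sum>k<n. cmod (x k)) \<le> M * cmod (\<Sum>k<n. v d k * x k)"
    and M1: "1 \<le> M"
    and q: "0 < q" "q \<le> 1"
begin

definition row :: "nat \<Rightarrow> (nat \<Rightarrow> complex) \<Rightarrow> complex" where
  "row d x = (\<Sum>k<n. v d k * x k)"

lemma L_pos: "0 < L"
  using norming[of "\<lambda>_. 0"] by auto

text \<open>
  The case \<open>q = 1\<close> of the domination theorem. After rotating the members of a family by phases \<open>\<theta> j\<close>, the
  sum of the moduli of the functional becomes its value at a single vector, whose \<open>l1\<close> norm is controlled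
  by the maximum over the rows.
\<close>

lemma dominated_by_L1_average:
  assumes w: "\<And>k. k < n \<Longrightarrow> cmod (w k) \<le> 1"
  shows "dominated_on_average L M (\<lambda>d x. cmod (row d x)) (\<lambda>x. cmod (\<Sum>k<n. w k * x k))"
proof (rule domination_minimax[OF L_pos])
  fix x and t :: real assume t: "t > 0"
  have "cmod (\<Sum>k<n. w k * (of_real t * x k)) = t * cmod (\<Sum>k<n. w k * x k)"
    using t by (simp add: mult.left_commute[of _ "of_real t"] sum_distrib_left[symmetric] norm_mult)
  moreover have "cmod (row d (\<lambda>k. of_real t * x k)) = t * cmod (row d x)" for d
    using t by (simp add: row_def mult.left_commute[of _ "of_real t"] sum_distrib_left[symmetric] norm_mult)
  ultimately have "cmod (\<Sum>k<n. w k * (of_real t * x k)) = t * cmod (\<Sum>k<n. w k * x k) \<and>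
      (\<forall>d<L. cmod (row d (\<lambda>k. of_real t * x k)) = t * cmod (row d x))" by blast
  then show "\<exists>y. cmod (\<Sum>k<n. w k * y k) = t * cmod (\<Sum>k<n. w k * x k) \<and>
      (\<forall>d<L. cmod (row d y) = t * cmod (row d x))" by (intro exI[of _ "\<lambda>k. of_real t * x k"])
next
  fix J :: nat and x S
  assume S: "\<And>d. d < L \<Longrightarrow> (\<Sum>j<J. cmod (row d (x j))) \<le> S"
  define \<theta> where "\<theta> j = cnj (sgn (\<Sum>k<n. w k * x j k))" for j
  have th: "cmod (\<theta> j) \<le> 1" for j by (simp add: \<theta>_def norm_sgn)
  have rot: "complex_of_real (cmod z) = cnj (sgn z) * z" for z
    proof (cases "z = 0")
    case False
    then have "cnj z * z = of_real (cmod z) * of_real (cmod z)"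
      using complex_norm_square[of z] by (simp add: power2_eq_square mult.commute)
    then show ?thesis using False by (simp add: sgn_eq)
  qed simp
  have "complex_of_real (\<Sum>j<J. cmod (\<Sum>k<n. w k * x j k)) = (\<Sum>j<J. \<theta> j * (\<Sum>k<n. w k * x j k))"
    unfolding of_real_sum rot \<theta>_def ..
  also have "\<dots> = (\<Sum>k<n. w k * (\<Sum>j<J. \<theta> j * x j k))"
    unfolding sum_distrib_left by (subst sum.swap) (simp add: algebra_simps)
  finally have "cmod (complex_of_real (\<Sum>j<J. cmod (\<Sum>k<n. w k * x j k))) \<le> (\<Sum>k<n. cmod (w k * (\<Sum>j<J. \<theta> j * x j k)))"
    by (simp only: norm_sum)
  also have "\<dots> \<le> (\<Sum>k<n. cmod (\<Sum>j<J. \<theta> j * x j k))"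
    using w by (intro sum_mono) (auto simp: norm_mult mult_left_le_one_le)
  finally have 1: "(\<Sum>j<J. cmod (\<Sum>k<n. w k * x j k)) \<le> (\<Sum>k<n. cmod (\<Sum>j<J. \<theta> j * x j k))"
    unfolding norm_of_real by linarith
  obtain d where d: "d < L" "(\<Sum>k<n. cmod (\<Sum>j<J. \<theta> j * x j k)) \<le> M * cmod (row d (\<lambda>k. \<Sum>j<J. \<theta> j * x j k))"
    using norming[of "\<lambda>k. \<Sum>j<J. \<theta> j * x j k"] unfolding row_def by blast
  have "row d (\<lambda>k. \<Sum>j<J. \<theta> j * x j k) = (\<Sum>j<J. \<theta> j * row d (x j))"
    unfolding row_def sum_distrib_left by (subst sum.swap) (simp add: algebra_simps)
  also have "cmod \<dots> \<le> (\<Sum>j<J. cmod (row d (x j)))"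
    using th by (intro sum_norm_le) (auto simp: norm_mult mult_left_le_one_le)
  finally have "cmod (row d (\<lambda>k. \<Sum>j<J. \<theta> j * x j k)) \<le> S" using S[OF d(1)] by simp
  then have "M * cmod (row d (\<lambda>k. \<Sum>j<J. \<theta> j * x j k)) \<le> M * S" using M1 by (intro mult_left_mono) auto
  then show "(\<Sum>j<J. cmod (\<Sum>k<n. w k * x j k)) \<le> M * S" using 1 d by linarith
qed (use M1 in auto)

text \<open>
  The vectors \<open>u k\<close> define an operator from \<open>l1\<close> to a Hilbert space which maps the \<open>k\<close>-th unit vector to
  \<open>u k\<close> and has norm at most one. Uniformly in these operators, the sum of the \<open>q\<close>-th powers of the norms of
  the images of finitely many vectors is at most \<open>A\<close> times the largest sum of \<open>q\<close>-th powers in a row. For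
  \<open>q = 1\<close> this is Grothendieck's theorem that such operators are absolutely summing.
\<close>

definition l2_dominated :: "real \<Rightarrow> bool" where
  "l2_dominated A \<longleftrightarrow>
     (\<forall>(N::nat) u. (\<forall>k<n. (\<Sum>i<N. (cmod (u k i))\<^sup>2) \<le> 1) \<longrightarrow>
       (\<forall>(J::nat) x S. (\<forall>d<L. (\<Sum>j<J. cmod (row d (x j)) powr q) \<le> S) \<longrightarrow>
         (\<Sum>j<J. (\<Sum>i<N. (cmod (\<Sum>k<n. x j k * u k i))\<^sup>2) powr (q / 2)) \<le> A * S))"

lemma l2_dominatedD:
  fixes N J :: nat
  assumes "l2_dominated A" "\<And>k. k < n \<Longrightarrow> (\<Sum>i<N. (cmod (u k i))\<^sup>2) \<le> 1"
    "\<And>d. d < L \<Longrightarrow> (\<Sum>j<J. cmod (row d (x j)) powr q) \<le> S"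
  shows "(\<Sum>j<J. (\<Sum>i<N. (cmod (\<Sum>k<n. x j k * u k i))\<^sup>2) powr (q / 2)) \<le> A * S"
proof -
  have "\<forall>k<n. (\<Sum>i<N. (cmod (u k i))\<^sup>2) \<le> 1" "\<forall>d<L. (\<Sum>j<J. cmod (row d (x j)) powr q) \<le> S"
    using assms by auto
  then show ?thesis using assms(1) unfolding l2_dominated_def by simp
qed

lemma l2_triangle:
  fixes u :: "nat \<Rightarrow> nat \<Rightarrow> complex"
  assumes "\<And>k. k < n \<Longrightarrow> (\<Sum>i<N. (cmod (u k i))\<^sup>2) \<le> 1"
  shows "sqrt (\<Sum>i<N. (cmod (\<Sum>k<n. x k * u k i))\<^sup>2) \<le> (\<Sum>k<n. cmod (x k))"
proof -
  have "L2_set (\<lambda>i. cmod (\<Sum>k<m. x k * u k i)) {..<N} \<le> (\<Sum>k<m. cmod (x k))" if "m \<le> n" for m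
    using that
  proof (induction m)
    case 0 then show ?case by (simp add: L2_set_def)
  next
    case (Suc m)
    have "L2_set (\<lambda>i. cmod (\<Sum>k<Suc m. x k * u k i)) {..<N}
        \<le> L2_set (\<lambda>i. cmod (\<Sum>k<m. x k * u k i) + cmod (x m) * cmod (u m i)) {..<N}"
      by (intro L2_set_mono) (auto simp: norm_mult[symmetric] norm_triangle_ineq)
    also have "\<dots> \<le> L2_set (\<lambda>i. cmod (\<Sum>k<m. x k * u k i)) {..<N} + L2_set (\<lambda>i. cmod (x m) * cmod (u m i)) {..<N}"
      by (rule L2_set_triangle_ineq)
    also have "L2_set (\<lambda>i. cmod (x m) * cmod (u m i)) {..<N} = cmod (x m) * L2_set (\<lambda>i. cmod (u m i)) {..<N}"
      by (simp add: L2_set_right_distrib)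
    also have "\<dots> \<le> cmod (x m)"
      using assms[of m] Suc.prems by (intro mult_right_le_one_le) (auto simp: L2_set_def sum_nonneg)
    finally show ?case using Suc by simp
  qed
  then show ?thesis unfolding L2_set_def by simp
qed

text \<open>
  This constant depends on \<open>L\<close>. It only serves to start the iteration of \<open>l2_dominated_improve\<close>, whose limit
  does not.
\<close>

lemma l2_dominated_trivial: "\<exists>A\<ge>0. l2_dominated A"
proof (intro exI[of _ "L * M powr q"] conjI)
  show "l2_dominated (real L * M powr q)"
    unfolding l2_dominated_def
  proof (intro allI impI)
    fix N J :: nat and u and x :: "nat \<Rightarrow> nat \<Rightarrow> complex" and S
    assume u: "\<forall>k<n. (\<Sum>i<N. (cmod (u k i))\<^sup>2) \<le> 1"
      and S: "\<forall>d<L. (\<Sum>j<J. cmod (row d (x j)) powr q) \<le> S"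
    have "(\<Sum>i<N. (cmod (\<Sum>k<n. x j k * u k i))\<^sup>2) powr (q / 2) \<le> M powr q * (\<Sum>d<L. cmod (row d (x j)) powr q)" for j
    proof -
      obtain d where d: "d < L" "(\<Sum>k<n. cmod (x j k)) \<le> M * cmod (row d (x j))"
        using norming unfolding row_def by blast
      have "(\<Sum>i<N. (cmod (\<Sum>k<n. x j k * u k i))\<^sup>2) powr (q / 2) =
          (sqrt (\<Sum>i<N. (cmod (\<Sum>k<n. x j k * u k i))\<^sup>2)) powr q"
        by (simp add: powr_half_sqrt[symmetric] powr_powr sum_nonneg)
      also have "\<dots> \<le> (M * cmod (row d (x j))) powr q"
        using l2_triangle[of u N "x j"] u d q by (intro powr_mono2) (auto simp: sum_nonneg)
      also have "\<dots> = M powr q * cmod (row d (x j)) powr q" using M1 by (simp add: powr_mult)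
      also have "\<dots> \<le> M powr q * (\<Sum>d<L. cmod (row d (x j)) powr q)"
        using d by (intro mult_left_mono member_le_sum) auto
      finally show ?thesis .
    qed
    then have "(\<Sum>j<J. (\<Sum>i<N. (cmod (\<Sum>k<n. x j k * u k i))\<^sup>2) powr (q / 2))
       \<le> (\<Sum>j<J. M powr q * (\<Sum>d<L. cmod (row d (x j)) powr q))" by (intro sum_mono)
    also have "\<dots> = M powr q * (\<Sum>d<L. \<Sum>j<J. cmod (row d (x j)) powr q)"
      by (subst sum.swap) (simp add: sum_distrib_left)
    also have "\<dots> \<le> M powr q * (\<Sum>d<L. S)" using S by (intro mult_left_mono sum_mono) auto
    finally show "(\<Sum>j<J. (\<Sum>i<N. (cmod (\<Sum>k<n. x j k * u k i))\<^sup>2) powr (q / 2)) \<le> real L * M powr q * S"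
      by (simp add: mult_ac)
  qed
qed simp

text \<open>
  By \<open>dominated_by_L1_average\<close> the functional is bounded by a first moment with respect to weights \<open>m\<close>, and
  \<open>L1_le_Lq_L2\<close> splits its \<open>q\<close>-th power. The sum of the \<open>q\<close>-th moments is at most \<open>S\<close>. The second moments are
  squared norms in the Hilbert space with weights \<open>m\<close>, so they fall under \<open>A\<close>, which thus enters only
  with the small factor \<open>\<eta>\<close>.
\<close>

lemma functional_dominated:
  fixes J :: nat
  assumes A: "l2_dominated A" and w: "\<And>k. k < n \<Longrightarrow> cmod (w k) \<le> 1" and \<eta>: "0 < \<eta>"
    and S: "\<And>d. d < L \<Longrightarrow> (\<Sum>j<J. cmod (row d (x j)) powr q) \<le> S"
  shows "(\<Sum>j<J. cmod (\<Sum>k<n. w k * x j k) powr q)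
     \<le> M powr q * (2 * (2 / (\<eta> powr (1 / q))\<^sup>2) powr (1 - q) + \<eta> * A) * S"
proof -
  define K where "K = 2 * (2 / (\<eta> powr (1 / q))\<^sup>2) powr (1 - q)"
  obtain m where m: "\<And>d. d < L \<Longrightarrow> 0 \<le> m d" "(\<Sum>d<L. m d) = 1"
     "\<And>x. cmod (\<Sum>k<n. w k * x k) \<le> M * (\<Sum>d<L. m d * cmod (row d x))"
    using dominated_by_L1_average[of w] w unfolding dominated_on_average_def by blast
  define u where "u k d = of_real (sqrt (m d)) * v d k" for k d
  have u: "(\<Sum>d<L. (cmod (u k d))\<^sup>2) \<le> 1" if "k < n" for k
  proof -
    have "(\<Sum>d<L. (cmod (u k d))\<^sup>2) \<le> (\<Sum>d<L. m d * 1)"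
      using v_le[OF _ that] m(1)
      by (intro sum_mono) (auto simp: u_def norm_mult power_mult_distrib intro!: mult_left_le power_le_one)
    then show ?thesis using m(2) by simp
  qed
  have xu: "(\<Sum>d<L. (cmod (\<Sum>k<n. y k * u k d))\<^sup>2) = (\<Sum>d<L. m d * (cmod (row d y))\<^sup>2)" for y
  proof (intro sum.cong refl)
    fix d assume "d \<in> {..<L}"
    have "(\<Sum>k<n. y k * u k d) = of_real (sqrt (m d)) * row d y"
      by (simp add: row_def u_def sum_distrib_left mult_ac)
    then show "(cmod (\<Sum>k<n. y k * u k d))\<^sup>2 = m d * (cmod (row d y))\<^sup>2"
      using m(1) \<open>d \<in> _\<close> by (simp add: norm_mult power_mult_distrib)
  qed
  have "cmod (\<Sum>k<n. w k * x j k) powr q \<le> M powr q * (K * (\<Sum>d<L. m d * cmod (row d (x j)) powr q)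
         + \<eta> * (\<Sum>d<L. m d * (cmod (row d (x j)))\<^sup>2) powr (q / 2))" for j
  proof -
    have "cmod (\<Sum>k<n. w k * x j k) powr q \<le> (M * (\<Sum>d<L. m d * cmod (row d (x j)))) powr q"
      using m q by (intro powr_mono2) auto
    also have "\<dots> = M powr q * (\<Sum>d<L. m d * cmod (row d (x j))) powr q"
      using M1 m by (subst powr_mult) (auto intro!: sum_nonneg)
    also have "\<dots> \<le> M powr q * (K * (\<Sum>d<L. m d * cmod (row d (x j)) powr q)
         + \<eta> * (\<Sum>d<L. m d * (cmod (row d (x j)))\<^sup>2) powr (q / 2))"
      unfolding K_def using m q \<eta> by (intro mult_left_mono L1_le_Lq_L2) auto
    finally show ?thesis .
  qed
  then have "(\<Sum>j<J. cmod (\<Sum>k<n. w k * x j k) powr q) \<le>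
    (\<Sum>j<J. M powr q * (K * (\<Sum>d<L. m d * cmod (row d (x j)) powr q)
         + \<eta> * (\<Sum>d<L. m d * (cmod (row d (x j)))\<^sup>2) powr (q / 2)))" by (intro sum_mono)
  also have "\<dots> = M powr q * (K * (\<Sum>j<J. \<Sum>d<L. m d * cmod (row d (x j)) powr q)
      + \<eta> * (\<Sum>j<J. (\<Sum>d<L. (cmod (\<Sum>k<n. x j k * u k d))\<^sup>2) powr (q / 2)))"
    unfolding xu by (simp add: sum.distrib sum_distrib_left algebra_simps)
  also have "\<dots> \<le> M powr q * (K * S + \<eta> * (A * S))"
  proof (intro mult_left_mono add_mono)
    have "(\<Sum>j<J. \<Sum>d<L. m d * cmod (row d (x j)) powr q) = (\<Sum>d<L. m d * (\<Sum>j<J. cmod (row d (x j)) powr q))"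
      by (subst sum.swap) (simp add: sum_distrib_left)
    also have "\<dots> \<le> (\<Sum>d<L. m d * S)" using m S by (intro sum_mono mult_left_mono) auto
    also have "\<dots> = S" using m by (simp add: sum_distrib_right[symmetric])
    finally show "(\<Sum>j<J. \<Sum>d<L. m d * cmod (row d (x j)) powr q) \<le> S" .
    show "(\<Sum>j<J. (\<Sum>d<L. (cmod (\<Sum>k<n. x j k * u k d))\<^sup>2) powr (q / 2)) \<le> A * S"
      by (rule l2_dominatedD[OF A u S])
  qed (use \<eta> in \<open>auto simp: K_def\<close>)
  finally show ?thesis unfolding K_def by (simp add: algebra_simps)
qed

text \<open>
  Khinchine's inequality replaces the Hilbert space norm of \<open>\<Sum>k. x k * u k\<close> by an average over signs of
  \<open>\<bar>\<Sum>k. x k * Z k\<bar> powr q\<close>, where \<open>Z k\<close> is the random sum of the coordinates of \<open>u k\<close>. Truncated at the level \<open>T\<close>,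
  the \<open>Z k\<close> are bounded coefficients, to which \<open>functional_dominated\<close> applies. By the fourth moment bound, the
  tails have norm at most \<open>sqrt 3 / T\<close> in the Hilbert space of functions of the signs, so that they fall under \<open>A\<close>
  once more. For large \<open>T\<close> and then small \<open>\<eta>\<close>, the total coefficient of \<open>A\<close> is small.
\<close>

lemma l2_dominated_improve:
  assumes A: "l2_dominated A" "0 \<le> A" and T: "0 < T" and \<eta>: "0 < \<eta>"
  shows "l2_dominated (12 * (T powr q * (M powr q * (2 * (2 / (\<eta> powr (1 / q))\<^sup>2) powr (1 - q) + \<eta> * A))
      + (sqrt 3 / T) powr q * A))"
  unfolding l2_dominated_def
proof (intro allI impI)
  fix N J :: nat and u and x :: "nat \<Rightarrow> nat \<Rightarrow> complex" and S
  assume u: "\<forall>k<n. (\<Sum>i<N. (cmod (u k i))\<^sup>2) \<le> 1"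
    and S: "\<forall>d<L. (\<Sum>j<J. cmod (row d (x j)) powr q) \<le> S"
  define B where "B = M powr q * (2 * (2 / (\<eta> powr (1 / q))\<^sup>2) powr (1 - q) + \<eta> * A)"
  define Z where "Z k a = sgn_sum N (u k) a" for k a
  define Zt where "Zt k a = (if cmod (Z k a) \<le> T then Z k a else 0)" for k a
  define R where "R k a = Z k a - Zt k a" for k a
  have lin: "sgn_sum N (\<lambda>i. \<Sum>k<n. x j k * u k i) a = (\<Sum>k<n. x j k * Zt k a) + (\<Sum>k<n. x j k * R k a)" for j a
  proof -
    have "sgn_sum N (\<lambda>i. \<Sum>k<n. x j k * u k i) a = (\<Sum>k<n. x j k * Z k a)"
      unfolding sgn_sum_def Z_def sum_distrib_right sum_distrib_left by (subst sum.swap) (simp add: mult_ac)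
    then show ?thesis by (simp add: R_def algebra_simps sum_subtractf)
  qed
  have bounded_part: "(\<Sum>j<J. cmod (\<Sum>k<n. x j k * Zt k a) powr q) \<le> T powr q * (B * S)" for a
  proof -
    have "(\<Sum>j<J. cmod (\<Sum>k<n. (Zt k a / T) * x j k) powr q) \<le> B * S"
      unfolding B_def using S T \<eta> A by (intro functional_dominated) (auto simp: Zt_def norm_divide)
    moreover have "cmod (\<Sum>k<n. x j k * Zt k a) powr q = T powr q * cmod (\<Sum>k<n. (Zt k a / T) * x j k) powr q" for j
    proof -
      have "(\<Sum>k<n. x j k * Zt k a) = of_real T * (\<Sum>k<n. (Zt k a / T) * x j k)"
        using T by (simp add: sum_distrib_left mult_ac)
      then show ?thesis using T by (simp add: norm_mult powr_mult)
    qed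
    ultimately show ?thesis using T by (simp add: sum_distrib_left[symmetric])
  qed
  \<comment> \<open>the tails, normalised to norm one and indexed by numbers as \<open>l2_dominated\<close> requires\<close>
  define r where "r k c = of_real (T / sqrt 3 / sqrt (2 ^ N)) * R k (set_decode c)" for k c
  have codes: "bij_betw set_decode {..<2 ^ N} (Pow {..<N})"
    by (rule bij_betw_set_decode_lessThan)
  have code_sum: "(\<Sum>c<2 ^ N. h (set_decode c)) = (\<Sum>a\<in>Pow {..<N}. h a)" for h :: "nat set \<Rightarrow> real"
    using sum.reindex_bij_betw[OF codes] by simp
  have r: "(\<Sum>c<2 ^ N. (cmod (r k c))\<^sup>2) \<le> 1" if "k < n" for k
  proof -
    have "(cmod (R k a))\<^sup>2 \<le> cmod (Z k a) ^ 4 / T\<^sup>2" for a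
    proof (cases "cmod (Z k a) \<le> T")
      case False
      then have "T\<^sup>2 * (cmod (Z k a))\<^sup>2 \<le> (cmod (Z k a))\<^sup>2 * (cmod (Z k a))\<^sup>2"
        using T by (intro mult_right_mono power_mono) auto
      moreover have "(cmod (Z k a))\<^sup>2 * (cmod (Z k a))\<^sup>2 = cmod (Z k a) ^ 4" by (simp add: power_add[symmetric])
      ultimately show ?thesis using T False by (simp add: R_def Zt_def pos_le_divide_eq mult.commute)
    qed (simp add: R_def Zt_def)
    then have "(\<Sum>a\<in>Pow {..<N}. (cmod (R k a))\<^sup>2) \<le> (\<Sum>a\<in>Pow {..<N}. cmod (Z k a) ^ 4) / T\<^sup>2"
      unfolding sum_divide_distrib by (intro sum_mono)
    also have "\<dots> \<le> (2 ^ N * (3 * (\<Sum>i<N. (cmod (u k i))\<^sup>2)\<^sup>2)) / T\<^sup>2"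
      unfolding Z_def by (intro divide_right_mono sgn_sum_fourth_moment) auto
    also have "\<dots> \<le> (2 ^ N * (3 * 1)) / T\<^sup>2"
      using u that by (intro divide_right_mono mult_left_mono power_le_one sum_nonneg) auto
    finally have *: "(\<Sum>a\<in>Pow {..<N}. (cmod (R k a))\<^sup>2) \<le> 2 ^ N * 3 / T\<^sup>2" by simp
    have "(\<Sum>c<2 ^ N. (cmod (r k c))\<^sup>2) = (T\<^sup>2 / 3 / 2 ^ N) * (\<Sum>a\<in>Pow {..<N}. (cmod (R k a))\<^sup>2)"
      unfolding code_sum[symmetric] using T
      by (simp add: r_def norm_mult norm_divide power_mult_distrib power_divide sum_distrib_left)
    also have "\<dots> \<le> (T\<^sup>2 / 3 / 2 ^ N) * (2 ^ N * 3 / T\<^sup>2)" using * by (intro mult_left_mono) auto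
    also have "\<dots> = 1" using T by simp
    finally show ?thesis .
  qed
  have tail: "(\<Sum>j<J. (\<Sum>a\<in>Pow {..<N}. cmod (\<Sum>k<n. x j k * R k a) powr q)) \<le> 2 ^ N * ((sqrt 3 / T) powr q * (A * S))"
  proof -
    have "(\<Sum>a\<in>Pow {..<N}. cmod (\<Sum>k<n. x j k * R k a) powr q)
       \<le> 2 ^ N * ((sqrt 3 / T) powr q * (\<Sum>c<2 ^ N. (cmod (\<Sum>k<n. x j k * r k c))\<^sup>2) powr (q / 2))" for j
    proof -
      let ?y = "\<lambda>a. (cmod (\<Sum>k<n. x j k * R k a))\<^sup>2"
      have sq: "(\<Sum>c<2 ^ N. (cmod (\<Sum>k<n. x j k * r k c))\<^sup>2) = (T\<^sup>2 / 3) * (\<Sum>a\<in>Pow {..<N}. (1 / 2 ^ N) * ?y a)"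
      proof -
        have "(\<Sum>k<n. x j k * r k c) = of_real (T / sqrt 3 / sqrt (2 ^ N)) * (\<Sum>k<n. x j k * R k (set_decode c))" for c
          unfolding r_def sum_distrib_left by (intro sum.cong) (simp_all only: mult_ac)
        then have "(cmod (\<Sum>k<n. x j k * r k c))\<^sup>2 = (T\<^sup>2 / 3) * ((1 / 2 ^ N) * ?y (set_decode c))" for c
          by (simp add: norm_mult norm_divide power_mult_distrib power_divide)
        then show ?thesis unfolding code_sum[symmetric] by (simp add: sum_distrib_left)
      qed
      have "(\<Sum>a\<in>Pow {..<N}. (1 / 2 ^ N) * ?y a powr (q / 2)) \<le> (\<Sum>a\<in>Pow {..<N}. (1 / 2 ^ N) * ?y a) powr (q / 2)"
        using q by (intro powr_jensen) (auto simp: card_Pow)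
      also have "\<dots> = (sqrt 3 / T) powr q * (\<Sum>c<2 ^ N. (cmod (\<Sum>k<n. x j k * r k c))\<^sup>2) powr (q / 2)"
      proof -
        have "(\<Sum>a\<in>Pow {..<N}. (1 / 2 ^ N) * ?y a) = (sqrt 3 / T)\<^sup>2 * (\<Sum>c<2 ^ N. (cmod (\<Sum>k<n. x j k * r k c))\<^sup>2)"
          unfolding sq using T by (simp add: power_divide)
        moreover have "((sqrt 3 / T)\<^sup>2) powr (q / 2) = (sqrt 3 / T) powr q"
          using T by (simp add: powr_powr flip: powr_numeral)
        ultimately show ?thesis by (simp add: powr_mult sum_nonneg)
      qed
      finally have "(\<Sum>a\<in>Pow {..<N}. ?y a powr (q / 2)) / 2 ^ N
        \<le> (sqrt 3 / T) powr q * (\<Sum>c<2 ^ N. (cmod (\<Sum>k<n. x j k * r k c))\<^sup>2) powr (q / 2)"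
        by (simp add: sum_divide_distrib)
      moreover have "?y a powr (q / 2) = cmod (\<Sum>k<n. x j k * R k a) powr q" for a
        by (cases "(\<Sum>k<n. x j k * R k a) = 0") (auto simp: powr_powr simp flip: powr_numeral)
      ultimately show ?thesis by (simp add: pos_divide_le_eq mult.commute)
    qed
    then have "(\<Sum>j<J. (\<Sum>a\<in>Pow {..<N}. cmod (\<Sum>k<n. x j k * R k a) powr q)) \<le>
      (\<Sum>j<J. 2 ^ N * ((sqrt 3 / T) powr q * (\<Sum>c<2 ^ N. (cmod (\<Sum>k<n. x j k * r k c))\<^sup>2) powr (q / 2)))"
      by (intro sum_mono)
    also have "\<dots> = 2 ^ N * ((sqrt 3 / T) powr q * (\<Sum>j<J. (\<Sum>c<2 ^ N. (cmod (\<Sum>k<n. x j k * r k c))\<^sup>2) powr (q / 2)))"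
      by (simp add: sum_distrib_left)
    also have "\<dots> \<le> 2 ^ N * ((sqrt 3 / T) powr q * (A * S))"
      using S r by (intro mult_left_mono l2_dominatedD[OF A(1)]) auto
    finally show ?thesis .
  qed
  have "2 ^ N * (\<Sum>j<J. (\<Sum>i<N. (cmod (\<Sum>k<n. x j k * u k i))\<^sup>2) powr (q / 2))
    \<le> (\<Sum>j<J. 12 * (\<Sum>a\<in>Pow {..<N}. cmod (sgn_sum N (\<lambda>i. \<Sum>k<n. x j k * u k i) a) powr q))"
    unfolding sum_distrib_left[of "2 ^ N"] using q by (intro sum_mono khinchine_lower)
  also have "\<dots> \<le> (\<Sum>j<J. 12 * (\<Sum>a\<in>Pow {..<N}. cmod (\<Sum>k<n. x j k * Zt k a) powr q + cmod (\<Sum>k<n. x j k * R k a) powr q))"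
    unfolding lin
  proof (intro sum_mono mult_left_mono)
    fix j a
    have "cmod ((\<Sum>k<n. x j k * Zt k a) + (\<Sum>k<n. x j k * R k a)) powr q
      \<le> (cmod (\<Sum>k<n. x j k * Zt k a) + cmod (\<Sum>k<n. x j k * R k a)) powr q"
      using q by (intro powr_mono2 norm_triangle_ineq) auto
    also have "\<dots> \<le> cmod (\<Sum>k<n. x j k * Zt k a) powr q + cmod (\<Sum>k<n. x j k * R k a) powr q"
      using q by (intro powr_add_le) auto
    finally show "cmod ((\<Sum>k<n. x j k * Zt k a) + (\<Sum>k<n. x j k * R k a)) powr q \<le> \<dots>" .
  qed auto
  also have "\<dots> = 12 * ((\<Sum>a\<in>Pow {..<N}. \<Sum>j<J. cmod (\<Sum>k<n. x j k * Zt k a) powr q)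
       + (\<Sum>j<J. \<Sum>a\<in>Pow {..<N}. cmod (\<Sum>k<n. x j k * R k a) powr q))"
    unfolding sum.distrib sum_distrib_left[symmetric] by (subst (2) sum.swap) simp
  also have "\<dots> \<le> 12 * ((\<Sum>a\<in>Pow {..<N}. T powr q * (B * S)) + 2 ^ N * ((sqrt 3 / T) powr q * (A * S)))"
    by (intro mult_left_mono add_mono tail sum_mono bounded_part) auto
  also have "\<dots> = 2 ^ N * (12 * (T powr q * B + (sqrt 3 / T) powr q * A) * S)"
  proof -
    have "12 * (a * (t * (B * S)) + a * (y * (A * S))) = a * (12 * (t * B + y * A) * S)" for a t y :: real
      by (simp add: algebra_simps)
    moreover have "(\<Sum>a\<in>Pow {..<N}. T powr q * (B * S)) = 2 ^ N * (T powr q * (B * S))"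
      by (simp add: card_Pow)
    ultimately show ?thesis by (simp only:)
  qed
  finally show "(\<Sum>j<J. (\<Sum>i<N. (cmod (\<Sum>k<n. x j k * u k i))\<^sup>2) powr (q / 2)) \<le>
     12 * (T powr q * (M powr q * (2 * (2 / (\<eta> powr (1 / q))\<^sup>2) powr (1 - q) + \<eta> * A)) + (sqrt 3 / T) powr q * A) * S"
    unfolding B_def by (rule mult_left_le_imp_le[where c = "2 ^ N"]) (simp only: zero_less_power zero_less_numeral)
qed

text \<open>
  The assumption on \<open>T\<close> and \<open>\<eta>\<close> makes \<open>l2_dominated_improve\<close> map a constant \<open>A\<close> to at most \<open>C / 2 + A / 2\<close>.
  Iterating from any admissible constant leads to \<open>C\<close> in the limit.
\<close>

lemma pointwise_domination:
  assumes \<eta>T: "0 < T" "0 < \<eta>" "12 * (T powr q * (M powr q * \<eta>)) + 12 * (sqrt 3 / T) powr q \<le> 1 / 2"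
    and w: "\<And>k. k < n \<Longrightarrow> cmod (w k) \<le> 1"
  defines "K \<equiv> 2 * (2 / (\<eta> powr (1 / q))\<^sup>2) powr (1 - q)"
  defines "C \<equiv> 24 * (T powr q * (M powr q * K))"
  shows "dominated_on_average L (M powr q * (K + \<eta> * C))
     (\<lambda>d x. cmod (\<Sum>k<n. v d k * x k) powr q) (\<lambda>x. cmod (\<Sum>k<n. w k * x k) powr q)"
proof -
  have K0: "0 \<le> K" by (simp add: K_def)
  then have C0: "0 \<le> C" by (simp add: C_def)
  have mono: "l2_dominated B" if "l2_dominated A" "A \<le> B" for A B
    unfolding l2_dominated_def
  proof (intro allI impI)
    fix N J :: nat and u and x :: "nat \<Rightarrow> nat \<Rightarrow> complex" and S
    assume u: "\<forall>k<n. (\<Sum>i<N. (cmod (u k i))\<^sup>2) \<le> 1"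
      and S: "\<forall>d<L. (\<Sum>j<J. cmod (row d (x j)) powr q) \<le> S"
    have "0 \<le> (\<Sum>j<J. cmod (row 0 (x j)) powr q)" by (intro sum_nonneg) auto
    then have "0 \<le> S" using S L_pos by (meson order_trans)
    have "(\<Sum>j<J. (\<Sum>i<N. (cmod (\<Sum>k<n. x j k * u k i))\<^sup>2) powr (q / 2)) \<le> A * S"
      using u S by (intro l2_dominatedD[OF that(1)]) auto
    also have "\<dots> \<le> B * S" using \<open>0 \<le> S\<close> that by (intro mult_right_mono)
    finally show "(\<Sum>j<J. (\<Sum>i<N. (cmod (\<Sum>k<n. x j k * u k i))\<^sup>2) powr (q / 2)) \<le> B * S" .
  qed
  have step: "l2_dominated (C / 2 + A / 2)" if A: "l2_dominated A" "0 \<le> A" for A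
  proof (rule mono[OF l2_dominated_improve[OF A \<eta>T(1,2)]])
    have "12 * (T powr q * (M powr q * (K + \<eta> * A)) + (sqrt 3 / T) powr q * A)
      = C / 2 + (12 * (T powr q * (M powr q * \<eta>)) + 12 * (sqrt 3 / T) powr q) * A"
      by (simp add: C_def algebra_simps)
    also have "\<dots> \<le> C / 2 + (1 / 2) * A"
      by (intro add_left_mono mult_right_mono \<eta>T(3) A)
    finally show "12 * (T powr q * (M powr q * (2 * (2 / (\<eta> powr (1 / q))\<^sup>2) powr (1 - q) + \<eta> * A))
      + (sqrt 3 / T) powr q * A) \<le> C / 2 + A / 2" unfolding K_def by simp
  qed
  obtain A0 where A0: "0 \<le> A0" "l2_dominated A0" using l2_dominated_trivial by blast
  have iter: "l2_dominated (C + A0 / 2 ^ i)" for i :: nat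
  proof (induction i)
    case 0
    show ?case using mono[OF A0(2)] C0 by simp
  next
    case (Suc i)
    have "l2_dominated (C / 2 + (C + A0 / 2 ^ i) / 2)" using Suc C0 A0 by (intro step) auto
    then show ?case by (simp add: field_simps)
  qed
  have "l2_dominated C"
    unfolding l2_dominated_def
  proof (intro allI impI)
    fix N J :: nat and u and x :: "nat \<Rightarrow> nat \<Rightarrow> complex" and S
    assume u: "\<forall>k<n. (\<Sum>i<N. (cmod (u k i))\<^sup>2) \<le> 1"
      and S: "\<forall>d<L. (\<Sum>j<J. cmod (row d (x j)) powr q) \<le> S"
    have "(\<lambda>i. (C + A0 / 2 ^ i) * S) \<longlonglongrightarrow> (C + 0) * S"
      by (intro tendsto_intros) (rule LIMSEQ_divide_realpow_zero, simp)
    then have "(\<lambda>i. (C + A0 / 2 ^ i) * S) \<longlonglongrightarrow> C * S" by simp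
    then show "(\<Sum>j<J. (\<Sum>i<N. (cmod (\<Sum>k<n. x j k * u k i))\<^sup>2) powr (q / 2)) \<le> C * S"
      by (rule LIMSEQ_le_const) (use u S in \<open>auto intro!: exI l2_dominatedD[OF iter]\<close>)
  qed
  then have dom: "(\<Sum>j<J. cmod (\<Sum>k<n. w k * x j k) powr q) \<le> M powr q * (K + \<eta> * C) * S"
    if "\<And>d. d < L \<Longrightarrow> (\<Sum>j<J. cmod (row d (x j)) powr q) \<le> S" for J :: nat and x S
    unfolding K_def using w \<eta>T(2) that by (rule functional_dominated)

  have "dominated_on_average L (M powr q * (K + \<eta> * C))
     (\<lambda>d x. cmod (row d x) powr q) (\<lambda>x. cmod (\<Sum>k<n. w k * x k) powr q)"
  proof (rule domination_minimax[OF L_pos])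
    show "(\<Sum>j<J. cmod (\<Sum>k<n. w k * x j k) powr q) \<le> M powr q * (K + \<eta> * C) * S"
      if "\<And>d. d < L \<Longrightarrow> (\<Sum>j<J. cmod (row d (x j)) powr q) \<le> S" for J :: nat and x S
      by (rule dom) (rule that)
    show "0 \<le> M powr q * (K + \<eta> * C)" using K0 C0 \<eta>T by simp
    fix x and t :: real assume t: "t > 0"
    define s where "s = t powr (1 / q)"
    have s: "s > 0" "s powr q = t" using t q by (auto simp: s_def powr_powr)
    have "cmod (\<Sum>k<n. a k * (of_real s * x k)) powr q = t * cmod (\<Sum>k<n. a k * x k) powr q" for a
    proof -
      have "(\<Sum>k<n. a k * (of_real s * x k)) = of_real s * (\<Sum>k<n. a k * x k)"
        unfolding sum_distrib_left by (intro sum.cong) (simp_all only: mult_ac)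
      then show ?thesis using s by (simp add: norm_mult powr_mult)
    qed
    then show "\<exists>y. cmod (\<Sum>k<n. w k * y k) powr q = t * cmod (\<Sum>k<n. w k * x k) powr q \<and>
         (\<forall>d<L. cmod (row d y) powr q = t * cmod (row d x) powr q)"
      unfolding row_def by (intro exI[of _ "\<lambda>k. of_real s * x k"]) simp
  qed
  then show ?thesis unfolding row_def .
qed

end

text \<open>
  The scalar inequality on which everything rests. It holds for every \<open>q\<close> in \<open>(0, 1]\<close>, although
  the definition of a Sidon set only involves first powers.
\<close>

lemma norming_matrix_domination:
  assumes "1 \<le> M" "0 < q" "q \<le> 1"
  shows "\<exists>C>0. \<forall>n L v w. norming_matrix n L v M q \<longrightarrow> (\<forall>k<n. cmod (w k) \<le> 1) \<longrightarrow>
     dominated_on_average L C (\<lambda>d x. cmod (\<Sum>k<n. v d k * x k) powr q)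
       (\<lambda>x. cmod (\<Sum>k<n. w k * x k) powr q)"
proof -
  \<comment> \<open>both terms of the condition of \<open>pointwise_domination\<close> become \<open>12 / 48\<close>\<close>
  define T where "T = sqrt 3 * 48 powr (1 / q)"
  have T: "0 < T" by (simp add: T_def)
  have T2: "(sqrt 3 / T) powr q = 1 / 48"
    using assms by (simp add: T_def powr_divide powr_powr)
  define \<eta> where "\<eta> = 1 / (48 * (T powr q * M powr q))"
  have \<eta>: "0 < \<eta>" using T assms by (simp add: \<eta>_def)
  have "T powr q * (M powr q * \<eta>) = 1 / 48" using T assms by (simp add: \<eta>_def)
  then have c: "12 * (T powr q * (M powr q * \<eta>)) + 12 * (sqrt 3 / T) powr q \<le> 1 / 2"
    unfolding T2 by simp
  define K where "K = 2 * (2 / (\<eta> powr (1 / q))\<^sup>2) powr (1 - q)"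
  define C where "C = M powr q * (K + \<eta> * (24 * (T powr q * (M powr q * K))))"
  have "K > 0" using \<eta> by (simp add: K_def)
  then have "C > 0" unfolding C_def using \<eta> T assms by (intro mult_pos_pos add_pos_pos) auto
  show ?thesis
  proof (intro exI[of _ C] conjI allI impI)
    fix n L v w assume "norming_matrix n L v M q" "\<forall>k<n. cmod (w k) \<le> 1"
    then show "dominated_on_average L C (\<lambda>d x. cmod (\<Sum>k<n. v d k * x k) powr q)
       (\<lambda>x. cmod (\<Sum>k<n. w k * x k) powr q)"
      unfolding C_def K_def by (intro norming_matrix.pointwise_domination[OF _ T \<eta> c]) auto
  qed fact
qed

section \<open>Lattice states on a principal ideal\<close>

abbreviation pos :: "'y::{ordered_real_vector,lattice} \<Rightarrow> 'y" where
  "pos x \<equiv> sup x 0"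

lemma vl_sup_add: "sup x y + z = sup (x + z) (y + z)"
  for x y z :: "'y::{ordered_real_vector,lattice}"
proof (rule order.antisym)
  have "x \<le> sup (x + z) (y + z) - z" "y \<le> sup (x + z) (y + z) - z"
    by (simp_all add: le_diff_eq)
  then have "sup x y \<le> sup (x + z) (y + z) - z" by (rule sup_least)
  then show "sup x y + z \<le> sup (x + z) (y + z)" by (simp add: le_diff_eq)
qed (simp add: add_right_mono)

lemma vl_inf_eq: "inf x y = - sup (- x) (- y)"
  for x y :: "'y::{ordered_real_vector,lattice}"
proof (rule order.antisym)
  have "- x \<le> - inf x y" "- y \<le> - inf x y" by simp_all
  then have "sup (- x) (- y) \<le> - inf x y" by simp
  then show "inf x y \<le> - sup (- x) (- y)" by (simp add: le_minus_iff)
  show "- sup (- x) (- y) \<le> inf x y" by (simp add: minus_le_iff)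
qed

lemma vl_sup_scale: "0 < c \<Longrightarrow> c *\<^sub>R sup x y = sup (c *\<^sub>R x) (c *\<^sub>R y)"
  for x y :: "'y::{ordered_real_vector,lattice}"
proof (rule order.antisym)
  assume c: "0 < c"
  let ?s = "sup (c *\<^sub>R x) (c *\<^sub>R y)"
  have *: "z \<le> inverse c *\<^sub>R ?s" if "c *\<^sub>R z \<le> ?s" for z
    using scaleR_left_mono[OF that, of "inverse c"] c by simp
  have "sup x y \<le> inverse c *\<^sub>R ?s" using * by simp
  then have "c *\<^sub>R sup x y \<le> c *\<^sub>R (inverse c *\<^sub>R ?s)" using c by (intro scaleR_left_mono) auto
  then show "c *\<^sub>R sup x y \<le> ?s" using c by simp
  show "?s \<le> c *\<^sub>R sup x y" using c by (simp add: scaleR_left_mono)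
qed

lemma vl_disjoint_parts:
  fixes z :: "'y::{ordered_real_vector,lattice}"
  assumes "x \<le> pos z" "x \<le> pos (- z)"
  shows "x \<le> 0"
proof -
  have "pos z = pos (- z) + z"
    by (simp add: vl_sup_add sup_commute)
  then have "x - pos (- z) \<le> z" using assms(1) by (simp add: diff_le_eq add.commute)
  moreover have "x - pos (- z) \<le> 0" using assms(2) by simp
  ultimately have "x - pos (- z) \<le> inf z 0" by simp
  also have "inf z 0 = - pos (- z)" by (simp add: vl_inf_eq)
  finally show ?thesis by simp
qed

text \<open>
  If \<open>f\<close> is disjoint from \<open>b\<close> and from \<open>c\<close>, it is disjoint from \<open>b + c\<close>. Disjointness of positive elements is
  expressed by all common lower bounds being negative or zero.
\<close>

lemma vl_disjoint_add:
  fixes b c f :: "'y::{ordered_real_vector,lattice}"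
  assumes "\<And>x. x \<le> f \<Longrightarrow> x \<le> b \<Longrightarrow> x \<le> 0" "\<And>x. x \<le> f \<Longrightarrow> x \<le> c \<Longrightarrow> x \<le> 0"
    and "0 \<le> c" "x \<le> f" "x \<le> b + c"
  shows "x \<le> 0"
proof -
  have "x - c \<le> f" using assms(3,4) by (metis add_increasing diff_le_eq add.commute)
  moreover have "x - c \<le> b" using assms(5) by (simp add: diff_le_eq)
  ultimately have "x - c \<le> 0" by (rule assms(1))
  then show ?thesis using assms(2,4) by simp
qed

lemma vl_inf_pos_le:
  fixes z z' :: "'y::{ordered_real_vector,lattice}"
  shows "inf (pos z) (pos z') \<le> pos (z + z')"
proof -
  let ?a = "inf (pos z) (pos z')"
  have dec: "pos z = z + pos (- z)" for z :: 'y by (metis add.commute add.left_neutral add.right_inverse sup_commute vl_sup_add)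
  have "?a + ?a \<le> (z + pos (- z)) + (z' + pos (- z'))"
    unfolding dec[symmetric] by (intro add_mono) auto
  also have "\<dots> \<le> pos (z + z') + (pos (- z) + pos (- z'))"
    by (simp add: add_ac)
  finally have *: "?a + ?a - pos (z + z') \<le> pos (- z) + pos (- z')" by (simp add: diff_le_eq add_ac)
  have a0: "0 \<le> ?a" by simp
  have "?a - pos (z + z') \<le> ?a + ?a - pos (z + z')" using a0 by simp
  with * have 1: "?a - pos (z + z') \<le> pos (- z) + pos (- z')" by (rule order_trans[rotated])
  have 2: "?a - pos (z + z') \<le> ?a" by (simp only: diff_le_eq le_add_same_cancel1 sup_ge2)
  have "?a - pos (z + z') \<le> 0"
  proof (rule vl_disjoint_add[OF _ _ _ 2 1])
    show "x \<le> 0" if "x \<le> ?a" "x \<le> pos (- z)" for x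
      using vl_disjoint_parts[of x z] that by simp
    show "x \<le> 0" if "x \<le> ?a" "x \<le> pos (- z')" for x
      using vl_disjoint_parts[of x z'] that by simp
  qed simp
  then show ?thesis by simp
qed

definition proper_filter :: "'y::{ordered_real_vector,lattice} set \<Rightarrow> bool" where
  "proper_filter F \<longleftrightarrow> (\<forall>b\<in>F. 0 \<le> b) \<and> 0 \<notin> F \<and> (\<forall>b\<in>F. \<forall>c\<in>F. inf b c \<in> F) \<and>
     (\<forall>b\<in>F. \<forall>c. b \<le> c \<longrightarrow> c \<in> F)"

text \<open>
  By Zorn's lemma. The last property is maximality: if \<open>b\<close> met every member of the filter, the filter could
  be enlarged by \<open>b\<close>.
\<close>

lemma maximal_filter_exists:
  fixes a :: "'y::{ordered_real_vector,lattice}"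
  assumes "0 \<le> a" "a \<noteq> 0"
  obtains F where "proper_filter F" "a \<in> F" "\<And>b. 0 \<le> b \<Longrightarrow> b \<notin> F \<Longrightarrow> \<exists>f\<in>F. \<forall>x. x \<le> b \<longrightarrow> x \<le> f \<longrightarrow> x \<le> 0"
proof -
  let ?\<F> = "{F. proper_filter F \<and> a \<in> F}"
  have "{c. a \<le> c} \<in> ?\<F>" using assms by (auto simp: proper_filter_def)
  then have ne: "?\<F> \<noteq> {}" by blast
  have "\<exists>F\<in>?\<F>. \<forall>X\<in>?\<F>. F \<subseteq> X \<longrightarrow> X = F"
  proof (rule subset_Zorn_nonempty[OF ne])
    fix \<C> assume \<C>: "\<C> \<noteq> {}" "subset.chain ?\<F> \<C>"
    then have sub: "\<C> \<subseteq> ?\<F>" and chain: "\<And>X Y. X \<in> \<C> \<Longrightarrow> Y \<in> \<C> \<Longrightarrow> X \<subseteq> Y \<or> Y \<subseteq> X"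
      by (auto simp: subset.chain_def subset_chain_def)
    have "inf b c \<in> \<Union>\<C>" if "b \<in> \<Union>\<C>" "c \<in> \<Union>\<C>" for b c
    proof -
      obtain X Y where XY: "X \<in> \<C>" "b \<in> X" "Y \<in> \<C>" "c \<in> Y" using \<open>b \<in> \<Union>\<C>\<close> \<open>c \<in> \<Union>\<C>\<close> by blast
      obtain Z where "Z \<in> \<C>" "b \<in> Z" "c \<in> Z" using chain[OF XY(1,3)] XY by blast
      then have "inf b c \<in> Z" using sub unfolding proper_filter_def by blast
      then show ?thesis using \<open>Z \<in> \<C>\<close> by blast
    qed
    moreover have "\<forall>b\<in>\<Union>\<C>. 0 \<le> b" "0 \<notin> \<Union>\<C>" "\<forall>b\<in>\<Union>\<C>. \<forall>c. b \<le> c \<longrightarrow> c \<in> \<Union>\<C>"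
      using sub unfolding proper_filter_def by (fast, fast, fast)
    moreover have "a \<in> \<Union>\<C>" using sub \<C>(1) by blast
    ultimately show "\<Union>\<C> \<in> ?\<F>" unfolding proper_filter_def by simp
  qed
  then obtain F where F: "proper_filter F" "a \<in> F"
    and max: "\<And>X. proper_filter X \<Longrightarrow> a \<in> X \<Longrightarrow> F \<subseteq> X \<Longrightarrow> X = F" by blast
  have "\<exists>f\<in>F. \<forall>x. x \<le> b \<longrightarrow> x \<le> f \<longrightarrow> x \<le> 0" if b: "0 \<le> b" "b \<notin> F" for b
  proof (rule ccontr)
    assume no: "\<not> ?thesis"
    define X where "X = {c. \<exists>f\<in>F. inf b f \<le> c}"
    have Fpos: "\<And>f. f \<in> F \<Longrightarrow> 0 \<le> f" and Finf: "\<And>f g. f \<in> F \<Longrightarrow> g \<in> F \<Longrightarrow> inf f g \<in> F"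
      using F by (auto simp: proper_filter_def)
    have "proper_filter X"
      unfolding proper_filter_def
    proof (intro conjI ballI allI impI)
      show "0 \<le> c" if "c \<in> X" for c
        
      proof -
        obtain f where f: "f \<in> F" "inf b f \<le> c" using \<open>c \<in> X\<close> by (auto simp: X_def)
        then have "0 \<le> inf b f" using b Fpos by simp
        then show ?thesis using f(2) by (rule order_trans)
      qed
      show "0 \<notin> X"
      proof
        assume "0 \<in> X"
        then obtain f where "f \<in> F" "inf b f \<le> 0" by (auto simp: X_def)
        then show False using no by (meson le_inf_iff order_trans)
      qed
      show "inf c c' \<in> X" if c: "c \<in> X" "c' \<in> X" for c c'
      proof -
        obtain f f' where f: "f \<in> F" "f' \<in> F" "inf b f \<le> c" "inf b f' \<le> c'" using c by (auto simp: X_def)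
        have "inf b (inf f f') \<le> inf b f" "inf b (inf f f') \<le> inf b f'"
          by (simp_all add: le_infI2)
        then have "inf b (inf f f') \<le> inf c c'" using f by (meson le_inf_iff order_trans)
        then show ?thesis using Finf f by (auto simp: X_def)
      qed
      show "c' \<in> X" if "c \<in> X" "c \<le> c'" for c c' using that by (auto simp: X_def intro: order_trans)
    qed
    moreover have sub: "F \<subseteq> X" by (auto simp: X_def intro!: bexI)
    ultimately have "X = F" using F max by blast
    moreover have "b \<in> X" using F(2) by (auto simp: X_def intro!: bexI[of _ a])
    ultimately show False using b by blast
  qed
  then show ?thesis using that F by blast
qed

definition order_ideal :: "'y::{ordered_real_vector,lattice} \<Rightarrow> 'y set" where
  "order_ideal e = {y. \<exists>C. y \<le> C *\<^sub>R e \<and> - y \<le> C *\<^sub>R e}"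

text \<open>
  The lattice homomorphisms from the ideal to the reals that are normalised at \<open>e\<close>. In Kakutani's
  representation they are the points of the compact space on which the ideal is realised as a lattice
  of continuous functions.
\<close>

definition lattice_state :: "'y::{ordered_real_vector,lattice} \<Rightarrow> ('y \<Rightarrow> real) \<Rightarrow> bool" where
  "lattice_state e \<phi> \<longleftrightarrow>
     (\<forall>x\<in>order_ideal e. \<forall>y\<in>order_ideal e. \<phi> (x + y) = \<phi> x + \<phi> y \<and> \<phi> (sup x y) = max (\<phi> x) (\<phi> y)) \<and>
     (\<forall>c. \<forall>x\<in>order_ideal e. \<phi> (c *\<^sub>R x) = c * \<phi> x) \<and> \<phi> e = 1"

lemma order_ideal_bound:
  assumes "x \<in> order_ideal e" "0 \<le> e"
  obtains C where "0 < C" "x \<le> C *\<^sub>R e" "- x \<le> C *\<^sub>R e"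
proof -
  obtain C where C: "x \<le> C *\<^sub>R e" "- x \<le> C *\<^sub>R e" using assms by (auto simp: order_ideal_def)
  have "C *\<^sub>R e \<le> (\<bar>C\<bar> + 1) *\<^sub>R e" using assms(2) by (intro scaleR_right_mono) auto
  then show ?thesis using that[of "\<bar>C\<bar> + 1"] C by (auto intro: order_trans)
qed

lemma order_ideal_add:
  assumes "x \<in> order_ideal e" "y \<in> order_ideal e"
  shows "x + y \<in> order_ideal e"
proof -
  obtain C D where C: "x \<le> C *\<^sub>R e" "- x \<le> C *\<^sub>R e" "y \<le> D *\<^sub>R e" "- y \<le> D *\<^sub>R e"
    using assms by (auto simp: order_ideal_def)
  have "x + y \<le> (C + D) *\<^sub>R e" "- x + - y \<le> (C + D) *\<^sub>R e"
    unfolding scaleR_add_left using C by (intro add_mono; simp)+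
  then show ?thesis by (auto simp: order_ideal_def)
qed

lemma order_ideal_uminus: "x \<in> order_ideal e \<Longrightarrow> - x \<in> order_ideal e"
  by (auto simp: order_ideal_def)

lemma order_ideal_self: "0 \<le> e \<Longrightarrow> e \<in> order_ideal e"
proof -
  assume "0 \<le> e"
  then have "- e \<le> e" by (meson neg_le_0_iff_le order_trans)
  then show ?thesis by (auto simp: order_ideal_def intro!: exI[of _ 1])
qed

lemma order_ideal_scale:
  assumes "x \<in> order_ideal e" "0 \<le> e"
  shows "c *\<^sub>R x \<in> order_ideal e"
proof -
  have *: "c *\<^sub>R x \<in> order_ideal e" if "0 \<le> c" for c
  proof -
    obtain C where C: "0 < C" "x \<le> C *\<^sub>R e" "- x \<le> C *\<^sub>R e" using order_ideal_bound[OF assms] .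
    have "c *\<^sub>R x \<le> c *\<^sub>R (C *\<^sub>R e)" "c *\<^sub>R (- x) \<le> c *\<^sub>R (C *\<^sub>R e)"
      using C that by (intro scaleR_left_mono; simp)+
    then show ?thesis by (auto simp: order_ideal_def)
  qed
  show ?thesis
  proof (cases "0 \<le> c")
    case False
    then have "- ((- c) *\<^sub>R x) \<in> order_ideal e" by (intro order_ideal_uminus *) simp
    then show ?thesis by simp
  qed (rule *)
qed

lemma order_ideal_between:
  assumes "x \<in> order_ideal e" "z \<in> order_ideal e" "x \<le> y" "y \<le> z" "0 \<le> e"
  shows "y \<in> order_ideal e"
proof -
  obtain C where C: "0 < C" "x \<le> C *\<^sub>R e" "- x \<le> C *\<^sub>R e" using order_ideal_bound[OF assms(1,5)] .
  obtain D where D: "0 < D" "z \<le> D *\<^sub>R e" "- z \<le> D *\<^sub>R e" using order_ideal_bound[OF assms(2,5)] .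
  have "C *\<^sub>R e \<le> (C + D) *\<^sub>R e" "D *\<^sub>R e \<le> (C + D) *\<^sub>R e"
    using C D assms(5) by (intro scaleR_right_mono; simp)+
  moreover have "- y \<le> - x" using assms by simp
  ultimately have "y \<le> (C + D) *\<^sub>R e" "- y \<le> (C + D) *\<^sub>R e"
    using C D assms by (meson order_trans)+
  then show ?thesis by (auto simp: order_ideal_def)
qed

lemma order_ideal_sup:
  assumes "x \<in> order_ideal e" "y \<in> order_ideal e" "0 \<le> e"
  shows "sup x y \<in> order_ideal e"
proof -
  obtain C where C: "0 < C" "x \<le> C *\<^sub>R e" "- x \<le> C *\<^sub>R e" using order_ideal_bound[OF assms(1,3)] .
  obtain D where D: "0 < D" "y \<le> D *\<^sub>R e" "- y \<le> D *\<^sub>R e" using order_ideal_bound[OF assms(2,3)] .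
  have "C *\<^sub>R e \<le> (C + D) *\<^sub>R e" "D *\<^sub>R e \<le> (C + D) *\<^sub>R e"
    using C D assms(3) by (intro scaleR_right_mono; simp)+
  then have "sup x y \<le> (C + D) *\<^sub>R e" using C D by (meson le_supI order_trans)
  moreover have "(C + D) *\<^sub>R e \<in> order_ideal e"
    by (intro order_ideal_scale order_ideal_self assms)
  ultimately show ?thesis using assms by (intro order_ideal_between[of x e _ "sup x y"]) (auto intro: order_ideal_between[of x e "(C + D) *\<^sub>R e"])
qed

text \<open>
  A maximal filter of positive elements is prime: if it contains the positive part of a supremum, it
  contains the positive part of one of the two members. Read \<open>P z\<close> below as ``\<open>z\<close> is positive at the point''. For
  \<open>s < t\<close> the supremum of \<open>y - s *\<^sub>R e\<close> and \<open>t *\<^sub>R e - y\<close> is at least a positive multiple of \<open>e\<close>, so that one of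
  them satisfies \<open>P\<close>. Hence \<open>P (y - t *\<^sub>R e)\<close> describes a Dedekind cut in \<open>t\<close>, whose value \<open>\<phi> y\<close> is linear in \<open>y\<close> and
  preserves suprema. A filter containing the positive part of \<open>u - \<delta> *\<^sub>R e\<close> gives a state with \<open>\<delta> \<le> \<phi> u\<close>.
\<close>

lemma lattice_state_exists:
  fixes e u :: "'y::{ordered_real_vector,lattice}"
  assumes e: "0 \<le> e" and u: "u \<in> order_ideal e" and \<delta>: "0 < \<delta>" "\<not> u \<le> \<delta> *\<^sub>R e"
  shows "\<exists>\<phi>. lattice_state e \<phi> \<and> \<delta> \<le> \<phi> u"
proof -
  define a where "a = pos (u - \<delta> *\<^sub>R e)"
  have a: "0 \<le> a" "a \<noteq> 0"
    using \<delta> by (auto simp: a_def) (metis diff_le_0_iff_le sup.cobounded1)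
  obtain F where F: "proper_filter F" "a \<in> F"
    and max: "\<And>b. 0 \<le> b \<Longrightarrow> b \<notin> F \<Longrightarrow> \<exists>f\<in>F. \<forall>x. x \<le> b \<longrightarrow> x \<le> f \<longrightarrow> x \<le> 0"
    using maximal_filter_exists[OF a] by blast
  have F0: "0 \<notin> F" and Finf: "\<And>f g. f \<in> F \<Longrightarrow> g \<in> F \<Longrightarrow> inf f g \<in> F"
    and Fup: "\<And>f g. f \<in> F \<Longrightarrow> f \<le> g \<Longrightarrow> g \<in> F" and Fpos: "\<And>f. f \<in> F \<Longrightarrow> 0 \<le> f"
    using F(1) unfolding proper_filter_def by blast+
  have nodisj: False if "f \<in> F" "g \<in> F" "\<And>x. x \<le> f \<Longrightarrow> x \<le> g \<Longrightarrow> x \<le> 0" for f g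
  proof -
    have "inf f g \<in> F" by (rule Finf) fact+
    moreover have "inf f g \<le> 0" by (rule that(3)) auto
    ultimately show False using F0 Fup by blast
  qed
  define P where "P z \<longleftrightarrow> pos z \<in> F" for z
  have Pmono: "P z'" if "P z" "z \<le> z'" for z z'
    using that Fup unfolding P_def by (meson order_refl sup_mono)
  have Padd: "P (z + z')" if "P z" "P z'" for z z'
    using that Fup[OF Finf vl_inf_pos_le] unfolding P_def by blast
  have Pneg: False if "P z" "P (- z)" for z
    using that nodisj[of "pos z" "pos (- z)"] vl_disjoint_parts unfolding P_def by blast
  have Pscale: "P (c *\<^sub>R z)" if "P z" "0 < c" for c z
  proof (rule ccontr)
    assume "\<not> P (c *\<^sub>R z)"
    then obtain f where f: "f \<in> F" "\<And>x. x \<le> pos (c *\<^sub>R z) \<Longrightarrow> x \<le> f \<Longrightarrow> x \<le> 0"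
      using max[of "pos (c *\<^sub>R z)"] unfolding P_def by auto
    define t where "t = min c 1"
    have t: "0 < t" "t \<le> c" "t \<le> 1" using that by (auto simp: t_def)
    have "x \<le> 0" if x: "x \<le> pos z" "x \<le> f" for x
    proof -
      have "pos x \<le> pos z" "pos x \<le> f" using x Fpos[OF f(1)] by (auto intro: le_supI1)
      have "t *\<^sub>R pos x \<le> c *\<^sub>R pos x" using t by (intro scaleR_right_mono) auto
      also have "\<dots> \<le> c *\<^sub>R pos z" using \<open>pos x \<le> pos z\<close> \<open>0 < c\<close> by (intro scaleR_left_mono) auto
      also have "\<dots> = pos (c *\<^sub>R z)" using vl_sup_scale[OF \<open>0 < c\<close>, of z 0] by simp
      finally have 1: "t *\<^sub>R pos x \<le> pos (c *\<^sub>R z)" .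
      have "t *\<^sub>R pos x \<le> 1 *\<^sub>R pos x" using t by (intro scaleR_right_mono) auto
      then have "t *\<^sub>R pos x \<le> f" using \<open>pos x \<le> f\<close> by (metis order_trans scaleR_one)
      then have "t *\<^sub>R pos x \<le> 0" by (rule f(2)[OF 1])
      then have "inverse t *\<^sub>R (t *\<^sub>R pos x) \<le> inverse t *\<^sub>R 0" using t by (intro scaleR_left_mono) auto
      then have "pos x \<le> 0" using t by simp
      then show ?thesis by simp
    qed
    then show False using nodisj[of "pos z" f] \<open>P z\<close> f(1) unfolding P_def by blast
  qed
  have Psup: "P z \<or> P z'" if "P (sup z z')" for z z'
  proof (rule ccontr)
    assume no: "\<not> (P z \<or> P z')"
    obtain f where f: "f \<in> F" "\<And>x. x \<le> pos z \<Longrightarrow> x \<le> f \<Longrightarrow> x \<le> 0"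
      using max[of "pos z"] no unfolding P_def by auto
    obtain f' where f': "f' \<in> F" "\<And>x. x \<le> pos z' \<Longrightarrow> x \<le> f' \<Longrightarrow> x \<le> 0"
      using max[of "pos z'"] no unfolding P_def by auto
    have le: "pos (sup z z') \<le> pos z + pos z'"
      by (simp add: add_increasing add_increasing2 le_supI1)
    have "x \<le> 0" if "x \<le> pos (sup z z')" "x \<le> inf f f'" for x
      by (rule vl_disjoint_add[of "inf f f'" "pos z" "pos z'"]) (use f f' that le in \<open>auto intro: order_trans\<close>)
    then show False using nodisj[of "pos (sup z z')" "inf f f'"] that Finf[OF f(1) f'(1)] unfolding P_def by blast
  qed
  obtain C where C: "0 < C" "u \<le> C *\<^sub>R e" using order_ideal_bound[OF u e] by blast
  have Pe: "P (t *\<^sub>R e)" if "0 < t" for t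
  proof -
    have "P (u - \<delta> *\<^sub>R e)" using F(2) unfolding P_def a_def .
    moreover have "u - \<delta> *\<^sub>R e \<le> C *\<^sub>R e"
    proof -
      have "u - \<delta> *\<^sub>R e \<le> u" using \<delta> e by (simp add: diff_le_eq scaleR_nonneg_nonneg)
      then show ?thesis using C(2) by (rule order_trans)
    qed
    ultimately have "P (C *\<^sub>R e)" by (rule Pmono)
    then have "P ((t / C) *\<^sub>R (C *\<^sub>R e))" by (rule Pscale) (use C that in simp)
    then show ?thesis using C by simp
  qed
  define \<phi> where "\<phi> y = Sup {t. P (y - t *\<^sub>R e)}" for y
  have down: "P (y - s *\<^sub>R e)" if "P (y - t *\<^sub>R e)" "s \<le> t" for y s t
    using that e by (intro Pmono[OF that(1)] diff_left_mono scaleR_right_mono) auto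
  have tri: "P (y - s *\<^sub>R e) \<or> P (t *\<^sub>R e - y)" if "s < t" for y s t
  proof (rule Psup)
    let ?m = "sup (y - s *\<^sub>R e) (t *\<^sub>R e - y)"
    have "(y - s *\<^sub>R e) + (t *\<^sub>R e - y) \<le> ?m + ?m" by (intro add_mono) auto
    then have "(t - s) *\<^sub>R e \<le> 2 *\<^sub>R ?m" by (simp add: scaleR_diff_left scaleR_2)
    then have "(1/2) *\<^sub>R ((t - s) *\<^sub>R e) \<le> (1/2) *\<^sub>R (2 *\<^sub>R ?m)" by (intro scaleR_left_mono) auto
    then have "((t - s) / 2) *\<^sub>R e \<le> ?m" by simp
    then show "P ?m" using that by (intro Pmono[OF Pe[of "(t - s) / 2"]]) auto
  qed
  have cut: "\<not> P (y - t *\<^sub>R e)" if "P (s *\<^sub>R e - y)" "s \<le> t" for y s t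
  proof
    assume "P (y - t *\<^sub>R e)"
    then have "P (y - s *\<^sub>R e)" using that(2) by (rule down)
    then show False using Pneg[of "y - s *\<^sub>R e"] that(1) by simp
  qed
  have ex: "\<exists>t. P (y - t *\<^sub>R e)" and bdd: "bdd_above {t. P (y - t *\<^sub>R e)}" if y: "y \<in> order_ideal e" for y
  proof -
    obtain D where D: "0 < D" "y \<le> D *\<^sub>R e" "- y \<le> D *\<^sub>R e" using order_ideal_bound[OF y e] .
    have "1 *\<^sub>R e \<le> y - (- D - 1) *\<^sub>R e" using D(3) by (simp add: scaleR_diff_left minus_le_iff add.commute)
        (metis add_le_cancel_right add.left_inverse add.commute minus_le_iff neg_le_iff_le)
    then show "\<exists>t. P (y - t *\<^sub>R e)" using Pmono[OF Pe[of 1]] by force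
    have "1 *\<^sub>R e \<le> (D + 1) *\<^sub>R e - y" using D(2) by (simp add: scaleR_add_left le_diff_eq add.commute)
    then have "P ((D + 1) *\<^sub>R e - y)" by (intro Pmono[OF Pe[of 1]]) auto
    then show "bdd_above {t. P (y - t *\<^sub>R e)}" using cut by (intro bdd_aboveI[of _ "D + 1"]) (metis linear mem_Collect_eq)
  qed
  have ge: "t \<le> \<phi> y" if "y \<in> order_ideal e" "P (y - t *\<^sub>R e)" for y t
    unfolding \<phi>_def using that bdd by (intro cSup_upper) auto
  have less: "P (y - t *\<^sub>R e)" if yt: "y \<in> order_ideal e" "t < \<phi> y" for y t
  proof -
    have "{t. P (y - t *\<^sub>R e)} \<noteq> {}" using ex[OF yt(1)] by blast
    then have "\<exists>s\<in>{t. P (y - t *\<^sub>R e)}. t < s"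
      using yt(2) unfolding \<phi>_def by (intro less_cSupD)
    then obtain s where s: "P (y - s *\<^sub>R e)" "t < s" by auto
    show ?thesis by (rule down[OF s(1)]) (use s(2) in simp)
  qed
  have gr: "P (t *\<^sub>R e - y)" if yt: "y \<in> order_ideal e" "\<phi> y < t" for y t
  proof -
    obtain s where s: "\<phi> y < s" "s < t" using yt(2) dense by blast
    have "\<not> P (y - s *\<^sub>R e)" using ge yt(1) s by force
    then show ?thesis using tri[OF s(2)] by blast
  qed
  have le: "\<phi> y \<le> t" if "y \<in> order_ideal e" "P (t *\<^sub>R e - y)" for y t
  proof (rule ccontr)
    assume "\<not> ?thesis"
    then have "P (y - t *\<^sub>R e)" using less that by simp
    then show False using cut[OF that(2)] by blast
  qed
  have add: "\<phi> (x + y) = \<phi> x + \<phi> y" if xy: "x \<in> order_ideal e" "y \<in> order_ideal e" for x y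
  proof (rule antisym; rule field_le_epsilon)
    fix \<epsilon> :: real assume \<epsilon>: "0 < \<epsilon>"
    have "P (((\<phi> x + \<epsilon>/2) *\<^sub>R e - x) + ((\<phi> y + \<epsilon>/2) *\<^sub>R e - y))"
      using xy \<epsilon> by (intro Padd gr) auto
    moreover have "((\<phi> x + \<epsilon>/2) *\<^sub>R e - x) + ((\<phi> y + \<epsilon>/2) *\<^sub>R e - y) = (\<phi> x + \<phi> y + \<epsilon>) *\<^sub>R e - (x + y)"
      by (simp add: algebra_simps flip: scaleR_add_left)
    ultimately show "\<phi> (x + y) \<le> \<phi> x + \<phi> y + \<epsilon>" by (intro le order_ideal_add xy) simp
    have "P ((x - (\<phi> x - \<epsilon>/2) *\<^sub>R e) + (y - (\<phi> y - \<epsilon>/2) *\<^sub>R e))"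
      using xy \<epsilon> by (intro Padd less) auto
    moreover have "(x - (\<phi> x - \<epsilon>/2) *\<^sub>R e) + (y - (\<phi> y - \<epsilon>/2) *\<^sub>R e) = (x + y) - (\<phi> x + \<phi> y - \<epsilon>) *\<^sub>R e"
      by (simp add: algebra_simps flip: scaleR_add_left)
    ultimately have "\<phi> x + \<phi> y - \<epsilon> \<le> \<phi> (x + y)" by (intro ge order_ideal_add xy) simp
    then show "\<phi> x + \<phi> y \<le> \<phi> (x + y) + \<epsilon>" by simp
  qed
  have scale_pos: "\<phi> (c *\<^sub>R x) = c * \<phi> x" if x: "x \<in> order_ideal e" and c: "0 < c" for c x
  proof (rule antisym; rule field_le_epsilon)
    fix \<epsilon> :: real assume \<epsilon>: "0 < \<epsilon>"
    have cx: "c *\<^sub>R x \<in> order_ideal e" using x e by (rule order_ideal_scale)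
    have "P (c *\<^sub>R ((\<phi> x + \<epsilon> / c) *\<^sub>R e - x))" using x c \<epsilon> by (intro Pscale gr) auto
    moreover have "c *\<^sub>R ((\<phi> x + \<epsilon> / c) *\<^sub>R e - x) = (c * \<phi> x + \<epsilon>) *\<^sub>R e - c *\<^sub>R x"
      using c by (simp add: scaleR_diff_right ring_distribs)
    ultimately show "\<phi> (c *\<^sub>R x) \<le> c * \<phi> x + \<epsilon>" by (intro le cx) simp
    have "P (c *\<^sub>R (x - (\<phi> x - \<epsilon> / c) *\<^sub>R e))" using x c \<epsilon> by (intro Pscale less) auto
    moreover have "c *\<^sub>R (x - (\<phi> x - \<epsilon> / c) *\<^sub>R e) = c *\<^sub>R x - (c * \<phi> x - \<epsilon>) *\<^sub>R e"
      using c by (simp add: scaleR_diff_right right_diff_distrib)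
    ultimately have "c * \<phi> x - \<epsilon> \<le> \<phi> (c *\<^sub>R x)" by (intro ge cx) simp
    then show "c * \<phi> x \<le> \<phi> (c *\<^sub>R x) + \<epsilon>" by simp
  qed
  have I0: "0 \<in> order_ideal e" using order_ideal_scale[OF u e, of 0] by simp
  have phi0: "\<phi> 0 = 0" using add[OF I0 I0] by simp
  have scale: "\<phi> (c *\<^sub>R x) = c * \<phi> x" if x: "x \<in> order_ideal e" for c x
  proof -
    consider "c = 0" | "0 < c" | "c < 0" by linarith
    then show ?thesis
    proof cases
      case 3
      have "\<phi> (c *\<^sub>R x) + \<phi> ((- c) *\<^sub>R x) = 0"
        using add[of "c *\<^sub>R x" "(- c) *\<^sub>R x"] x e phi0 by (simp add: order_ideal_scale order_ideal_uminus)
      then show ?thesis using scale_pos[OF x, of "- c"] 3 by simp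
    qed (use phi0 scale_pos x in auto)
  qed
  have mono: "\<phi> x \<le> \<phi> y" if xy: "x \<in> order_ideal e" "y \<in> order_ideal e" "x \<le> y" for x y
  proof (rule dense_le)
    fix t assume "t < \<phi> x"
    then have "P (x - t *\<^sub>R e)" using xy less by blast
    then have "P (y - t *\<^sub>R e)" by (rule Pmono) (intro diff_right_mono xy)
    then show "t \<le> \<phi> y" using xy ge by blast
  qed
  have sup: "\<phi> (sup x y) = max (\<phi> x) (\<phi> y)" if xy: "x \<in> order_ideal e" "y \<in> order_ideal e" for x y
  proof (rule antisym)
    have s: "sup x y \<in> order_ideal e" using xy e by (intro order_ideal_sup)
    show "max (\<phi> x) (\<phi> y) \<le> \<phi> (sup x y)" using mono xy s by simp
    show "\<phi> (sup x y) \<le> max (\<phi> x) (\<phi> y)"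
    proof (rule dense_le)
      fix t assume "t < \<phi> (sup x y)"
      then have "P (sup x y - t *\<^sub>R e)" using s less by blast
      moreover have "sup x y - t *\<^sub>R e = sup (x - t *\<^sub>R e) (y - t *\<^sub>R e)"
        using vl_sup_add[of x y "- (t *\<^sub>R e)"] by simp
      ultimately have "P (sup (x - t *\<^sub>R e) (y - t *\<^sub>R e))" by simp
      then have "P (x - t *\<^sub>R e) \<or> P (y - t *\<^sub>R e)" by (rule Psup)
      then show "t \<le> max (\<phi> x) (\<phi> y)" using ge xy by (meson max.coboundedI1 max.coboundedI2)
    qed
  qed
  have eI: "e \<in> order_ideal e" using e by (rule order_ideal_self)
  have one: "\<phi> e = 1"
  proof (rule antisym; rule field_le_epsilon)
    fix \<epsilon> :: real assume \<epsilon>: "0 < \<epsilon>"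
    show "\<phi> e \<le> 1 + \<epsilon>" using Pe[OF \<epsilon>] by (intro le eI) (simp add: scaleR_add_left)
    have "1 - \<epsilon> \<le> \<phi> e" using Pe[OF \<epsilon>] by (intro ge eI) (simp add: scaleR_diff_left)
    then show "1 \<le> \<phi> e + \<epsilon>" by simp
  qed
  have "lattice_state e \<phi>" unfolding lattice_state_def using add sup scale one by blast
  moreover have "\<delta> \<le> \<phi> u" using F(2) u by (intro ge) (auto simp: P_def a_def)
  ultimately show ?thesis by blast
qed

section \<open>Positively homogeneous functions\<close>

text \<open>
  Functions of \<open>n\<close> variables are functions on all sequences, and these sequences form the copy of \<open>\<real>\<^sup>n\<close>
  that determines them.
\<close>

definition supported_vectors :: "nat \<Rightarrow> (nat \<Rightarrow> real) set" where
  "supported_vectors n = {v. \<forall>k\<ge>n. v k = 0}"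

definition l1 :: "nat \<Rightarrow> (nat \<Rightarrow> real) \<Rightarrow> real" where
  "l1 n v = (\<Sum>k<n. \<bar>v k\<bar>)"

definition l1_sphere :: "nat \<Rightarrow> (nat \<Rightarrow> real) set" where
  "l1_sphere n = {v \<in> supported_vectors n. l1 n v = 1}"

text \<open>
  For \<open>c\<close> on the sphere, the supported vectors where this function vanishes are the nonnegative multiples
  of \<open>c\<close>. Unlike a distance, it is itself positively homogeneous and a lattice expression in the
  coordinates, so that it can be evaluated in a vector lattice.
\<close>

definition ray_gauge :: "nat \<Rightarrow> (nat \<Rightarrow> real) \<Rightarrow> (nat \<Rightarrow> real) \<Rightarrow> real" where
  "ray_gauge n c v = (\<Sum>k<n. \<bar>v k - c k * l1 n v\<bar>)"

lemma continuous_on_coordinate: "continuous_on A (\<lambda>v :: nat \<Rightarrow> real. v k)"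
  by (rule continuous_on_subset[OF continuous_on_product_coordinates]) simp

lemma continuous_on_l1: "continuous_on A (l1 n)"
  unfolding l1_def by (intro continuous_intros continuous_on_coordinate)

lemma continuous_on_ray_gauge: "continuous_on A (ray_gauge n c)"
  unfolding ray_gauge_def
  by (intro continuous_intros continuous_on_coordinate continuous_on_l1)

lemma l1_scale: "0 \<le> t \<Longrightarrow> l1 n (\<lambda>k. t * v k) = t * l1 n v"
  by (simp add: l1_def abs_mult sum_distrib_left)

lemma compact_l1_sphere: "compact (l1_sphere n)"
proof -
  define B where "B k = (if k < n then {-1..1} else {0::real})" for k :: nat
  have "compactin (product_topology (\<lambda>_. euclidean) UNIV) (PiE UNIV B)"
    unfolding compactin_PiE by (auto simp: B_def)
  then have "compact (PiE UNIV B)" by (simp add: euclidean_product_topology)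
  moreover have "l1_sphere n = PiE UNIV B \<inter> (l1 n -` {1})"
  proof
    have "\<bar>v k\<bar> \<le> 1" if "l1 n v = 1" "k < n" for v k
      using that member_le_sum[of k "{..<n}" "\<lambda>k. \<bar>v k\<bar>"] by (simp add: l1_def)
    then show "l1_sphere n \<subseteq> PiE UNIV B \<inter> (l1 n -` {1})"
      by (fastforce simp: l1_sphere_def supported_vectors_def B_def abs_le_iff)
    show "PiE UNIV B \<inter> (l1 n -` {1}) \<subseteq> l1_sphere n"
      by (auto simp: l1_sphere_def supported_vectors_def B_def PiE_iff split: if_splits)
  qed
  moreover have "closed (l1 n -` {1})"
    by (intro closed_vimage continuous_on_l1) auto
  ultimately show ?thesis by (simp add: compact_Int_closed)
qed

lemma homogeneous_functionsD:
  assumes "f \<in> homogeneous_functions n"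
  shows "continuous_on A f" "0 \<le> c \<Longrightarrow> f (\<lambda>k. c * v k) = c * f v"
    "(\<And>k. k < n \<Longrightarrow> v k = w k) \<Longrightarrow> f v = f w"
proof -
  have "continuous_on UNIV f" using assms by (simp add: homogeneous_functions_def)
  then show "continuous_on A f" by (rule continuous_on_subset) simp
  show "f (\<lambda>k. c * v k) = c * f v" if "0 \<le> c" using assms that by (simp add: homogeneous_functions_def)
  show "f v = f w" if "\<And>k. k < n \<Longrightarrow> v k = w k"
  proof -
    have "\<forall>k<n. v k = w k" using that by simp
    then show ?thesis using assms unfolding homogeneous_functions_def by blast
  qed
qed

lemma homogeneous_functionsI:
  assumes "continuous_on UNIV f" "\<And>v w. (\<And>k. k < n \<Longrightarrow> v k = w k) \<Longrightarrow> f v = f w"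
    "\<And>c v. 0 \<le> c \<Longrightarrow> f (\<lambda>k. c * v k) = c * f v"
  shows "f \<in> homogeneous_functions n"
  using assms unfolding homogeneous_functions_def by blast

lemma homogeneous_zero: "f \<in> homogeneous_functions n \<Longrightarrow> f (\<lambda>_. 0) = 0"
  using homogeneous_functionsD(2)[of f n 0 "\<lambda>_. 0"] by simp

lemma homogeneous_add:
  assumes f: "f \<in> homogeneous_functions n" and g: "g \<in> homogeneous_functions n"
  shows "(\<lambda>v. f v + g v) \<in> homogeneous_functions n"
proof (rule homogeneous_functionsI)
  show "continuous_on UNIV (\<lambda>v. f v + g v)"
    by (intro continuous_on_add homogeneous_functionsD(1)[OF f] homogeneous_functionsD(1)[OF g])
  show "f v + g v = f w + g w" if "\<And>k. k < n \<Longrightarrow> v k = w k" for v w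
    using homogeneous_functionsD(3)[OF f that] homogeneous_functionsD(3)[OF g that] by simp
  show "f (\<lambda>k. c * v k) + g (\<lambda>k. c * v k) = c * (f v + g v)" if "0 \<le> c" for c v
    using that by (simp add: homogeneous_functionsD(2)[OF f] homogeneous_functionsD(2)[OF g] distrib_left)
qed

lemma homogeneous_cmult:
  assumes f: "f \<in> homogeneous_functions n"
  shows "(\<lambda>v. c * f v) \<in> homogeneous_functions n"
proof (rule homogeneous_functionsI)
  show "continuous_on UNIV (\<lambda>v. c * f v)"
    by (intro continuous_on_mult_left homogeneous_functionsD(1)[OF f])
  show "c * f v = c * f w" if "\<And>k. k < n \<Longrightarrow> v k = w k" for v w
    using homogeneous_functionsD(3)[OF f that] by simp
  show "c * f (\<lambda>k. t * v k) = t * (c * f v)" if "0 \<le> t" for t v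
    using that by (simp add: homogeneous_functionsD(2)[OF f])
qed

lemma homogeneous_max:
  assumes f: "f \<in> homogeneous_functions n" and g: "g \<in> homogeneous_functions n"
  shows "(\<lambda>v. max (f v) (g v)) \<in> homogeneous_functions n"
proof (rule homogeneous_functionsI)
  show "continuous_on UNIV (\<lambda>v. max (f v) (g v))"
    by (intro continuous_on_max homogeneous_functionsD(1)[OF f] homogeneous_functionsD(1)[OF g])
  show "max (f v) (g v) = max (f w) (g w)" if "\<And>k. k < n \<Longrightarrow> v k = w k" for v w
    using homogeneous_functionsD(3)[OF f that] homogeneous_functionsD(3)[OF g that] by simp
  show "max (f (\<lambda>k. c * v k)) (g (\<lambda>k. c * v k)) = c * max (f v) (g v)" if "0 \<le> c" for c v
    using that by (simp add: homogeneous_functionsD(2)[OF f] homogeneous_functionsD(2)[OF g] max_mult_distrib_left)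
qed

lemma homogeneous_coord: "k < n \<Longrightarrow> (\<lambda>v. v k) \<in> homogeneous_functions n"
  unfolding homogeneous_functions_def by (simp add: continuous_on_coordinate)

lemma homogeneous_abs:
  assumes "f \<in> homogeneous_functions n"
  shows "(\<lambda>v. \<bar>f v\<bar>) \<in> homogeneous_functions n"
proof -
  have "(\<lambda>v. max (f v) ((-1) * f v)) \<in> homogeneous_functions n"
    by (intro homogeneous_max homogeneous_cmult assms)
  moreover have "max (f v) ((-1) * f v) = \<bar>f v\<bar>" for v by simp
  ultimately show ?thesis by simp
qed

lemma homogeneous_const0: "(\<lambda>v. 0) \<in> homogeneous_functions n"
  unfolding homogeneous_functions_def by simp

lemma homogeneous_sum:
  assumes "\<And>i. i \<in> I \<Longrightarrow> f i \<in> homogeneous_functions n"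
  shows "(\<lambda>v. \<Sum>i\<in>I. f i v) \<in> homogeneous_functions n"
  using assms
  by (induction I rule: infinite_finite_induct) (auto intro: homogeneous_const0 homogeneous_add)

lemma homogeneous_l1: "l1 n \<in> homogeneous_functions n"
  unfolding l1_def by (intro homogeneous_sum homogeneous_abs homogeneous_coord) auto

lemma homogeneous_ray_gauge: "ray_gauge n c \<in> homogeneous_functions n"
proof -
  have "(\<lambda>v. \<Sum>k<n. \<bar>v k + (- c k) * l1 n v\<bar>) \<in> homogeneous_functions n"
    by (intro homogeneous_sum homogeneous_abs homogeneous_add homogeneous_cmult homogeneous_coord homogeneous_l1) auto
  then show ?thesis by (simp add: ray_gauge_def[abs_def])
qed

lemma homogeneous_sphere_cases:
  assumes "v \<in> supported_vectors n"
  obtains "v = (\<lambda>_. 0)" "l1 n v = 0" | u where "u \<in> l1_sphere n" "0 < l1 n v" "v = (\<lambda>k. l1 n v * u k)"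
proof (cases "l1 n v = 0")
  case True
  then have "v k = 0" if "k < n" for k
    using that by (simp add: l1_def sum_nonneg_eq_0_iff)
  then have "v = (\<lambda>_. 0)" using assms by (auto simp: supported_vectors_def) (metis not_le)
  then show ?thesis using that(1) True by blast
next
  case False
  then have p: "0 < l1 n v" unfolding l1_def by (smt (verit) sum_nonneg abs_ge_zero)
  have "l1 n (\<lambda>k. inverse (l1 n v) * v k) = 1" using p by (subst l1_scale) auto
  then have "(\<lambda>k. inverse (l1 n v) * v k) \<in> l1_sphere n"
    using assms by (auto simp: l1_sphere_def supported_vectors_def)
  then show ?thesis using that(2)[of "\<lambda>k. inverse (l1 n v) * v k"] p by (simp add: fun_eq_iff)
qed

lemma homogeneous_le_from_sphere:
  assumes f: "f \<in> homogeneous_functions n" and g: "g \<in> homogeneous_functions n"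
    and le: "\<And>u. u \<in> l1_sphere n \<Longrightarrow> f u \<le> g u" and v: "v \<in> supported_vectors n"
  shows "f v \<le> g v"
  using v
proof (cases rule: homogeneous_sphere_cases)
  case 1
  then show ?thesis using homogeneous_zero[OF f] homogeneous_zero[OF g] by simp
next
  case (2 u)
  have "l1 n v * f u \<le> l1 n v * g u" using 2 le by (intro mult_left_mono) auto
  then have "f (\<lambda>k. l1 n v * u k) \<le> g (\<lambda>k. l1 n v * u k)"
    using 2(2) by (simp add: homogeneous_functionsD(2)[OF f] homogeneous_functionsD(2)[OF g])
  then show ?thesis using 2(3) by simp
qed

lemma homogeneous_bounded:
  assumes f: "f \<in> homogeneous_functions n"
  obtains B where "0 \<le> B" "\<And>v. v \<in> supported_vectors n \<Longrightarrow> \<bar>f v\<bar> \<le> B * l1 n v"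
proof -
  have "compact (f ` l1_sphere n)"
    by (intro compact_continuous_image compact_l1_sphere homogeneous_functionsD(1)[OF f])
  then obtain B where B: "\<And>u. u \<in> l1_sphere n \<Longrightarrow> \<bar>f u\<bar> \<le> B"
    by (metis bounded_iff compact_imp_bounded imageI real_norm_def)
  have "\<bar>f v\<bar> \<le> \<bar>B\<bar> * l1 n v" if "v \<in> supported_vectors n" for v
    by (rule homogeneous_le_from_sphere[OF homogeneous_abs[OF f] homogeneous_cmult[OF homogeneous_l1] _ that])
      (use B in \<open>auto simp: l1_sphere_def intro: order_trans[OF _ abs_ge_self]\<close>)
  then show ?thesis using that[of "\<bar>B\<bar>"] by simp
qed

text \<open>
  On the sphere, \<open>f - f c\<close> is small near \<open>c\<close> by continuity. Away from \<open>c\<close> the gauge is bounded below by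
  compactness, and a large multiple of it dominates the bounded function \<open>f - f c\<close>.
\<close>

lemma homogeneous_near_ray:
  assumes f: "f \<in> homogeneous_functions n" and c: "c \<in> l1_sphere n" and \<eta>: "0 < \<eta>"
  obtains K where "0 \<le> K"
    "\<And>v. v \<in> supported_vectors n \<Longrightarrow> \<bar>f v - f c * l1 n v\<bar> \<le> \<eta> * l1 n v + K * ray_gauge n c v"
proof -
  define h where "h v = f v + (- f c) * l1 n v" for v
  have h: "h \<in> homogeneous_functions n"
    unfolding h_def[abs_def] by (intro homogeneous_add homogeneous_cmult f homogeneous_l1)
  obtain B where B: "0 \<le> B" "\<And>v. v \<in> supported_vectors n \<Longrightarrow> \<bar>h v\<bar> \<le> B * l1 n v"
    using homogeneous_bounded[OF h] by blast
  define S where "S = l1_sphere n \<inter> {v. \<eta> \<le> \<bar>h v\<bar>}"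
  have "closed {v. \<eta> \<le> \<bar>h v\<bar>}"
    by (intro closed_Collect_le continuous_intros homogeneous_functionsD(1)[OF h])
  then have S: "compact S" unfolding S_def by (intro compact_Int_closed compact_l1_sphere)
  have gauge0: "0 \<le> ray_gauge n c v" for v by (auto simp: ray_gauge_def intro!: sum_nonneg)
  have "\<exists>K\<ge>0. \<forall>u\<in>S. B \<le> K * ray_gauge n c u"
  proof (cases "S = {}")
    case False
    obtain u0 where u0: "u0 \<in> S" "\<And>u. u \<in> S \<Longrightarrow> ray_gauge n c u0 \<le> ray_gauge n c u"
      using continuous_attains_inf[OF S False continuous_on_ray_gauge] by blast
    have "ray_gauge n c u0 \<noteq> 0"
    proof
      assume "ray_gauge n c u0 = 0"
      then have "u0 k = c k" if "k < n" for k
        using that u0(1) by (simp add: ray_gauge_def sum_nonneg_eq_0_iff S_def l1_sphere_def)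
      then have "h u0 = h c" by (intro homogeneous_functionsD(3)[OF h])
      also have "h c = 0" using c by (simp add: h_def l1_sphere_def)
      finally show False using u0(1) \<eta> by (simp add: S_def)
    qed
    then have p: "0 < ray_gauge n c u0" using gauge0[of u0] by simp
    have "B \<le> (B / ray_gauge n c u0) * ray_gauge n c u" if "u \<in> S" for u
      using mult_left_mono[OF u0(2)[OF that], of "B / ray_gauge n c u0"] p B(1) by simp
    then show ?thesis using p B(1) by (intro exI[of _ "B / ray_gauge n c u0"]) auto
  qed auto
  then obtain K where K: "0 \<le> K" "\<And>u. u \<in> S \<Longrightarrow> B \<le> K * ray_gauge n c u" by blast
  have "\<bar>h v\<bar> \<le> \<eta> * l1 n v + K * ray_gauge n c v" if "v \<in> supported_vectors n" for v
  proof (rule homogeneous_le_from_sphere[OF homogeneous_abs[OF h] _ _ that])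
    show "(\<lambda>v. \<eta> * l1 n v + K * ray_gauge n c v) \<in> homogeneous_functions n"
      by (intro homogeneous_add homogeneous_cmult homogeneous_l1 homogeneous_ray_gauge)
    fix u assume u: "u \<in> l1_sphere n"
    show "\<bar>h u\<bar> \<le> \<eta> * l1 n u + K * ray_gauge n c u"
    proof (cases "u \<in> S")
      case True
      have "\<bar>h u\<bar> \<le> B" using B(2)[of u] u by (simp add: l1_sphere_def)
      then show ?thesis using K(2)[OF True] u \<eta> by (simp add: l1_sphere_def)
    next
      case False
      then have "\<bar>h u\<bar> \<le> \<eta>" using u by (simp add: S_def)
      then show ?thesis using u K(1) gauge0[of u] by (simp add: l1_sphere_def add_increasing2)
    qed
  qed
  then show ?thesis using that[OF K(1)] by (simp add: h_def)
qed

text \<open>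
  This gives uniqueness of Krivine's calculus. A lattice homomorphism maps the gauge of the ray
  through \<open>c\<close> to its value at \<open>c\<close>, which is zero. By \<open>homogeneous_near_ray\<close> it therefore cannot
  distinguish \<open>f\<close> from the multiple of \<open>l1 n\<close> which agrees with \<open>f\<close> on that ray.
\<close>

lemma homogeneous_hom_is_evaluation:
  assumes add: "\<And>f g. f \<in> homogeneous_functions n \<Longrightarrow> g \<in> homogeneous_functions n \<Longrightarrow>
      \<Lambda> (\<lambda>v. f v + g v) = \<Lambda> f + \<Lambda> g"
    and max: "\<And>f g. f \<in> homogeneous_functions n \<Longrightarrow> g \<in> homogeneous_functions n \<Longrightarrow>
      \<Lambda> (\<lambda>v. max (f v) (g v)) = max (\<Lambda> f) (\<Lambda> g)"
    and cmult: "\<And>f c. f \<in> homogeneous_functions n \<Longrightarrow> \<Lambda> (\<lambda>v. c * f v) = c * \<Lambda> f"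
    and c: "c \<in> supported_vectors n" "\<And>k. k < n \<Longrightarrow> c k = \<Lambda> (\<lambda>v. v k)"
    and f: "f \<in> homogeneous_functions n"
  shows "\<Lambda> f = (f c :: real)"
proof -
  let ?H = "homogeneous_functions n"
  have abs: "\<Lambda> (\<lambda>v. \<bar>g v\<bar>) = \<bar>\<Lambda> g\<bar>" if "g \<in> ?H" for g
  proof -
    have "\<Lambda> (\<lambda>v. max (g v) ((-1) * g v)) = max (\<Lambda> g) ((-1) * \<Lambda> g)"
      using that by (simp only: max cmult homogeneous_cmult)
    moreover have "max (g v) ((-1) * g v) = \<bar>g v\<bar>" for v by simp
    ultimately show ?thesis by simp
  qed
  have cong: "\<Lambda> g = \<Lambda> (\<lambda>v. g (\<lambda>k. if k < n then v k else 0))" if "g \<in> ?H" for g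
  proof -
    have "g = (\<lambda>v. g (\<lambda>k. if k < n then v k else 0))"
      by (rule ext, rule homogeneous_functionsD(3)[OF that]) simp
    then show ?thesis by simp
  qed
  have le: "\<Lambda> g \<le> \<Lambda> h" if "g \<in> ?H" "h \<in> ?H" "\<And>v. v \<in> supported_vectors n \<Longrightarrow> g v \<le> h v" for g h
  proof -
    have "g v \<le> h v" for v
    proof -
      let ?v = "\<lambda>k. if k < n then v k else 0"
      have "g v = g ?v" "h v = h ?v"
        by (rule homogeneous_functionsD(3)[OF \<open>g \<in> ?H\<close>], simp, rule homogeneous_functionsD(3)[OF \<open>h \<in> ?H\<close>], simp)
      moreover have "?v \<in> supported_vectors n" by (simp add: supported_vectors_def)
      ultimately show ?thesis using that(3)[of ?v] by simp
    qed
    then have "(\<lambda>v. max (g v) (h v)) = h" by (auto simp: max_def)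
    then show ?thesis using max[OF that(1,2)] by simp
  qed
  have zero: "\<Lambda> (\<lambda>v. 0) = 0" using cmult[OF f, of 0] by simp
  have sum: "\<Lambda> (\<lambda>v. \<Sum>k<m. g k v) = (\<Sum>k<m. \<Lambda> (g k))" if "m \<le> n" "\<And>k. k < n \<Longrightarrow> g k \<in> ?H" for g :: "nat \<Rightarrow> (nat \<Rightarrow> real) \<Rightarrow> real" and m
    using that(1)
  proof (induction m)
    case (Suc m)
    then have "(\<lambda>v. \<Sum>k<m. g k v) \<in> ?H" "g m \<in> ?H" using that(2) by (auto intro!: homogeneous_sum)
    from add[OF this] Suc show ?case by simp
  qed (simp add: zero)
  have L1: "\<Lambda> (l1 n) = l1 n c"
    using sum[of n "\<lambda>k v. \<bar>v k\<bar>"] c(2) by (simp add: l1_def[abs_def] homogeneous_abs homogeneous_coord abs)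
  show ?thesis
    using c(1)
  proof (cases rule: homogeneous_sphere_cases)
    case 1
    obtain B where B: "0 \<le> B" "\<And>v. v \<in> supported_vectors n \<Longrightarrow> \<bar>f v\<bar> \<le> B * l1 n v"
      using homogeneous_bounded[OF f] by blast
    have "\<bar>\<Lambda> f\<bar> \<le> B * l1 n c"
      using le[OF homogeneous_abs[OF f] homogeneous_cmult[OF homogeneous_l1] B(2)]
      by (simp add: abs f cmult homogeneous_l1 L1)
    then show ?thesis using 1 homogeneous_zero[OF f] by simp
  next
    case (2 u)
    have G: "\<Lambda> (ray_gauge n u) = 0"
    proof -
      have "\<Lambda> (\<lambda>v. \<Sum>k<n. \<bar>v k + (- u k) * l1 n v\<bar>) = (\<Sum>k<n. \<bar>c k + (- u k) * l1 n c\<bar>)"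
      proof -
        have k: "(\<lambda>v. v k + (- u k) * l1 n v) \<in> ?H" if "k < n" for k
          using that by (intro homogeneous_add homogeneous_cmult homogeneous_l1 homogeneous_coord)
        have "\<Lambda> (\<lambda>v. \<bar>v k + (- u k) * l1 n v\<bar>) = \<bar>c k + (- u k) * l1 n c\<bar>" if "k < n" for k
          using that by (simp only: abs[OF k] add cmult c(2) L1 homogeneous_cmult homogeneous_l1 homogeneous_coord)
        then show ?thesis
          using sum[of n "\<lambda>k v. \<bar>v k + (- u k) * l1 n v\<bar>"] homogeneous_abs[OF k] by simp
      qed
      also have "\<dots> = 0"
      proof (intro sum.neutral ballI)
        fix k
        have "c k = l1 n c * u k" using 2(3) by metis
        then show "\<bar>c k + (- u k) * l1 n c\<bar> = 0" by simp
      qed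
      finally show ?thesis by (simp add: ray_gauge_def[abs_def])
    qed
    have "\<bar>\<Lambda> f - f u * l1 n c\<bar> \<le> \<eta> * l1 n c" if \<eta>: "0 < \<eta>" for \<eta>
    proof -
      obtain K where K: "0 \<le> K"
        "\<And>v. v \<in> supported_vectors n \<Longrightarrow> \<bar>f v - f u * l1 n v\<bar> \<le> \<eta> * l1 n v + K * ray_gauge n u v"
        using homogeneous_near_ray[OF f 2(1) \<eta>] by blast
      have h: "(\<lambda>v. f v + (- f u) * l1 n v) \<in> ?H" by (intro homogeneous_add homogeneous_cmult f homogeneous_l1)
      have g: "(\<lambda>v. \<eta> * l1 n v + K * ray_gauge n u v) \<in> ?H"
        by (intro homogeneous_add homogeneous_cmult homogeneous_l1 homogeneous_ray_gauge)
      have "\<Lambda> (\<lambda>v. \<bar>f v + (- f u) * l1 n v\<bar>) \<le> \<Lambda> (\<lambda>v. \<eta> * l1 n v + K * ray_gauge n u v)"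
        using K(2) by (intro le homogeneous_abs h g) auto
      also have "\<dots> = \<eta> * l1 n c"
        by (simp add: add cmult homogeneous_cmult homogeneous_l1 homogeneous_ray_gauge G L1)
      also have "\<Lambda> (\<lambda>v. \<bar>f v + (- f u) * l1 n v\<bar>) = \<bar>\<Lambda> f + (- f u) * l1 n c\<bar>"
        by (simp only: abs[OF h] add cmult f homogeneous_cmult homogeneous_l1 L1)
      finally show ?thesis by simp
    qed
    then have "\<bar>\<Lambda> f - f u * l1 n c\<bar> \<le> 0 + \<epsilon>" if "0 < \<epsilon>" for \<epsilon>
      using that 2(2) by (metis add_0 divide_pos_pos nonzero_eq_divide_eq less_irrefl)
    then have "\<bar>\<Lambda> f - f u * l1 n c\<bar> \<le> 0" by (rule field_le_epsilon)
    moreover have "f c = l1 n c * f u"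
      using homogeneous_functionsD(2)[OF f, of "l1 n c" u] 2(2,3) by simp
    ultimately show ?thesis by simp
  qed
qed

text \<open>
  A Stone-Weierstrass theorem for the vector lattices \<open>\<R>\<close> that contain the coordinates. By
  \<open>homogeneous_near_ray\<close>, for each \<open>c\<close> on the sphere some combination \<open>h c\<close> of \<open>l1 n\<close> and the gauge lies above
  \<open>f\<close> everywhere and is close to \<open>f\<close> near \<open>c\<close>. The minimum of finitely many \<open>h c\<close> is close to \<open>f\<close> on the
  whole sphere.
\<close>

lemma homogeneous_approx:
  assumes f: "f \<in> homogeneous_functions n" and \<eta>: "0 < \<eta>" and n: "0 < n"
    and cl: "\<And>g h. g \<in> \<R> \<Longrightarrow> h \<in> \<R> \<Longrightarrow> (\<lambda>v. g v + h v) \<in> \<R>"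
      "\<And>g c. g \<in> \<R> \<Longrightarrow> (\<lambda>v. c * g v) \<in> \<R>"
      "\<And>g h. g \<in> \<R> \<Longrightarrow> h \<in> \<R> \<Longrightarrow> (\<lambda>v. max (g v) (h v)) \<in> \<R>"
      "\<And>k. k < n \<Longrightarrow> (\<lambda>v. v k) \<in> \<R>"
  shows "\<exists>g\<in>\<R>. \<forall>v\<in>supported_vectors n. \<bar>f v - g v\<bar> \<le> \<eta> * l1 n v"
proof -
  have abs: "(\<lambda>v. \<bar>g v\<bar>) \<in> \<R>" if "g \<in> \<R>" for g :: "(nat \<Rightarrow> real) \<Rightarrow> real"
  proof -
    have "(\<lambda>v. max (g v) ((-1) * g v)) \<in> \<R>" by (intro cl that)
    moreover have "max (g v) ((-1) * g v) = \<bar>g v\<bar>" for v by simp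
    ultimately show ?thesis by simp
  qed
  have zero: "(\<lambda>v. 0) \<in> \<R>" using cl(2)[OF cl(4)[OF n], of 0] by simp
  have sum: "(\<lambda>v. \<Sum>k<m. g k v) \<in> \<R>" if "\<And>k. k < m \<Longrightarrow> g k \<in> \<R>" for g :: "nat \<Rightarrow> (nat \<Rightarrow> real) \<Rightarrow> real" and m
    using that by (induction m) (auto intro: zero cl)
  have min: "(\<lambda>v. min (g v) (h v)) \<in> \<R>" if "g \<in> \<R>" "h \<in> \<R>" for g h :: "(nat \<Rightarrow> real) \<Rightarrow> real"
  proof -
    have "(\<lambda>v. (-1) * max ((-1) * g v) ((-1) * h v)) \<in> \<R>" by (intro cl that)
    moreover have "(-1) * max ((-1) * g v) ((-1) * h v) = min (g v) (h v)" for v by (simp add: min_def max_def)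
    ultimately show ?thesis by simp
  qed
  have l1R: "l1 n \<in> \<R>" unfolding l1_def[abs_def] by (intro sum abs cl)
  have gaugeR: "ray_gauge n c \<in> \<R>" for c
  proof -
    have "(\<lambda>v. \<Sum>k<n. \<bar>v k + (- c k) * l1 n v\<bar>) \<in> \<R>" by (intro sum abs cl l1R)
    then show ?thesis by (simp add: ray_gauge_def[abs_def])
  qed
  define \<theta> where "\<theta> = \<eta> / 2"
  have \<theta>: "0 < \<theta>" using \<eta> by (simp add: \<theta>_def)
  have "\<forall>c\<in>l1_sphere n. \<exists>K\<ge>0. \<forall>v\<in>supported_vectors n. \<bar>f v - f c * l1 n v\<bar> \<le> \<theta> * l1 n v + K * ray_gauge n c v"
    using homogeneous_near_ray[OF f _ \<theta>] by metis
  then obtain K where K: "\<And>c. c \<in> l1_sphere n \<Longrightarrow> 0 \<le> K c"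
     "\<And>c v. c \<in> l1_sphere n \<Longrightarrow> v \<in> supported_vectors n \<Longrightarrow>
        \<bar>f v - f c * l1 n v\<bar> \<le> \<theta> * l1 n v + K c * ray_gauge n c v"
    by (metis (no_types, lifting))
  define h where "h c v = (f c + \<theta>) * l1 n v + K c * ray_gauge n c v" for c v
  have hR: "h c \<in> \<R>" for c unfolding h_def[abs_def] by (intro cl l1R gaugeR)
  have hH: "h c \<in> homogeneous_functions n" for c unfolding h_def[abs_def]
    by (intro homogeneous_add homogeneous_cmult homogeneous_l1 homogeneous_ray_gauge)
  have f_le_h: "f v \<le> h c v" if "c \<in> l1_sphere n" "v \<in> supported_vectors n" for c v
    using K(2)[OF that] by (simp add: h_def algebra_simps abs_le_iff)
  define U where "U c = {v. h c v < f v + \<eta>}" for c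
  have "open (U c)" for c unfolding U_def
    by (intro open_Collect_less continuous_intros homogeneous_functionsD(1)[OF f] homogeneous_functionsD(1)[OF hH])
  moreover have "c \<in> U c" if "c \<in> l1_sphere n" for c
  proof -
    have "ray_gauge n c c = 0" using that by (simp add: ray_gauge_def l1_sphere_def)
    then show ?thesis using that \<theta> by (simp add: U_def h_def l1_sphere_def \<theta>_def)
  qed
  ultimately obtain D where D: "D \<subseteq> l1_sphere n" "finite D" "l1_sphere n \<subseteq> (\<Union>c\<in>D. U c)"
    using compactE_image[OF compact_l1_sphere, of "l1_sphere n" U n] by (metis UN_I subsetI)
  have ne: "l1_sphere n \<noteq> {}"
  proof -
    have "l1 n (\<lambda>k. if k = 0 then 1 else 0) = (\<Sum>k<n. if k = 0 then 1 else 0)"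
      unfolding l1_def by (intro sum.cong) auto
    also have "\<dots> = (1::real)" using n by simp
    finally have "(\<lambda>k. if k = 0 then 1 else 0) \<in> l1_sphere n" using n by (auto simp: l1_sphere_def supported_vectors_def)
    then show ?thesis by blast
  qed
  have net: "\<exists>g\<in>\<R> \<inter> homogeneous_functions n. \<forall>v. (\<forall>c\<in>D'. g v \<le> h c v) \<and> (\<exists>c\<in>D'. g v = h c v)"
    if "finite D'" "D' \<noteq> {}" for D'
    using that
  proof (induction D' rule: finite_ne_induct)
    case (singleton c)
    then show ?case using hR hH by (intro bexI[of _ "h c"]) auto
  next
    case (insert c D')
    then obtain g where g: "g \<in> \<R>" "g \<in> homogeneous_functions n"
      "\<And>v. (\<forall>c\<in>D'. g v \<le> h c v) \<and> (\<exists>c\<in>D'. g v = h c v)" by auto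
    have "(\<lambda>v. (-1) * max ((-1) * g v) ((-1) * h c v)) \<in> homogeneous_functions n"
      by (intro homogeneous_cmult homogeneous_max g hH)
    moreover have "(-1) * max ((-1) * g v) ((-1) * h c v) = min (g v) (h c v)" for v by (simp add: min_def max_def)
    ultimately have 1: "(\<lambda>v. min (g v) (h c v)) \<in> homogeneous_functions n" by simp
    have 2: "(\<lambda>v. min (g v) (h c v)) \<in> \<R>" using g hR by (intro min)
    have 3: "(\<forall>c'\<in>insert c D'. min (g v) (h c v) \<le> h c' v) \<and>
        (\<exists>c'\<in>insert c D'. min (g v) (h c v) = h c' v)" for v
      using g(3)[of v] by (auto simp: min_le_iff_disj min_def)
    show ?case by (intro bexI[of _ "\<lambda>v. min (g v) (h c v)"] allI IntI 1 2 3)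
  qed
  have "D \<noteq> {}" using ne D(3) by auto
  from net[OF D(2) this] obtain g where "g \<in> \<R> \<inter> homogeneous_functions n"
    and g0: "\<forall>v. (\<forall>c\<in>D. g v \<le> h c v) \<and> (\<exists>c\<in>D. g v = h c v)" by (rule bexE)
  then have g: "g \<in> \<R>" "g \<in> homogeneous_functions n" by simp_all
  have g_le: "g v \<le> h c v" if "c \<in> D" for c v using g0 that by blast
  have g_eq: "\<exists>c\<in>D. g v = h c v" for v using g0 by blast
  have "\<bar>f v - g v\<bar> \<le> \<eta> * l1 n v" if v: "v \<in> supported_vectors n" for v
  proof -
    have "f v + (-1) * g v \<le> 0" using g_eq[of v] f_le_h[OF _ v] D(1) by force
    moreover have "g v \<le> f v + \<eta> * l1 n v"
    proof (rule homogeneous_le_from_sphere[OF g(2) _ _ v])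
      show "(\<lambda>v. f v + \<eta> * l1 n v) \<in> homogeneous_functions n"
        by (intro homogeneous_add homogeneous_cmult f homogeneous_l1)
      fix u assume u: "u \<in> l1_sphere n"
      then obtain c where "c \<in> D" "u \<in> U c" using D(3) by blast
      then show "g u \<le> f u + \<eta> * l1 n u" using g_le[of c u] u by (simp add: U_def l1_sphere_def)
    qed
    ultimately show ?thesis by simp
  qed
  then show ?thesis using g(1) by blast
qed

section \<open>Krivine's functional calculus in quasi-Banach lattices\<close>

lemma lattice_abs_nonneg: "0 \<le> lattice_abs y"
proof -
  have "y + - y \<le> lattice_abs y + lattice_abs y" unfolding lattice_abs_def by (intro add_mono) auto
  then have "0 \<le> 2 *\<^sub>R lattice_abs y" by (simp add: scaleR_2)
  then have "(1/2) *\<^sub>R 0 \<le> (1/2) *\<^sub>R (2 *\<^sub>R lattice_abs y)" by (intro scaleR_left_mono) auto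
  then show ?thesis by simp
qed

lemma lattice_abs_of_nonneg: "0 \<le> x \<Longrightarrow> lattice_abs x = x"
  unfolding lattice_abs_def by (intro sup_absorb1) (meson neg_le_0_iff_le order_trans)

locale principal_ideal =
  fixes NY :: "'y::{ordered_real_vector,lattice} \<Rightarrow> real" and e :: 'y
  assumes lattice: "quasi_banach_lattice NY" and e: "0 \<le> e"
begin

lemma NY_nonneg: "0 \<le> NY x" and NY_zero: "NY x = 0 \<longleftrightarrow> x = 0" and NY_scale: "NY (c *\<^sub>R x) = \<bar>c\<bar> * NY x"
  using lattice unfolding quasi_banach_lattice_def quasi_banach_def by auto

lemma NY_complete: "quasinorm_Cauchy NY u \<Longrightarrow> \<exists>l. quasinorm_tendsto NY u l"
  using lattice unfolding quasi_banach_lattice_def quasi_banach_def by blast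

lemma NY_mono: "lattice_abs x \<le> lattice_abs y \<Longrightarrow> NY x \<le> NY y"
  using lattice unfolding quasi_banach_lattice_def by blast

lemma archimedean:
  assumes "\<And>\<epsilon>. 0 < \<epsilon> \<Longrightarrow> x \<le> \<epsilon> *\<^sub>R e"
  shows "x \<le> 0"
proof -
  have "NY (pos x) \<le> 0 + \<epsilon>" if \<epsilon>: "0 < \<epsilon>" for \<epsilon>
  proof -
    define d where "d = \<epsilon> / (NY e + 1)"
    have p: "0 < NY e + 1" using NY_nonneg[of e] by simp
    then have d: "0 < d" using \<epsilon> by (simp add: d_def)
    have "0 \<le> d *\<^sub>R e" using d e by (intro scaleR_nonneg_nonneg) auto
    then have "pos x \<le> d *\<^sub>R e" using assms[OF d] by simp
    then have "NY (pos x) \<le> NY (d *\<^sub>R e)"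
      using \<open>0 \<le> d *\<^sub>R e\<close> by (intro NY_mono) (simp add: lattice_abs_of_nonneg)
    also have "\<dots> \<le> d * (NY e + 1)" using d by (simp add: NY_scale)
    also have "\<dots> = \<epsilon>" using p by (simp add: d_def)
    finally show ?thesis by simp
  qed
  then have "NY (pos x) \<le> 0" by (rule field_le_epsilon)
  then have "pos x = 0" using NY_nonneg[of "pos x"] NY_zero by simp
  then show ?thesis by (metis sup.cobounded1)
qed

abbreviation I where "I \<equiv> order_ideal e"

lemmas I_add = order_ideal_add[of _ e]
lemmas I_uminus = order_ideal_uminus[of _ e]
lemmas I_scale = order_ideal_scale[OF _ e]
lemmas I_sup = order_ideal_sup[OF _ _ e]
lemmas I_between = order_ideal_between[OF _ _ _ _ e]

lemma I_zero: "0 \<in> I"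
  using I_scale[OF order_ideal_self[OF e], of 0] by simp

lemma I_diff: "x \<in> I \<Longrightarrow> y \<in> I \<Longrightarrow> x - y \<in> I"
  using I_add[OF _ I_uminus, of x y] by simp

lemma I_sum: "(\<And>i. i \<in> A \<Longrightarrow> f i \<in> I) \<Longrightarrow> sum f A \<in> I"
  by (induction A rule: infinite_finite_induct) (auto intro: I_zero I_add)

lemma state_add: "lattice_state e \<phi> \<Longrightarrow> x \<in> I \<Longrightarrow> y \<in> I \<Longrightarrow> \<phi> (x + y) = \<phi> x + \<phi> y"
  and state_sup: "lattice_state e \<phi> \<Longrightarrow> x \<in> I \<Longrightarrow> y \<in> I \<Longrightarrow> \<phi> (sup x y) = max (\<phi> x) (\<phi> y)"
  and state_scale: "lattice_state e \<phi> \<Longrightarrow> x \<in> I \<Longrightarrow> \<phi> (c *\<^sub>R x) = c * \<phi> x"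
  and state_unit: "lattice_state e \<phi> \<Longrightarrow> \<phi> e = 1"
  unfolding lattice_state_def by blast+

lemma state_zero: "lattice_state e \<phi> \<Longrightarrow> \<phi> 0 = 0"
  using state_scale[OF _ I_zero, of \<phi> 0] by simp

lemma state_uminus: "lattice_state e \<phi> \<Longrightarrow> x \<in> I \<Longrightarrow> \<phi> (- x) = - \<phi> x"
  using state_scale[of \<phi> x "-1"] by simp

lemma state_diff: "lattice_state e \<phi> \<Longrightarrow> x \<in> I \<Longrightarrow> y \<in> I \<Longrightarrow> \<phi> (x - y) = \<phi> x - \<phi> y"
  using state_add[OF _ _ I_uminus, of \<phi> x y] by (simp add: state_uminus)

lemma state_sum:
  assumes "lattice_state e \<phi>"
  shows "(\<And>i. i \<in> A \<Longrightarrow> f i \<in> I) \<Longrightarrow> \<phi> (sum f A) = (\<Sum>i\<in>A. \<phi> (f i))"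
  by (induction A rule: infinite_finite_induct)
    (auto simp: state_zero[OF assms] state_add[OF assms] I_sum)

lemma state_mono:
  assumes "lattice_state e \<phi>" "x \<in> I" "y \<in> I" "x \<le> y"
  shows "\<phi> x \<le> \<phi> y"
  using state_sup[OF assms(1-3)] assms(4) by (simp add: sup_absorb2)

lemma state_bound:
  assumes "x \<in> I"
  obtains C where "0 < C" "\<And>\<phi>. lattice_state e \<phi> \<Longrightarrow> \<bar>\<phi> x\<bar> \<le> C"
proof -
  obtain C where C: "0 < C" "x \<le> C *\<^sub>R e" "- x \<le> C *\<^sub>R e" using order_ideal_bound[OF assms e] .
  have "\<bar>\<phi> x\<bar> \<le> C" if \<phi>: "lattice_state e \<phi>" for \<phi>
  proof -
    have Ce: "C *\<^sub>R e \<in> I" by (intro I_scale order_ideal_self e)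
    have "\<phi> x \<le> \<phi> (C *\<^sub>R e)" "\<phi> (- x) \<le> \<phi> (C *\<^sub>R e)"
      using C Ce assms I_uminus state_mono[OF \<phi>] by blast+
    then show ?thesis
      by (simp add: state_scale[OF \<phi> order_ideal_self[OF e]] state_unit[OF \<phi>] state_uminus[OF \<phi> assms])
  qed
  then show ?thesis using that C(1) by blast
qed

text \<open>
  The states separate points, so identities and inequalities in the ideal reduce to the real numbers.
\<close>

lemma le_by_states:
  assumes "x \<in> I" "y \<in> I" "\<And>\<phi>. lattice_state e \<phi> \<Longrightarrow> \<phi> x \<le> \<phi> y"
  shows "x \<le> y"
proof -
  have "x - y \<le> 0"
  proof (rule archimedean, rule ccontr)
    fix \<epsilon> :: real assume \<epsilon>: "0 < \<epsilon>" "\<not> x - y \<le> \<epsilon> *\<^sub>R e"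
    obtain \<phi> where \<phi>: "lattice_state e \<phi>" "\<epsilon> \<le> \<phi> (x - y)"
      using lattice_state_exists[OF e I_diff[OF assms(1,2)] \<epsilon>] by blast
    then show False using assms(3)[OF \<phi>(1)] \<epsilon> by (simp add: state_diff assms)
  qed
  then show ?thesis by simp
qed

lemma eq_by_states:
  assumes "x \<in> I" "y \<in> I" "\<And>\<phi>. lattice_state e \<phi> \<Longrightarrow> \<phi> x = \<phi> y"
  shows "x = y"
proof (intro order.antisym le_by_states assms(1,2))
  fix \<phi> assume "lattice_state e \<phi>"
  then show "\<phi> x \<le> \<phi> y" "\<phi> y \<le> \<phi> x" using assms(3)[of \<phi>] by simp_all
qed

text \<open>
  Elements that are uniformly close on all states are close in the order unit norm of \<open>e\<close>, hence in the
  quasinorm. Completeness gives a limit, and since order intervals are closed, it is also the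
  limit in the order unit norm.
\<close>

lemma uniform_limit_represented:
  assumes h: "\<And>j. h j \<in> I" and \<epsilon>: "\<And>j. 0 \<le> \<epsilon> j" "\<epsilon> \<longlonglongrightarrow> 0"
    and lim: "\<And>\<phi> j. lattice_state e \<phi> \<Longrightarrow> \<bar>\<phi> (h j) - \<Phi> \<phi>\<bar> \<le> \<epsilon> j"
  shows "\<exists>w\<in>I. \<forall>\<phi>. lattice_state e \<phi> \<longrightarrow> \<phi> w = \<Phi> \<phi>"
proof -
  have eI: "t *\<^sub>R e \<in> I" for t by (intro I_scale order_ideal_self e)
  have near: "h i - h j \<le> (\<epsilon> i + \<epsilon> j) *\<^sub>R e" for i j
  proof (rule le_by_states)
    fix \<phi> assume \<phi>: "lattice_state e \<phi>"
    show "\<phi> (h i - h j) \<le> \<phi> ((\<epsilon> i + \<epsilon> j) *\<^sub>R e)"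
      using lim[OF \<phi>, of i] lim[OF \<phi>, of j]
      by (simp add: state_diff[OF \<phi>] h state_scale[OF \<phi> order_ideal_self[OF e]] state_unit[OF \<phi>])
  qed (intro I_diff h eI)+
  have NYnear: "NY (h i - h j) \<le> (\<epsilon> i + \<epsilon> j) * NY e" for i j
  proof -
    have "0 \<le> (\<epsilon> i + \<epsilon> j) *\<^sub>R e" using \<epsilon> e by (intro scaleR_nonneg_nonneg) auto
    moreover have "lattice_abs (h i - h j) \<le> (\<epsilon> i + \<epsilon> j) *\<^sub>R e"
      using near[of i j] near[of j i] by (simp add: lattice_abs_def add.commute)
    ultimately have "NY (h i - h j) \<le> NY ((\<epsilon> i + \<epsilon> j) *\<^sub>R e)"
      by (intro NY_mono) (simp add: lattice_abs_of_nonneg)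
    then show ?thesis using \<epsilon> by (simp add: NY_scale)
  qed
  have "quasinorm_Cauchy NY h"
    unfolding quasinorm_Cauchy_def
  proof (intro allI impI)
    fix d :: real assume d: "0 < d"
    define c where "c = d / (2 * (NY e + 1))"
    have p: "0 < NY e + 1" using NY_nonneg[of e] by simp
    then have c: "0 < c" using d by (simp add: c_def)
    then obtain K where K: "\<And>i. K \<le> i \<Longrightarrow> \<epsilon> i < c"
      using order_tendstoD(2)[OF \<epsilon>(2) c] by (auto simp: eventually_sequentially)
    have "NY (h i - h j) < d" if "K \<le> i" "K \<le> j" for i j
    proof -
      have "NY (h i - h j) \<le> (\<epsilon> i + \<epsilon> j) * (NY e + 1)"
        using NYnear[of i j] \<epsilon>(1)[of i] \<epsilon>(1)[of j] by (simp add: distrib_left)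
      also have "\<dots> < (c + c) * (NY e + 1)"
        using K[OF that(1)] K[OF that(2)] p by (intro mult_strict_right_mono) auto
      also have "\<dots> = c * (2 * (NY e + 1))" by (simp add: algebra_simps)
      also have "\<dots> = d" using p by (simp add: c_def)
      finally show ?thesis .
    qed
    then show "\<exists>K. \<forall>i\<ge>K. \<forall>j\<ge>K. NY (h i - h j) < d" by blast
  qed
  then obtain l where l: "(\<lambda>i. NY (h i - l)) \<longlonglongrightarrow> 0"
    using NY_complete unfolding quasinorm_tendsto_def by blast
  have zero: "z \<le> 0" if z: "\<And>i. i \<ge> i0 \<Longrightarrow> z \<le> lattice_abs (h i - l)" for z i0
  proof -
    have "NY (pos z) \<le> NY (h i - l)" if "i \<ge> i0" for i
    proof (rule NY_mono)
      have "pos z \<le> lattice_abs (h i - l)" using z[OF that] lattice_abs_nonneg by simp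
      then show "lattice_abs (pos z) \<le> lattice_abs (h i - l)" by (simp add: lattice_abs_of_nonneg)
    qed
    then have "NY (pos z) \<le> 0" by (intro LIMSEQ_le_const[OF l]) blast
    then have "pos z = 0" using NY_nonneg[of "pos z"] NY_zero by simp
    then show ?thesis by (metis sup.cobounded1)
  qed
  have up: "l - h j \<le> (\<epsilon> j + c) *\<^sub>R e \<and> h j - l \<le> (\<epsilon> j + c) *\<^sub>R e" if c: "0 < c" for j c
  proof -
    obtain i0 where i0: "\<And>i. i0 \<le> i \<Longrightarrow> \<epsilon> i < c"
      using order_tendstoD(2)[OF \<epsilon>(2) c] by (auto simp: eventually_sequentially)
    have b: "h i - h j \<le> (\<epsilon> j + c) *\<^sub>R e" "h j - h i \<le> (\<epsilon> j + c) *\<^sub>R e" if "i0 \<le> i" for i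
    proof -
      have "(\<epsilon> i + \<epsilon> j) *\<^sub>R e \<le> (\<epsilon> j + c) *\<^sub>R e" using i0[OF that] e by (intro scaleR_right_mono) auto
      then show "h i - h j \<le> (\<epsilon> j + c) *\<^sub>R e" "h j - h i \<le> (\<epsilon> j + c) *\<^sub>R e"
        using near[of i j] near[of j i] by (auto simp: add.commute intro: order_trans)
    qed
    have "l - h j - (\<epsilon> j + c) *\<^sub>R e \<le> 0"
    proof (rule zero)
      fix i assume "i0 \<le> i"
      have "l - h j - (\<epsilon> j + c) *\<^sub>R e \<le> l - h j - (h i - h j)"
        by (intro diff_left_mono b \<open>i0 \<le> i\<close>)
      also have "\<dots> \<le> lattice_abs (h i - l)" by (simp add: lattice_abs_def)
      finally show "l - h j - (\<epsilon> j + c) *\<^sub>R e \<le> lattice_abs (h i - l)" .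
    qed
    moreover have "h j - l - (\<epsilon> j + c) *\<^sub>R e \<le> 0"
    proof (rule zero)
      fix i assume "i0 \<le> i"
      have "h j - l - (\<epsilon> j + c) *\<^sub>R e \<le> h j - l - (h j - h i)"
        by (intro diff_left_mono b \<open>i0 \<le> i\<close>)
      also have "\<dots> \<le> lattice_abs (h i - l)" by (simp add: lattice_abs_def)
      finally show "h j - l - (\<epsilon> j + c) *\<^sub>R e \<le> lattice_abs (h i - l)" .
    qed
    ultimately show ?thesis by simp
  qed
  have "l - h 0 \<in> I"
    using up[of 1 0] by (auto simp: order_ideal_def)
  then have lI: "l \<in> I" using I_add[OF _ h[of 0]] by fastforce
  have "\<phi> l = \<Phi> \<phi>" if \<phi>: "lattice_state e \<phi>" for \<phi>
  proof -
    have "\<bar>\<phi> l - \<Phi> \<phi>\<bar> \<le> 0 + c" if c: "0 < c" for c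
    proof -
      have c4: "0 < c / 4" using c by simp
      obtain j where j: "\<epsilon> j < c / 4"
        using order_tendstoD(2)[OF \<epsilon>(2) c4] by (auto simp: eventually_sequentially)
      have "\<phi> (l - h j) \<le> \<phi> ((\<epsilon> j + c / 4) *\<^sub>R e)" "\<phi> (h j - l) \<le> \<phi> ((\<epsilon> j + c / 4) *\<^sub>R e)"
        using up[OF c4, of j] by (intro state_mono[OF \<phi>] I_diff lI h eI; simp)+
      then have "\<bar>\<phi> l - \<phi> (h j)\<bar> \<le> \<epsilon> j + c / 4"
        by (simp add: state_diff[OF \<phi>] lI h state_scale[OF \<phi> order_ideal_self[OF e]] state_unit[OF \<phi>])
      then show ?thesis using lim[OF \<phi>, of j] j c by linarith
    qed
    then have "\<bar>\<phi> l - \<Phi> \<phi>\<bar> \<le> 0" by (rule field_le_epsilon)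
    then show ?thesis by simp
  qed
  then show ?thesis using lI by blast
qed

definition state_vector :: "nat \<Rightarrow> (nat \<Rightarrow> 'y) \<Rightarrow> ('y \<Rightarrow> real) \<Rightarrow> nat \<Rightarrow> real" where
  "state_vector n y \<phi> k = (if k < n then \<phi> (y k) else 0)"

lemma state_vector_supported: "state_vector n y \<phi> \<in> supported_vectors n"
  by (simp add: state_vector_def supported_vectors_def)

text \<open>
  The functions with a representing element form a vector lattice that contains the coordinates and is
  closed under uniform limits, so \<open>homogeneous_approx\<close> applies.
\<close>

lemma homogeneous_represented:
  assumes f: "f \<in> homogeneous_functions n" and y: "\<And>k. k < n \<Longrightarrow> y k \<in> I"
  shows "\<exists>w\<in>I. \<forall>\<phi>. lattice_state e \<phi> \<longrightarrow> \<phi> w = f (state_vector n y \<phi>)"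
proof (cases "n = 0")
  case True
  have "f v = 0" for v
    using homogeneous_functionsD(3)[OF f, of v "\<lambda>_. 0"] homogeneous_zero[OF f] True by simp
  then show ?thesis using I_zero state_zero by auto
next
  case False
  define \<R> where "\<R> = {g. \<exists>w\<in>I. \<forall>\<phi>. lattice_state e \<phi> \<longrightarrow> \<phi> w = g (state_vector n y \<phi>)}"
  have R: "\<exists>w\<in>I. \<forall>\<phi>. lattice_state e \<phi> \<longrightarrow> \<phi> w = g (state_vector n y \<phi>)" if "g \<in> \<R>" for g
    using that by (simp add: \<R>_def)
  have approx: "\<exists>g\<in>\<R>. \<forall>v\<in>supported_vectors n. \<bar>f v - g v\<bar> \<le> \<eta> * l1 n v" if "0 < \<eta>" for \<eta>
  proof (rule homogeneous_approx[OF f that])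
    show "0 < n" using False by simp
    show "(\<lambda>v. g v + h v) \<in> \<R>" if gh: "g \<in> \<R>" "h \<in> \<R>" for g h
    proof -
      obtain a b where "a \<in> I" "b \<in> I" "\<forall>\<phi>. lattice_state e \<phi> \<longrightarrow> \<phi> a = g (state_vector n y \<phi>)"
        "\<forall>\<phi>. lattice_state e \<phi> \<longrightarrow> \<phi> b = h (state_vector n y \<phi>)" using R[OF gh(1)] R[OF gh(2)] by blast
      then show ?thesis unfolding \<R>_def by (auto intro!: bexI[of _ "a + b"] I_add simp: state_add)
    qed
    show "(\<lambda>v. max (g v) (h v)) \<in> \<R>" if gh: "g \<in> \<R>" "h \<in> \<R>" for g h
    proof -
      obtain a b where "a \<in> I" "b \<in> I" "\<forall>\<phi>. lattice_state e \<phi> \<longrightarrow> \<phi> a = g (state_vector n y \<phi>)"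
        "\<forall>\<phi>. lattice_state e \<phi> \<longrightarrow> \<phi> b = h (state_vector n y \<phi>)" using R[OF gh(1)] R[OF gh(2)] by blast
      then show ?thesis unfolding \<R>_def by (auto intro!: bexI[of _ "sup a b"] I_sup simp: state_sup)
    qed
    show "(\<lambda>v. c * g v) \<in> \<R>" if g: "g \<in> \<R>" for g c
    proof -
      obtain a where "a \<in> I" "\<forall>\<phi>. lattice_state e \<phi> \<longrightarrow> \<phi> a = g (state_vector n y \<phi>)" using R[OF g] by blast
      then show ?thesis unfolding \<R>_def by (auto intro!: bexI[of _ "c *\<^sub>R a"] I_scale simp: state_scale)
    qed
    show "(\<lambda>v. v k) \<in> \<R>" if "k < n" for k
      unfolding \<R>_def using that y by (auto simp: state_vector_def intro!: bexI[of _ "y k"])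
  qed
  have "\<exists>g\<in>\<R>. \<forall>v\<in>supported_vectors n. \<bar>f v - g v\<bar> \<le> inverse (real (Suc j)) * l1 n v" for j
    by (rule approx) simp
  then obtain g where g: "\<And>j. g j \<in> \<R>"
      "\<And>j v. v \<in> supported_vectors n \<Longrightarrow> \<bar>f v - g j v\<bar> \<le> inverse (real (Suc j)) * l1 n v" by metis
  obtain h where h: "\<And>j. h j \<in> I" "\<And>j \<phi>. lattice_state e \<phi> \<Longrightarrow> \<phi> (h j) = g j (state_vector n y \<phi>)"
    using R[OF g(1)] by metis
  have "\<forall>k. \<exists>C>0. k < n \<longrightarrow> (\<forall>\<phi>. lattice_state e \<phi> \<longrightarrow> \<bar>\<phi> (y k)\<bar> \<le> C)"
    using state_bound[OF y] by (metis zero_less_one)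
  then obtain C where C: "\<And>k. 0 < C k" "\<And>k \<phi>. k < n \<Longrightarrow> lattice_state e \<phi> \<Longrightarrow> \<bar>\<phi> (y k)\<bar> \<le> C k" by metis
  show ?thesis
  proof (rule uniform_limit_represented[OF h(1)])
    show "0 \<le> inverse (real (Suc j)) * sum C {..<n}" for j using C(1) by (intro mult_nonneg_nonneg sum_nonneg) (auto intro: less_imp_le)
    show "(\<lambda>j. inverse (real (Suc j)) * sum C {..<n}) \<longlonglongrightarrow> 0"
      by (rule tendsto_mult_left_zero) (rule LIMSEQ_inverse_real_of_nat)
    fix \<phi> j assume \<phi>: "lattice_state e \<phi>"
    have "l1 n (state_vector n y \<phi>) \<le> sum C {..<n}"
      unfolding l1_def using C(2)[OF _ \<phi>] by (intro sum_mono) (auto simp: state_vector_def)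
    then have "inverse (real (Suc j)) * l1 n (state_vector n y \<phi>) \<le> inverse (real (Suc j)) * sum C {..<n}"
      by (intro mult_left_mono) auto
    with g(2)[OF state_vector_supported, of y \<phi> j]
    have "\<bar>f (state_vector n y \<phi>) - g j (state_vector n y \<phi>)\<bar> \<le> inverse (real (Suc j)) * sum C {..<n}"
      by (rule order_trans)
    then show "\<bar>\<phi> (h j) - f (state_vector n y \<phi>)\<bar> \<le> inverse (real (Suc j)) * sum C {..<n}"
      by (simp only: h(2)[OF \<phi>] abs_minus_commute)
  qed
qed

lemma krivine_calculus_value:
  assumes \<tau>: "krivine_calculus n y \<tau>" and f: "f \<in> homogeneous_functions n" and y: "\<And>k. k < n \<Longrightarrow> y k \<in> I"
  shows "\<tau> f \<in> I" "lattice_state e \<phi> \<Longrightarrow> \<phi> (\<tau> f) = f (state_vector n y \<phi>)"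
proof -
  let ?H = "homogeneous_functions n"
  have add: "\<tau> (\<lambda>v. f v + g v) = \<tau> f + \<tau> g" and sup: "\<tau> (\<lambda>v. max (f v) (g v)) = sup (\<tau> f) (\<tau> g)"
    if "f \<in> ?H" "g \<in> ?H" for f g
    using \<tau> that unfolding krivine_calculus_def by blast+
  have scale: "\<tau> (\<lambda>v. c * f v) = c *\<^sub>R \<tau> f" if "f \<in> ?H" for c f
    using \<tau> that unfolding krivine_calculus_def by blast
  have coord: "\<tau> (\<lambda>v. v k) = y k" if "k < n" for k
    using \<tau> that unfolding krivine_calculus_def by blast
  have zero: "\<tau> (\<lambda>v. 0) = 0" using scale[OF f, of 0] by simp
  have sum: "\<tau> (\<lambda>v. \<Sum>k<m. \<bar>v k\<bar>) \<in> I" if "m \<le> n" for m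
    using that
  proof (induction m)
    case (Suc m)
    have m: "(\<lambda>v. v m) \<in> ?H" "(\<lambda>v. (-1) * v m) \<in> ?H"
      using Suc.prems by (auto intro!: homogeneous_cmult[of _ _ "-1", simplified] homogeneous_coord)
    have "\<tau> (\<lambda>v. max (v m) ((-1) * v m)) = sup (y m) ((-1) *\<^sub>R y m)"
      using sup[OF m] scale[OF m(1), of "-1"] coord Suc.prems by simp
    moreover have "max (v m) ((-1) * v m) = \<bar>v m\<bar>" for v :: "nat \<Rightarrow> real" by simp
    ultimately have "\<tau> (\<lambda>v. \<bar>v m\<bar>) = sup (y m) (- y m)" by simp
    then have "\<tau> (\<lambda>v. \<bar>v m\<bar>) \<in> I" using y Suc.prems by (simp add: I_sup I_uminus)
    moreover have "(\<lambda>v. \<Sum>k<m. \<bar>v k\<bar>) \<in> ?H" "(\<lambda>v. \<bar>v m\<bar>) \<in> ?H"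
      using Suc.prems by (auto intro!: homogeneous_sum homogeneous_abs homogeneous_coord)
    ultimately show ?case using add Suc by (simp add: I_add)
  qed (simp add: zero I_zero)
  have L1: "\<tau> (l1 n) \<in> I" using sum[of n] by (simp add: l1_def[abs_def])
  have mono: "\<tau> f \<le> \<tau> g" if "f \<in> ?H" "g \<in> ?H" "\<And>v. f v \<le> g v" for f g
  proof -
    have "(\<lambda>v. max (f v) (g v)) = g" using that(3) by (auto simp: max_def)
    then show ?thesis using sup[OF that(1,2)] by (metis sup.cobounded1)
  qed
  have fI: "\<tau> f \<in> I" if f: "f \<in> ?H" for f
  proof -
    obtain B where B: "0 \<le> B" "\<And>v. v \<in> supported_vectors n \<Longrightarrow> \<bar>f v\<bar> \<le> B * l1 n v"
      using homogeneous_bounded[OF f] by blast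
    have "\<bar>f v\<bar> \<le> B * l1 n v" for v
    proof -
      have "f v = f (\<lambda>k. if k < n then v k else 0)" by (rule homogeneous_functionsD(3)[OF f]) simp
      moreover have "l1 n v = l1 n (\<lambda>k. if k < n then v k else 0)" by (simp add: l1_def)
      ultimately show ?thesis using B(2)[of "\<lambda>k. if k < n then v k else 0"] by (simp add: supported_vectors_def)
    qed
    then have "f v \<le> B * l1 n v" "(- B) * l1 n v \<le> f v" for v by (auto simp: abs_le_iff minus_le_iff)
    then have "\<tau> (\<lambda>v. (- B) * l1 n v) \<le> \<tau> f" "\<tau> f \<le> \<tau> (\<lambda>v. B * l1 n v)"
      using mono[OF f homogeneous_cmult[OF homogeneous_l1]] mono[OF homogeneous_cmult[OF homogeneous_l1] f]
      by blast+
    then show ?thesis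
      unfolding scale[OF homogeneous_l1] by (rule I_between[OF I_scale[OF L1] I_scale[OF L1]])
  qed
  show "\<tau> f \<in> I" using fI[OF f] .
  show "\<phi> (\<tau> f) = f (state_vector n y \<phi>)" if \<phi>: "lattice_state e \<phi>"
  proof (rule homogeneous_hom_is_evaluation[where \<Lambda> = "\<lambda>f. \<phi> (\<tau> f)"])
    show "\<phi> (\<tau> (\<lambda>v. f v + g v)) = \<phi> (\<tau> f) + \<phi> (\<tau> g)" if "f \<in> ?H" "g \<in> ?H" for f g
      using that by (simp add: add state_add[OF \<phi>] fI)
    show "\<phi> (\<tau> (\<lambda>v. max (f v) (g v))) = max (\<phi> (\<tau> f)) (\<phi> (\<tau> g))" if "f \<in> ?H" "g \<in> ?H" for f g
      using that by (simp add: sup state_sup[OF \<phi>] fI)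
    show "\<phi> (\<tau> (\<lambda>v. c * f v)) = c * \<phi> (\<tau> f)" if "f \<in> ?H" for f c
      using that by (simp add: scale state_scale[OF \<phi>] fI)
    show "state_vector n y \<phi> k = \<phi> (\<tau> (\<lambda>v. v k))" if "k < n" for k
      using that by (simp add: coord state_vector_def)
  qed (intro state_vector_supported f)+
qed

lemma krivine_calculus_exists:
  assumes y: "\<And>k. k < n \<Longrightarrow> y k \<in> I"
  shows "\<exists>\<tau>. krivine_calculus n y \<tau>"
proof -
  let ?H = "homogeneous_functions n"
  have "\<exists>w. w \<in> I \<and> (\<forall>\<phi>. lattice_state e \<phi> \<longrightarrow> \<phi> w = f (state_vector n y \<phi>))" if "f \<in> ?H" for f
    using homogeneous_represented[of f n y] that y by blast
  then obtain \<tau> where tI: "\<And>f. f \<in> ?H \<Longrightarrow> \<tau> f \<in> I"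
    and tv: "\<And>f \<phi>. f \<in> ?H \<Longrightarrow> lattice_state e \<phi> \<Longrightarrow> \<phi> (\<tau> f) = f (state_vector n y \<phi>)"
    by metis
  have "krivine_calculus n y \<tau>"
    unfolding krivine_calculus_def
  proof (intro conjI ballI allI impI)
    fix f g assume f: "f \<in> ?H" and g: "g \<in> ?H"
    show "\<tau> (\<lambda>v. f v + g v) = \<tau> f + \<tau> g"
      by (rule eq_by_states[OF tI[OF homogeneous_add[OF f g]] I_add[OF tI[OF f] tI[OF g]]])
        (simp add: tv[OF homogeneous_add[OF f g]] tv[OF f] tv[OF g] state_add[OF _ tI[OF f] tI[OF g]])
    show "\<tau> (\<lambda>v. max (f v) (g v)) = sup (\<tau> f) (\<tau> g)"
      by (rule eq_by_states[OF tI[OF homogeneous_max[OF f g]] I_sup[OF tI[OF f] tI[OF g]]])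
        (simp add: tv[OF homogeneous_max[OF f g]] tv[OF f] tv[OF g] state_sup[OF _ tI[OF f] tI[OF g]])
  next
    fix f c assume f: "f \<in> ?H"
    show "\<tau> (\<lambda>v. c * f v) = c *\<^sub>R \<tau> f"
      by (rule eq_by_states[OF tI[OF homogeneous_cmult[OF f]] I_scale[OF tI[OF f]]])
        (simp add: tv[OF homogeneous_cmult[OF f]] tv[OF f] state_scale[OF _ tI[OF f]])
  next
    fix k assume k: "k < n"
    show "\<tau> (\<lambda>v. v k) = y k"
      by (rule eq_by_states[OF tI[OF homogeneous_coord[OF k]] y[OF k]])
        (simp add: tv[OF homogeneous_coord[OF k]] k state_vector_def)
  qed
  then show ?thesis by blast
qed

lemma homogeneous_lq: 
  assumes "0 < q"
  shows "(\<lambda>v. (\<Sum>k<n. \<bar>v k\<bar> powr q) powr (1 / q)) \<in> homogeneous_functions n"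
proof (rule homogeneous_functionsI)
  show "continuous_on UNIV (\<lambda>v::nat \<Rightarrow> real. (\<Sum>k<n. \<bar>v k\<bar> powr q) powr (1 / q))"
    using assms by (intro continuous_on_powr' continuous_intros continuous_on_coordinate) (auto intro!: sum_nonneg)
  show "(\<Sum>k<n. \<bar>v k\<bar> powr q) powr (1 / q) = (\<Sum>k<n. \<bar>w k\<bar> powr q) powr (1 / q)"
    if "\<And>k. k < n \<Longrightarrow> v k = w k" for v w :: "nat \<Rightarrow> real"
    using that by (intro arg_cong2[of _ _ _ _ "(powr)"] sum.cong) auto
  show "(\<Sum>k<n. \<bar>c * v k\<bar> powr q) powr (1 / q) = c * (\<Sum>k<n. \<bar>v k\<bar> powr q) powr (1 / q)"
    if "0 \<le> c" for c :: real and v :: "nat \<Rightarrow> real"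
  proof -
    have "(\<Sum>k<n. \<bar>c * v k\<bar> powr q) = c powr q * (\<Sum>k<n. \<bar>v k\<bar> powr q)"
      using that by (simp add: abs_mult powr_mult sum_distrib_left)
    then show ?thesis using that assms by (simp add: powr_mult sum_nonneg powr_powr)
  qed
qed

text \<open>
  Existence and uniqueness of the calculus make the definite description in \<open>lattice_lq_sum\<close> denote the
  intended element, which the states evaluate as the real expression.
\<close>

lemma lattice_lq_sum_value:
  assumes q: "0 < q" and y: "\<And>k. k < n \<Longrightarrow> y k \<in> I"
  shows "lattice_lq_sum q n y \<in> I"
    "lattice_state e \<phi> \<Longrightarrow> \<phi> (lattice_lq_sum q n y) = (\<Sum>k<n. \<bar>\<phi> (y k)\<bar> powr q) powr (1 / q)"
proof -
  let ?f = "\<lambda>v :: nat \<Rightarrow> real. (\<Sum>k<n. \<bar>v k\<bar> powr q) powr (1 / q)"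
  note f = homogeneous_lq[OF q, of n]
  obtain \<tau> where \<tau>: "krivine_calculus n y \<tau>" using krivine_calculus_exists[of n y] y by blast
  have "lattice_lq_sum q n y = \<tau> ?f"
    unfolding lattice_lq_sum_def
  proof (rule the_equality)
    show "\<exists>\<tau>'. krivine_calculus n y \<tau>' \<and> \<tau> ?f = \<tau>' ?f" using \<tau> by blast
    fix w assume "\<exists>\<tau>'. krivine_calculus n y \<tau>' \<and> w = \<tau>' ?f"
    then obtain \<tau>' where \<tau>': "krivine_calculus n y \<tau>'" "w = \<tau>' ?f" by blast
    show "w = \<tau> ?f" unfolding \<tau>'(2)
      by (rule eq_by_states)
        (simp_all add: krivine_calculus_value[OF \<tau> f y] krivine_calculus_value[OF \<tau>'(1) f y])
  qed
  then show "lattice_lq_sum q n y \<in> I"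
    "lattice_state e \<phi> \<Longrightarrow> \<phi> (lattice_lq_sum q n y) = (\<Sum>k<n. \<bar>\<phi> (y k)\<bar> powr q) powr (1 / q)"
    using krivine_calculus_value[OF \<tau> f y] by (simp_all add: state_vector_def)
qed

text \<open>
  The element represented by \<open>sqrt (a\<^sup>2 + b\<^sup>2)\<close> is the supremum in the definition of the modulus. An upper
  bound \<open>u\<close> may lie outside the ideal, but its infimum with that element does not, and at each state some
  angle \<open>t\<close> attains the modulus of the complex number that the state assigns to \<open>z\<close>.
\<close>

lemma modulus_value:
  assumes z: "fst z \<in> I" "snd z \<in> I"
  shows "modulus z \<in> I"
    "lattice_state e \<phi> \<Longrightarrow> \<phi> (modulus z) = cmod (Complex (\<phi> (fst z)) (\<phi> (snd z)))"
proof -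
  let ?f = "\<lambda>v :: nat \<Rightarrow> real. sqrt ((v 0)\<^sup>2 + (v 1)\<^sup>2)"
  let ?y = "\<lambda>k::nat. if k = 0 then fst z else snd z"
  have f: "?f \<in> homogeneous_functions 2"
  proof (rule homogeneous_functionsI)
    show "continuous_on UNIV ?f" by (intro continuous_intros continuous_on_coordinate)
    show "sqrt ((c * v 0)\<^sup>2 + (c * v 1)\<^sup>2) = c * sqrt ((v 0)\<^sup>2 + (v 1)\<^sup>2)" if "0 \<le> c" for c and v :: "nat \<Rightarrow> real"
      using that by (simp add: power_mult_distrib real_sqrt_mult flip: distrib_left)
  qed simp
  obtain w where w: "w \<in> I" "\<And>\<phi>. lattice_state e \<phi> \<Longrightarrow> \<phi> w = ?f (state_vector 2 ?y \<phi>)"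
  proof -
    have "?y k \<in> I" for k using z by simp
    then show ?thesis using homogeneous_represented[OF f, of ?y] that by blast
  qed
  have wv: "\<phi> w = sqrt ((\<phi> (fst z))\<^sup>2 + (\<phi> (snd z))\<^sup>2)" if "lattice_state e \<phi>" for \<phi>
    using w(2)[OF that] by (simp add: state_vector_def)
  let ?l = "\<lambda>t. cos t *\<^sub>R fst z + sin t *\<^sub>R snd z"
  have lI: "?l t \<in> I" for t by (intro I_add I_scale z)
  have lv: "\<phi> (?l t) = cos t * \<phi> (fst z) + sin t * \<phi> (snd z)" if "lattice_state e \<phi>" for \<phi> t
    using that z by (simp add: state_add state_scale I_scale)
  have "modulus z = w"
    unfolding modulus_def
  proof (rule Least_equality)
    show "\<forall>t. ?l t \<le> w"
    proof (intro allI le_by_states lI w)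
      fix t \<phi> assume \<phi>: "lattice_state e \<phi>"
      define a b where "a = \<phi> (fst z)" "b = \<phi> (snd z)"
      have "(cos t * a + sin t * b)\<^sup>2 + (sin t * a - cos t * b)\<^sup>2 = ((cos t)\<^sup>2 + (sin t)\<^sup>2) * (a\<^sup>2 + b\<^sup>2)"
        by (simp only: power2_eq_square) (simp only: algebra_simps)
      also have "\<dots> = a\<^sup>2 + b\<^sup>2" by simp
      finally have "(cos t * a + sin t * b)\<^sup>2 \<le> a\<^sup>2 + b\<^sup>2" by (smt (verit) zero_le_power2)
      then have "cos t * a + sin t * b \<le> sqrt (a\<^sup>2 + b\<^sup>2)" by (rule real_le_rsqrt)
      then show "\<phi> (?l t) \<le> \<phi> w" by (simp add: lv[OF \<phi>] wv[OF \<phi>] a_b_def)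
    qed
    fix u assume u: "\<forall>t. ?l t \<le> u"
    have wl: "?l t \<le> w" for t using \<open>\<forall>t. ?l t \<le> w\<close> by blast
    have le: "?l t \<le> inf u w" for t using u wl by (intro inf_greatest) blast+
    have uI: "inf u w \<in> I" by (rule I_between[OF lI[of 0] w(1) le]) simp
    have "w \<le> inf u w"
    proof (rule le_by_states[OF w(1) uI])
      fix \<phi> assume \<phi>: "lattice_state e \<phi>"
      define c where "c = Complex (\<phi> (fst z)) (\<phi> (snd z))"
      have c: "\<phi> (fst z) = cmod c * cos (Arg c)" "\<phi> (snd z) = cmod c * sin (Arg c)"
        using rcis_cmod_Arg[of c] by (auto simp: c_def rcis_def complex_eq_iff cis.sel)
      have "\<phi> w = cmod c" by (simp add: wv[OF \<phi>] c_def complex_norm)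
      also have "\<dots> = cmod c * ((cos (Arg c))\<^sup>2 + (sin (Arg c))\<^sup>2)" by simp
      also have "\<dots> = \<phi> (?l (Arg c))"
        unfolding lv[OF \<phi>] c by (simp only: power2_eq_square distrib_left mult_ac)
      also have "\<dots> \<le> \<phi> (inf u w)" by (rule state_mono[OF \<phi> lI uI le])
      finally show "\<phi> w \<le> \<phi> (inf u w)" .
    qed
    then show "w \<le> u" by simp
  qed
  then show "modulus z \<in> I" "lattice_state e \<phi> \<Longrightarrow> \<phi> (modulus z) = cmod (Complex (\<phi> (fst z)) (\<phi> (snd z)))"
    using w(1) wv by (simp_all add: complex_norm)
qed

end

text \<open>
  Every state extends to a complex linear functional on the pairs from the ideal and turns the modulus
  into the modulus of complex numbers. The scalar inequality \<open>dom\<close>, read at all states of the ideal generated by the \<open>x k\<close>, is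
  therefore an inequality in the lattice, to which \<open>q\<close>-convexity can be applied.
\<close>

lemma q_convex_domination:
  fixes NY :: "'y::{ordered_real_vector,lattice} \<Rightarrow> real" and x :: "nat \<Rightarrow> 'y \<times> 'y"
    and w :: "nat \<Rightarrow> complex" and b :: "nat \<Rightarrow> nat \<Rightarrow> complex"
  assumes lat: "quasi_banach_lattice NY" and q: "0 < q"
    and conv: "\<And>n (z :: nat \<Rightarrow> 'y \<times> 'y). NY (lattice_lq_sum q n (\<lambda>k. modulus (z k)))
          \<le> C * (\<Sum>k<n. complexification_norm NY (z k) powr q) powr (1 / q)"
    and dom: "\<And>\<xi>. cmod (\<Sum>k<n. w k * \<xi> k) \<le> (\<Sum>d<L. cmod (\<Sum>k<n. b d k * \<xi> k) powr q) powr (1 / q)"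
  shows "complexification_norm NY (\<Sum>k<n. complexification_scale (w k) (x k))
     \<le> C * (\<Sum>d<L. complexification_norm NY (\<Sum>k<n. complexification_scale (b d k) (x k)) powr q) powr (1 / q)"
proof -
  define e where "e = (\<Sum>k<n. lattice_abs (fst (x k)) + lattice_abs (snd (x k)))"
  have e0: "0 \<le> e" unfolding e_def by (intro sum_nonneg add_nonneg_nonneg lattice_abs_nonneg)
  interpret principal_ideal NY e by unfold_locales (fact lat e0)+
  have le_e: "lattice_abs (fst (x k)) \<le> e" "lattice_abs (snd (x k)) \<le> e" if "k < n" for k
  proof -
    have "lattice_abs (fst (x k)) + lattice_abs (snd (x k)) \<le> e"
      unfolding e_def using that
        sum_mono2[of "{..<n}" "{k}" "\<lambda>k. lattice_abs (fst (x k)) + lattice_abs (snd (x k))"]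
      by (simp add: add_nonneg_nonneg lattice_abs_nonneg)
    then show "lattice_abs (fst (x k)) \<le> e" "lattice_abs (snd (x k)) \<le> e"
      using lattice_abs_nonneg[of "fst (x k)"] lattice_abs_nonneg[of "snd (x k)"]
      by (metis add_increasing add_increasing2 order_refl order_trans)+
  qed
  have xI: "fst (x k) \<in> I" "snd (x k) \<in> I" if "k < n" for k
    using le_e[OF that] by (auto simp: order_ideal_def lattice_abs_def intro!: exI[of _ 1])
  define \<Sigma> where "\<Sigma> a = (\<Sum>k<n. complexification_scale (a k) (x k))" for a
  have SI: "fst (\<Sigma> a) \<in> I" "snd (\<Sigma> a) \<in> I" for a
    unfolding \<Sigma>_def fst_sum snd_sum complexification_scale_def fst_conv snd_conv
    by (intro I_sum I_diff I_add I_scale xI; simp)+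
  define \<xi> where "\<xi> \<phi> k = Complex (\<phi> (fst (x k))) (\<phi> (snd (x k)))" for \<phi> k
  have Sv: "Complex (\<phi> (fst (\<Sigma> a))) (\<phi> (snd (\<Sigma> a))) = (\<Sum>k<n. a k * \<xi> \<phi> k)" if \<phi>: "lattice_state e \<phi>" for \<phi> a
  proof (rule complex_eqI)
    show "Re (Complex (\<phi> (fst (\<Sigma> a))) (\<phi> (snd (\<Sigma> a)))) = Re (\<Sum>k<n. a k * \<xi> \<phi> k)"
      unfolding \<Sigma>_def fst_sum complexification_scale_def fst_conv complex.sel
      by (subst state_sum[OF \<phi>])
        (auto simp: \<xi>_def xI I_diff I_scale state_diff[OF \<phi>] state_scale[OF \<phi>] intro!: sum.cong)
    show "Im (Complex (\<phi> (fst (\<Sigma> a))) (\<phi> (snd (\<Sigma> a)))) = Im (\<Sum>k<n. a k * \<xi> \<phi> k)"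
      unfolding \<Sigma>_def snd_sum complexification_scale_def snd_conv complex.sel
      by (subst state_sum[OF \<phi>])
        (auto simp: \<xi>_def xI I_add I_scale state_add[OF \<phi>] state_scale[OF \<phi>] intro!: sum.cong)
  qed
  let ?y = "\<lambda>d. modulus (\<Sigma> (b d))"
  have "modulus (\<Sigma> w) \<le> lattice_lq_sum q L ?y"
  proof (rule le_by_states)
    show "modulus (\<Sigma> w) \<in> I" by (rule modulus_value(1)[OF SI])
    show "lattice_lq_sum q L ?y \<in> I" by (rule lattice_lq_sum_value(1)[OF q]) (rule modulus_value(1)[OF SI])
    fix \<phi> assume \<phi>: "lattice_state e \<phi>"
    have "\<phi> (lattice_lq_sum q L ?y) = (\<Sum>d<L. \<bar>\<phi> (?y d)\<bar> powr q) powr (1 / q)"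
      by (rule lattice_lq_sum_value(2)[OF q _ \<phi>]) (rule modulus_value(1)[OF SI])
    then show "\<phi> (modulus (\<Sigma> w)) \<le> \<phi> (lattice_lq_sum q L ?y)"
      using dom[of "\<xi> \<phi>"] by (simp add: modulus_value(2)[OF SI \<phi>] Sv[OF \<phi>])
  qed
  moreover have "0 \<le> modulus (\<Sigma> w)"
    by (rule le_by_states[OF I_zero modulus_value(1)[OF SI]])
      (simp add: state_zero modulus_value(2)[OF SI])
  ultimately have "NY (modulus (\<Sigma> w)) \<le> NY (lattice_lq_sum q L ?y)"
    by (intro NY_mono) (simp add: lattice_abs_of_nonneg)
  also have "\<dots> \<le> C * (\<Sum>d<L. complexification_norm NY (\<Sigma> (b d)) powr q) powr (1 / q)"
    by (rule conv)
  finally show ?thesis unfolding \<Sigma>_def complexification_norm_def .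
qed

section \<open>Domination in natural spaces\<close>

text \<open>
  The scalar inequality is transferred to the space at the expense of a constant. The lattice is convex for
  some exponent \<open>r\<close>, possibly larger than \<open>q\<close>, so the exponents have to be matched. For given vectors the weights \<open>m d\<close>
  are replaced by weights \<open>\<rho> d\<close> nearly proportional to \<open>m d * N (z d) powr q\<close>. With the \<open>d\<close>-th term divided by \<open>N (z d)\<close>, Jensen's
  inequality allows the power mean of order \<open>q\<close> to be replaced by that of order \<open>r\<close>, and the \<open>d\<close>-th summand on the right of
  the convexity inequality is at most a multiple of \<open>\<rho> d\<close>. The bound in terms of \<open>b\<close> is the same statement for the vectors
  \<open>s (b k) (x k)\<close>; with characters or signs for \<open>b\<close>, its right-hand side becomes an average over translates.
\<close>

lemma natural_domination:
  fixes s :: "complex \<Rightarrow> 'x::ab_group_add \<Rightarrow> 'x" and NY :: "'y::{ordered_real_vector,lattice} \<Rightarrow> real"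
  assumes qb: "quasi_banach s N" and nat: "natural_via NY s N"
  shows "\<exists>q0>0. \<forall>q M. 0 < q \<longrightarrow> q \<le> q0 \<longrightarrow> q \<le> 1 \<longrightarrow> 1 \<le> M \<longrightarrow> (\<exists>C\<ge>1. \<forall>n L v w x.
     norming_matrix n L v M q \<longrightarrow> (\<forall>k<n. cmod (w k) \<le> 1) \<longrightarrow>
     dominated_on_average L C (\<lambda>d b. N (\<Sum>k<n. s (v d k * b k) (x k)) powr q)
       (\<lambda>b. N (\<Sum>k<n. s (w k * b k) (x k)) powr q))"
proof -
  have lat: "quasi_banach_lattice NY" using nat by (simp add: natural_via_def)
  have N0: "0 \<le> N x" and Nscale: "N (s c x) = cmod c * N x" for c x
    using qb by (auto simp: quasi_banach_def)
  obtain r where r: "0 < r" "q_convex r NY" using nat by (auto simp: natural_via_def)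
  then obtain C1' where C1': "\<And>n (z :: nat \<Rightarrow> 'y \<times> 'y). NY (lattice_lq_sum r n (\<lambda>k. modulus (z k)))
          \<le> C1' * (\<Sum>k<n. complexification_norm NY (z k) powr r) powr (1 / r)"
    unfolding q_convex_def by blast
  define C1 where "C1 = \<bar>C1'\<bar> + 1"
  have C1: "NY (lattice_lq_sum r n (\<lambda>k. modulus (z k)))
          \<le> C1 * (\<Sum>k<n. complexification_norm NY (z k) powr r) powr (1 / r)" for n and z :: "nat \<Rightarrow> 'y \<times> 'y"
    by (rule order_trans[OF C1']) (auto intro!: mult_right_mono simp: C1_def)
  obtain T :: "'x \<Rightarrow> 'y \<times> 'y" and c Cu' where T: "Vector_Spaces.linear s complexification_scale T"
    and c: "0 < c" "\<And>x. c * N x \<le> complexification_norm NY (T x)"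
    and Cu': "\<And>x. complexification_norm NY (T x) \<le> Cu' * N x"
    using nat unfolding natural_via_def by blast
  define Cu where "Cu = \<bar>Cu'\<bar> + 1"
  have Cu: "complexification_norm NY (T x) \<le> Cu * N x" for x
    by (rule order_trans[OF Cu']) (auto intro!: mult_right_mono simp: Cu_def N0)
  interpret T: Vector_Spaces.linear s complexification_scale T by (rule T)
  define K where "K = C1 * Cu / c"
  have pos: "0 < C1" "0 < Cu" by (auto simp: C1_def Cu_def intro: add_nonneg_pos)
  then have K: "0 < K" using c(1) by (simp add: K_def)
  note pos = pos K
  have NC0: "0 \<le> complexification_norm NY z" for z
    using lat by (simp add: complexification_norm_def quasi_banach_lattice_def quasi_banach_def)
  show ?thesis
  proof (rule exI[of _ r], intro conjI r(1) allI impI)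
    fix q M :: real assume q: "0 < q" "q \<le> r" "q \<le> 1" and M: "1 \<le> M"
    from norming_matrix_domination[OF M q(1,3)]
    obtain C where C: "0 < C" and C_dom: "\<forall>n L v w. norming_matrix n L v M q \<longrightarrow> (\<forall>k<n. cmod (w k) \<le> 1) \<longrightarrow>
        dominated_on_average L C (\<lambda>d x. cmod (\<Sum>k<n. v d k * x k) powr q)
          (\<lambda>x. cmod (\<Sum>k<n. w k * x k) powr q)"
      by (elim exE conjE)
    show "\<exists>C\<ge>1. \<forall>n L v w x. norming_matrix n L v M q \<longrightarrow> (\<forall>k<n. cmod (w k) \<le> 1) \<longrightarrow>
       dominated_on_average L C (\<lambda>d b. N (\<Sum>k<n. s (v d k * b k) (x k)) powr q)
         (\<lambda>b. N (\<Sum>k<n. s (w k * b k) (x k)) powr q)"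
    proof (rule exI[of _ "max 1 (K powr q * C)"], intro conjI allI impI)
      fix n L v w and x0 :: "nat \<Rightarrow> 'x"
      assume v: "norming_matrix n L v M q" and w: "\<forall>k<n. cmod (w k) \<le> 1"
      obtain m where m: "\<And>d. d < L \<Longrightarrow> 0 \<le> m d" "(\<Sum>d<L. m d) = 1"
        "\<And>x. cmod (\<Sum>k<n. w k * x k) powr q \<le> C * (\<Sum>d<L. m d * cmod (\<Sum>k<n. v d k * x k) powr q)"
        using C_dom[THEN spec, THEN spec, THEN spec, THEN spec, THEN mp, THEN mp, OF v w]
        unfolding dominated_on_average_def by blast
      have main: "N (\<Sum>k<n. s (w k) (x k)) powr q \<le> K powr q * C * (\<Sum>d<L. m d * N (\<Sum>k<n. s (v d k) (x k)) powr q)" for x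
      proof (rule field_le_epsilon)
        fix \<epsilon> :: real assume \<epsilon>: "0 < \<epsilon>"
        define \<delta> where "\<delta> = (\<epsilon> / (K powr q * C)) powr (1 / q)"
        have \<delta>: "0 < \<delta>" "\<delta> powr q = \<epsilon> / (K powr q * C)"
          using \<epsilon> C pos q by (auto simp: \<delta>_def powr_powr)
        define z where "z d = (\<Sum>k<n. s (v d k) (x k))" for d
        \<comment> \<open>\<open>\<delta>\<close> allows division when \<open>N (z d) = 0\<close>\<close>
        define \<nu> where "\<nu> d = N (z d) + \<delta>" for d
        have \<nu>: "0 < \<nu> d" for d using N0[of "z d"] \<delta>(1) by (simp add: \<nu>_def)
        define S where "S = (\<Sum>d<L. m d * \<nu> d powr q)"
        have "\<exists>d<L. 0 < m d"
        proof (rule ccontr)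
          assume "\<not> ?thesis"
          then have "m d = 0" if "d < L" for d using m(1)[OF that] that by force
          then show False using m(2) by simp
        qed
        then obtain d0 where "d0 < L" "0 < m d0" by blast
        then have S: "0 < S" unfolding S_def
          using m(1) \<nu>[of d0] by (intro sum_pos2[of _ d0]) auto
        have S_le: "S \<le> (\<Sum>d<L. m d * N (z d) powr q) + \<delta> powr q"
        proof -
          have "S \<le> (\<Sum>d<L. m d * (N (z d) powr q + \<delta> powr q))"
            unfolding S_def \<nu>_def using m(1) N0 \<delta> q by (intro sum_mono mult_left_mono powr_add_le) auto
          also have "\<dots> = (\<Sum>d<L. m d * N (z d) powr q) + \<delta> powr q"
            by (simp add: distrib_left sum.distrib sum_distrib_right[symmetric] m(2))
          finally show ?thesis .
        qed
        define \<rho> where "\<rho> d = m d * \<nu> d powr q / S" for d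
        have lam: "\<And>d. d < L \<Longrightarrow> 0 \<le> \<rho> d" "(\<Sum>d<L. \<rho> d) = 1"
          using m(1) S by (auto simp: \<rho>_def sum_divide_distrib[symmetric] S_def[symmetric])
        define R where "R = (C * S) powr (1 / q)"
        have R: "0 < R" "R powr q = C * S" using C S q by (auto simp: R_def powr_powr)
        define a where "a d = R * \<rho> d powr (1 / r) / \<nu> d" for d
        have a: "0 \<le> a d" "a d * N (z d) \<le> R * \<rho> d powr (1 / r)" for d
        proof -
          show "0 \<le> a d" using R \<nu>[of d] by (simp add: a_def)
          then have "a d * N (z d) \<le> a d * \<nu> d" using \<delta> by (intro mult_left_mono) (auto simp: \<nu>_def)
          then show "a d * N (z d) \<le> R * \<rho> d powr (1 / r)" using \<nu>[of d] by (simp add: a_def)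
        qed
        have dom: "cmod (\<Sum>k<n. w k * \<xi> k) \<le> (\<Sum>d<L. cmod (\<Sum>k<n. (of_real (a d) * v d k) * \<xi> k) powr r) powr (1 / r)" for \<xi>
        proof -
          define F where "F d = cmod (\<Sum>k<n. v d k * \<xi> k)" for d
          have "cmod (\<Sum>k<n. w k * \<xi> k) powr q \<le> C * (\<Sum>d<L. m d * F d powr q)"
            unfolding F_def by (rule m(3))
          also have "(\<Sum>d<L. m d * F d powr q) = S * (\<Sum>d<L. \<rho> d * ((F d / \<nu> d) powr r) powr (q / r))"
            unfolding sum_distrib_left
          proof (intro sum.cong refl)
            fix d
            have "((F d / \<nu> d) powr r) powr (q / r) = F d powr q / \<nu> d powr q"
              using r \<nu>[of d] by (simp add: powr_powr powr_divide F_def)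
            then show "m d * F d powr q = S * (\<rho> d * ((F d / \<nu> d) powr r) powr (q / r))"
              using S \<nu>[of d] by (simp add: \<rho>_def)
          qed
          also have "(\<Sum>d<L. \<rho> d * ((F d / \<nu> d) powr r) powr (q / r)) \<le> (\<Sum>d<L. \<rho> d * (F d / \<nu> d) powr r) powr (q / r)"
            using lam q r by (intro powr_jensen) auto
          finally have 1: "cmod (\<Sum>k<n. w k * \<xi> k) powr q \<le> C * (S * (\<Sum>d<L. \<rho> d * (F d / \<nu> d) powr r) powr (q / r))"
            using C S by (simp add: mult_left_mono)
          define W where "W = (\<Sum>d<L. \<rho> d * (F d / \<nu> d) powr r)"
          have W: "0 \<le> W" unfolding W_def using lam by (intro sum_nonneg mult_nonneg_nonneg) auto
          have "cmod (\<Sum>k<n. w k * \<xi> k) = (cmod (\<Sum>k<n. w k * \<xi> k) powr q) powr (1 / q)"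
            using q by (simp add: powr_powr)
          also have "\<dots> \<le> ((C * S) * W powr (q / r)) powr (1 / q)"
            using 1 q by (intro powr_mono2) (auto simp: W_def mult.assoc)
          also have "\<dots> = R * W powr (1 / r)"
            using C S W q by (simp add: powr_mult powr_powr R_def)
          also have "\<dots> = (R powr r * W) powr (1 / r)"
            using R W r by (simp add: powr_mult powr_powr)
          also have "R powr r * W = (\<Sum>d<L. cmod (\<Sum>k<n. (of_real (a d) * v d k) * \<xi> k) powr r)"
            unfolding W_def sum_distrib_left
          proof (intro sum.cong refl)
            fix d assume "d \<in> {..<L}"
            have "(\<Sum>k<n. (of_real (a d) * v d k) * \<xi> k) = of_real (a d) * (\<Sum>k<n. v d k * \<xi> k)"
              by (simp add: sum_distrib_left mult.assoc)
            then have "cmod (\<Sum>k<n. (of_real (a d) * v d k) * \<xi> k) powr r = (a d * F d) powr r"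
              using a(1)[of d] by (simp add: norm_mult F_def)
            also have "a d * F d = (R * \<rho> d powr (1 / r)) * (F d / \<nu> d)" by (simp add: a_def)
            also have "\<dots> powr r = (R * \<rho> d powr (1 / r)) powr r * (F d / \<nu> d) powr r"
              by (rule powr_mult)
            also have "(R * \<rho> d powr (1 / r)) powr r = R powr r * \<rho> d"
              using R r lam(1)[of d] \<open>d \<in> _\<close> by (simp add: powr_mult powr_powr)
            finally show "R powr r * (\<rho> d * (F d / \<nu> d) powr r) = cmod (\<Sum>k<n. (of_real (a d) * v d k) * \<xi> k) powr r"
              by simp
          qed
          finally show ?thesis .
        qed
        have Tsum: "T (\<Sum>k<n. s (b k) (x k)) = (\<Sum>k<n. complexification_scale (b k) (T (x k)))" for b
          by (simp add: T.sum T.scale)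
        have "c * N (\<Sum>k<n. s (w k) (x k)) \<le> complexification_norm NY (\<Sum>k<n. complexification_scale (w k) (T (x k)))"
          using c(2) unfolding Tsum[symmetric] .
        also have "\<dots> \<le> C1 * (\<Sum>d<L. complexification_norm NY (\<Sum>k<n. complexification_scale (of_real (a d) * v d k) (T (x k))) powr r) powr (1 / r)"
          by (rule q_convex_domination[OF lat r(1) C1 dom])
        also have "\<dots> \<le> C1 * (\<Sum>d<L. (Cu * R) powr r * \<rho> d) powr (1 / r)"
        proof (intro mult_left_mono powr_mono2 sum_mono sum_nonneg)
          fix d assume d: "d \<in> {..<L}"
          have "(\<Sum>k<n. s (of_real (a d) * v d k) (x k)) = s (of_real (a d)) (z d)"
            by (simp add: z_def T.vs1.scale_sum_right)
          then have "complexification_norm NY (\<Sum>k<n. complexification_scale (of_real (a d) * v d k) (T (x k))) \<le> Cu * (a d * N (z d))"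
            using Cu[of "s (of_real (a d)) (z d)"] a(1)[of d] unfolding Tsum[symmetric] by (simp add: Nscale)
          also have "\<dots> \<le> Cu * (R * \<rho> d powr (1 / r))" using a(2)[of d] pos by (intro mult_left_mono) auto
          finally have "complexification_norm NY (\<Sum>k<n. complexification_scale (of_real (a d) * v d k) (T (x k))) powr r
             \<le> (Cu * (R * \<rho> d powr (1 / r))) powr r" using r NC0 by (intro powr_mono2) auto
          also have "\<dots> = (Cu * R) powr r * \<rho> d"
            using pos R r lam(1)[of d] d by (simp add: powr_mult powr_powr)
          finally show "complexification_norm NY (\<Sum>k<n. complexification_scale (of_real (a d) * v d k) (T (x k))) powr r
            \<le> (Cu * R) powr r * \<rho> d" .
        qed (use pos r in auto)
        also have "(\<Sum>d<L. (Cu * R) powr r * \<rho> d) = (Cu * R) powr r"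
          by (simp add: sum_distrib_left[symmetric] lam(2))
        also have "((Cu * R) powr r) powr (1 / r) = Cu * R" using pos R r by (simp add: powr_powr)
        finally have "N (\<Sum>k<n. s (w k) (x k)) \<le> K * R"
          using c(1) by (simp add: K_def field_simps)
        then have "N (\<Sum>k<n. s (w k) (x k)) powr q \<le> (K * R) powr q"
          using q N0 by (intro powr_mono2) auto
        also have "\<dots> = K powr q * C * S" using pos R by (simp add: powr_mult)
        also have "\<dots> \<le> K powr q * C * ((\<Sum>d<L. m d * N (z d) powr q) + \<delta> powr q)"
          using S_le pos C by (intro mult_left_mono) auto
        also have "\<dots> = K powr q * C * (\<Sum>d<L. m d * N (z d) powr q) + \<epsilon>"
          using pos C by (simp add: distrib_left \<delta>(2))
        finally show "N (\<Sum>k<n. s (w k) (x k)) powr q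
            \<le> K powr q * C * (\<Sum>d<L. m d * N (\<Sum>k<n. s (v d k) (x k)) powr q) + \<epsilon>"
          unfolding z_def .
      qed
      have "N (\<Sum>k<n. s (w k * b k) (x0 k)) powr q
          \<le> max 1 (K powr q * C) * (\<Sum>d<L. m d * N (\<Sum>k<n. s (v d k * b k) (x0 k)) powr q)" for b
      proof -
        have "N (\<Sum>k<n. s (w k * b k) (x0 k)) powr q
            \<le> K powr q * C * (\<Sum>d<L. m d * N (\<Sum>k<n. s (v d k * b k) (x0 k)) powr q)"
          using main[of "\<lambda>k. s (b k) (x0 k)"] by simp
        also have "\<dots> \<le> max 1 (K powr q * C) * (\<Sum>d<L. m d * N (\<Sum>k<n. s (v d k * b k) (x0 k)) powr q)"
          using m(1) by (intro mult_right_mono sum_nonneg mult_nonneg_nonneg) auto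
        finally show ?thesis .
      qed
      then show "dominated_on_average L (max 1 (K powr q * C)) (\<lambda>d b. N (\<Sum>k<n. s (v d k * b k) (x0 k)) powr q)
         (\<lambda>b. N (\<Sum>k<n. s (w k * b k) (x0 k)) powr q)"
        unfolding dominated_on_average_def using m(1,2) by blast
    qed simp
  qed
qed

section \<open>Norming families of points\<close>

text \<open>
  The supremum in the definition of a Sidon set may be taken over a finite set. By compactness there are
  finitely many points such that at every point of the group the characters differ from those at one
  of them by less than \<open>\<eta> = 1 / (2 * M)\<close>, which costs half of the left-hand side.
\<close>

lemma sidon_norming:
  fixes E :: "('g::{topological_ab_group_add,t2_space} \<Rightarrow> complex) set"
  assumes comp: "compact (UNIV :: 'g set)" and sidon: "sidon_set E"
  shows "\<exists>M\<ge>1. \<forall>n \<gamma> q. inj_on \<gamma> {..<n} \<longrightarrow> \<gamma> ` {..<n} \<subseteq> E \<longrightarrow> 0 < q \<longrightarrow> q \<le> 1 \<longrightarrow>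
      (\<exists>L (e :: nat \<Rightarrow> 'g). norming_matrix n L (\<lambda>d k. \<gamma> k (e d)) M q)"
proof -
  obtain M0 where M0: "\<And>a :: ('g \<Rightarrow> complex) \<Rightarrow> complex. finite {\<gamma> \<in> E. a \<gamma> \<noteq> 0} \<Longrightarrow>
        (\<Sum>\<gamma> | \<gamma> \<in> E \<and> a \<gamma> \<noteq> 0. cmod (a \<gamma>)) \<le> M0 * (SUP g. cmod (\<Sum>\<gamma> | \<gamma> \<in> E \<and> a \<gamma> \<noteq> 0. a \<gamma> * \<gamma> g))"
    and ED: "E \<subseteq> dual_group" using sidon unfolding sidon_set_def by blast
  define M where "M = max 1 M0"
  have M: "1 \<le> M" "M0 \<le> M" by (auto simp: M_def)
  show ?thesis
  proof (intro exI[of _ "2 * M"] conjI allI impI)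
    show "1 \<le> 2 * M" using M by simp
    fix n :: nat and \<gamma> :: "nat \<Rightarrow> 'g \<Rightarrow> complex" and q :: real
    assume inj: "inj_on \<gamma> {..<n}" and sub: "\<gamma> ` {..<n} \<subseteq> E" and q: "0 < q" "q \<le> 1"
    have ch: "continuous_on UNIV (\<gamma> k)" "cmod (\<gamma> k g) = 1" if "k < n" for k g
      using that sub ED unfolding dual_group_def by blast+
    have sidon': "(\<Sum>k<n. cmod (\<xi> k)) \<le> M * (SUP g. cmod (\<Sum>k<n. \<gamma> k g * \<xi> k))" for \<xi>
    proof -
      define a where "a \<zeta> = (\<Sum>k | k < n \<and> \<gamma> k = \<zeta>. \<xi> k)" for \<zeta>
      have a: "a (\<gamma> k) = \<xi> k" if "k < n" for k
      proof -
        have "{j. j < n \<and> \<gamma> j = \<gamma> k} = {k}" using inj that by (auto simp: inj_on_def)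
        then show ?thesis by (simp add: a_def)
      qed
      have a0: "a \<zeta> = 0" if "\<zeta> \<notin> \<gamma> ` {..<n}" for \<zeta>
      proof -
        have none: "{k. k < n \<and> \<gamma> k = \<zeta>} = {}" using that by auto
        show ?thesis unfolding a_def none by simp
      qed
      have supp: "{\<zeta> \<in> E. a \<zeta> \<noteq> 0} \<subseteq> \<gamma> ` {..<n}" using a0 by blast
      then have fin: "finite {\<zeta> \<in> E. a \<zeta> \<noteq> 0}" by (rule finite_subset) simp
      have sum: "(\<Sum>\<zeta> | \<zeta> \<in> E \<and> a \<zeta> \<noteq> 0. h \<zeta>) = (\<Sum>k<n. h (\<gamma> k))"
        if "\<And>\<zeta>. a \<zeta> = 0 \<Longrightarrow> h \<zeta> = 0" for h :: "('g \<Rightarrow> complex) \<Rightarrow> 'z::comm_monoid_add"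
      proof -
        have "(\<Sum>\<zeta> | \<zeta> \<in> E \<and> a \<zeta> \<noteq> 0. h \<zeta>) = sum h (\<gamma> ` {..<n})"
          using supp sub that by (intro sum.mono_neutral_left) auto
        then show ?thesis using inj by (simp add: sum.reindex)
      qed
      have "(\<Sum>k<n. cmod (\<xi> k)) = (\<Sum>\<zeta> | \<zeta> \<in> E \<and> a \<zeta> \<noteq> 0. cmod (a \<zeta>))"
        by (subst sum) (auto simp: a)
      also have "\<dots> \<le> M0 * (SUP g. cmod (\<Sum>\<zeta> | \<zeta> \<in> E \<and> a \<zeta> \<noteq> 0. a \<zeta> * \<zeta> g))"
        by (rule M0[OF fin])
      also have "(\<lambda>g. cmod (\<Sum>\<zeta> | \<zeta> \<in> E \<and> a \<zeta> \<noteq> 0. a \<zeta> * \<zeta> g)) = (\<lambda>g. cmod (\<Sum>k<n. \<gamma> k g * \<xi> k))"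
        by (intro ext arg_cong[of _ _ cmod], subst sum) (auto simp: a mult.commute)
      also have "M0 * (SUP g. cmod (\<Sum>k<n. \<gamma> k g * \<xi> k)) \<le> M * (SUP g. cmod (\<Sum>k<n. \<gamma> k g * \<xi> k))"
      proof (rule mult_right_mono[OF M(2)])
        have "cmod (\<Sum>k<n. \<gamma> k g * \<xi> k) \<le> (\<Sum>k<n. cmod (\<xi> k))" for g
          by (rule sum_norm_le) (simp add: norm_mult ch)
        then have "bdd_above (range (\<lambda>g. cmod (\<Sum>k<n. \<gamma> k g * \<xi> k)))"
          by (intro bdd_aboveI[of _ "\<Sum>k<n. cmod (\<xi> k)"]) auto
        then show "0 \<le> (SUP g. cmod (\<Sum>k<n. \<gamma> k g * \<xi> k))"
          by (rule cSUP_upper2[of _ _ 0]) auto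
      qed
      finally show ?thesis .
    qed
    define \<eta> where "\<eta> = 1 / (2 * M)"
    have \<eta>: "0 < \<eta>" "M * \<eta> = 1 / 2" using M by (auto simp: \<eta>_def)
    define U where "U d = {g. \<forall>k<n. cmod (\<gamma> k g - \<gamma> k d) < \<eta>}" for d
    have op: "open (U d)" for d
    proof -
      have "U d = (\<Inter>k\<in>{..<n}. {g. cmod (\<gamma> k g - \<gamma> k d) < \<eta>})" by (auto simp: U_def)
      moreover have "open {g. cmod (\<gamma> k g - \<gamma> k d) < \<eta>}" if "k < n" for k
        by (intro open_Collect_less continuous_intros ch that)
      ultimately show ?thesis by (auto intro: open_INT)
    qed
    have cov: "UNIV \<subseteq> (\<Union>d\<in>UNIV. U d)" using \<eta> by (auto simp: U_def)
    obtain D where "D \<subseteq> UNIV" and D: "finite D" "UNIV \<subseteq> (\<Union>d\<in>D. U d)"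
      by (rule compactE_image[OF comp op cov])
    obtain L and e :: "nat \<Rightarrow> 'g" where e: "D = e ` {i. i < L}"
      using finite_imp_nat_seg_image_inj_on[OF D(1)] by blast
    have "norming_matrix n L (\<lambda>d k. \<gamma> k (e d)) (2 * M) q"
    proof
      show "cmod (\<gamma> k (e d)) \<le> 1" if "k < n" for d k using ch that by simp
      fix \<xi> :: "nat \<Rightarrow> complex"
      let ?F = "\<lambda>g. cmod (\<Sum>k<n. \<gamma> k g * \<xi> k)"
      have Dne: "D \<noteq> {}" using D(2) by auto
      define b where "b = Max (?F ` D)"
      have "b \<in> ?F ` D" unfolding b_def using D Dne by (intro Max_in) auto
      then obtain d where d: "d < L" "b = ?F (e d)" unfolding e by auto
      have le: "?F g \<le> b + \<eta> * (\<Sum>k<n. cmod (\<xi> k))" for g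
      proof -
        obtain d where d: "d \<in> D" "g \<in> U d" using D(2) by blast
        have "(\<Sum>k<n. \<gamma> k g * \<xi> k) = (\<Sum>k<n. \<gamma> k d * \<xi> k) + (\<Sum>k<n. (\<gamma> k g - \<gamma> k d) * \<xi> k)"
          by (simp add: algebra_simps sum_subtractf)
        then have "?F g \<le> ?F d + cmod (\<Sum>k<n. (\<gamma> k g - \<gamma> k d) * \<xi> k)"
          by (metis norm_triangle_ineq)
        also have "?F d \<le> b" unfolding b_def using d D by (intro Max_ge) auto
        also have "cmod (\<Sum>k<n. (\<gamma> k g - \<gamma> k d) * \<xi> k) \<le> (\<Sum>k<n. \<eta> * cmod (\<xi> k))"
        proof (rule sum_norm_le)
          fix k assume "k \<in> {..<n}"
          then have "cmod (\<gamma> k g - \<gamma> k d) \<le> \<eta>" using d(2) by (simp add: U_def less_imp_le)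
          then show "cmod ((\<gamma> k g - \<gamma> k d) * \<xi> k) \<le> \<eta> * cmod (\<xi> k)"
            by (simp add: norm_mult mult_right_mono)
        qed
        finally show ?thesis by (simp add: sum_distrib_left)
      qed
      have "(\<Sum>k<n. cmod (\<xi> k)) \<le> M * (SUP g. ?F g)" by (rule sidon')
      also have "\<dots> \<le> M * (b + \<eta> * (\<Sum>k<n. cmod (\<xi> k)))"
        using M le by (intro mult_left_mono cSUP_least) auto
      also have "\<dots> = M * b + (1 / 2) * (\<Sum>k<n. cmod (\<xi> k))"
        using \<eta>(2) by (simp add: distrib_left mult.assoc[symmetric])
      finally show "\<exists>d<L. (\<Sum>k<n. cmod (\<xi> k)) \<le> 2 * M * ?F (e d)" using d by auto
    qed (use M q in auto)
    then show "\<exists>L (e :: nat \<Rightarrow> 'g). norming_matrix n L (\<lambda>d k. \<gamma> k (e d)) (2 * M) q" by blast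
  qed
qed

text \<open>
  The coordinates of the Cantor group are a Sidon set: one choice of signs adds up the moduli of the
  real parts, another one those of the imaginary parts, and one of the two sums is at least half of
  the \<open>l1\<close> norm.
\<close>

lemma signs_norming:
  assumes "0 < q" "q \<le> 1"
  shows "norming_matrix n (2 ^ n) (\<lambda>d. sgn_of (set_decode d)) 2 q"
proof
  show "cmod (sgn_of (set_decode d) k) \<le> 1" for d k by (simp add: sgn_of_def)
  fix \<xi> :: "nat \<Rightarrow> complex"
  have *: "\<exists>d<2 ^ n. sum f {..<n} \<le> cmod (\<Sum>k<n. sgn_of (set_decode d) k * \<xi> k)"
    if lin: "\<And>A. \<bar>\<Sum>k<n. Re (sgn_of A k) * h k\<bar> \<le> cmod (\<Sum>k<n. sgn_of A k * \<xi> k)"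
      and f: "\<And>k. f k = \<bar>h k\<bar>" for f h :: "nat \<Rightarrow> real"
  proof -
    define A where "A = {k \<in> {..<n}. 0 \<le> h k}"
    have "set_encode A < 2 ^ n" by (rule set_encode_less) (auto simp: A_def)
    moreover have dec: "set_decode (set_encode A) = A" by (simp add: A_def)
    moreover have "sum f {..<n} = (\<Sum>k<n. Re (sgn_of A k) * h k)"
      by (intro sum.cong) (auto simp: f A_def sgn_of_def)
    ultimately show ?thesis using lin[of A] by (intro exI[of _ "set_encode A"]) auto
  qed
  have 1: "\<exists>d<2 ^ n. (\<Sum>k<n. \<bar>Re (\<xi> k)\<bar>) \<le> cmod (\<Sum>k<n. sgn_of (set_decode d) k * \<xi> k)"
  proof (rule *[where h = "\<lambda>k. Re (\<xi> k)"])
    fix A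
    have "(\<Sum>k<n. Re (sgn_of A k) * Re (\<xi> k)) = Re (\<Sum>k<n. sgn_of A k * \<xi> k)"
      by (auto simp: sgn_of_def intro!: sum.cong)
    then show "\<bar>\<Sum>k<n. Re (sgn_of A k) * Re (\<xi> k)\<bar> \<le> cmod (\<Sum>k<n. sgn_of A k * \<xi> k)"
      using abs_Re_le_cmod by metis
  qed simp
  have 2: "\<exists>d<2 ^ n. (\<Sum>k<n. \<bar>Im (\<xi> k)\<bar>) \<le> cmod (\<Sum>k<n. sgn_of (set_decode d) k * \<xi> k)"
  proof (rule *[where h = "\<lambda>k. Im (\<xi> k)"])
    fix A
    have "(\<Sum>k<n. Re (sgn_of A k) * Im (\<xi> k)) = Im (\<Sum>k<n. sgn_of A k * \<xi> k)"
      by (auto simp: sgn_of_def intro!: sum.cong)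
    then show "\<bar>\<Sum>k<n. Re (sgn_of A k) * Im (\<xi> k)\<bar> \<le> cmod (\<Sum>k<n. sgn_of A k * \<xi> k)"
      using abs_Im_le_cmod by metis
  qed simp
  have "(\<Sum>k<n. cmod (\<xi> k)) \<le> (\<Sum>k<n. \<bar>Re (\<xi> k)\<bar>) + (\<Sum>k<n. \<bar>Im (\<xi> k)\<bar>)"
    unfolding sum.distrib[symmetric] by (intro sum_mono cmod_le)
  then show "\<exists>d<2 ^ n. (\<Sum>k<n. cmod (\<xi> k)) \<le> 2 * cmod (\<Sum>k<n. sgn_of (set_decode d) k * \<xi> k)"
    using 1 2 by (smt (verit))
qed (use assms in auto)

section \<open>Comparison of averages over the group and over signs\<close>

text \<open>
  The \<open>r\<close>-norm inequality makes the \<open>r\<close>-th power of the quasinorm a continuous function. Continuity in the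
  coefficients yields all measurability statements below.
\<close>

lemma quasinorm_combination_continuous:
  fixes s :: "complex \<Rightarrow> 'x::ab_group_add \<Rightarrow> 'x"
  assumes qb: "quasi_banach s N"
  shows "continuous_on UNIV (\<lambda>c :: nat \<Rightarrow> complex. N (\<Sum>k<n. s (c k) (x k)))"
proof -
  have N0: "\<And>y. 0 \<le> N y" and Nz: "\<And>y. N y = 0 \<longleftrightarrow> y = 0" and Nscale: "\<And>c y. N (s c y) = cmod c * N y"
    and vs: "vector_space s"
    using qb by (auto simp: quasi_banach_def)
  interpret vector_space s by (rule vs)
  obtain r where r: "0 < r" "r < 1" "\<And>y z. N (y + z) powr r \<le> N y powr r + N z powr r"
    using qb by (auto simp: quasi_banach_def)
  define f where "f c = (\<Sum>k<n. s (c k) (x k))" for c :: "nat \<Rightarrow> complex"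
  have fdiff: "f c - f c' = f (\<lambda>k. c k - c' k)" for c c'
    by (simp add: f_def sum_subtractf scale_left_diff_distrib)
  have sum_le: "N (\<Sum>k<m. y k) powr r \<le> (\<Sum>k<m. N (y k) powr r)" for y and m :: nat
  proof (induction m)
    case 0
    have "N 0 = 0" using Nz by simp
    then show ?case by simp
  next
    case (Suc m)
    then show ?case using r(3)[of "\<Sum>k<m. y k" "y m"] by simp
  qed
  have f_le: "N (f c) powr r \<le> (\<Sum>k<n. (cmod (c k) * N (x k)) powr r)" for c
    unfolding f_def using sum_le[where m = n and y = "\<lambda>k. s (c k) (x k)"] by (simp add: Nscale)
  have "N y powr r \<le> N (y - z) powr r + N z powr r" for y z using r(3)[of "y - z" z] by simp
  moreover have "N (y - z) = N (z - y)" for y z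
    using Nscale[of "-1" "y - z"] by simp
  ultimately have Ndiff: "\<bar>N y powr r - N z powr r\<bar> \<le> N (y - z) powr r" for y z
    by (smt (verit))
  have cont: "continuous_on UNIV (\<lambda>c. N (f c) powr r)"
  proof (rule continuous_on_eq_continuous_at[THEN iffD2, OF open_UNIV], intro ballI)
    fix c0 :: "nat \<Rightarrow> complex"
    have coord: "((\<lambda>c :: nat \<Rightarrow> complex. c k) \<longlongrightarrow> c0 k) (at c0)" for k
    proof -
      have "continuous_on UNIV (\<lambda>c :: nat \<Rightarrow> complex. c k)" by (rule continuous_on_product_coordinates)
      then show ?thesis by (simp add: continuous_on_def)
    qed
    have "((\<lambda>c. \<Sum>k<n. (cmod (c k - c0 k) * N (x k)) powr r) \<longlongrightarrow> (\<Sum>k<n. (cmod (c0 k - c0 k) * N (x k)) powr r)) (at c0)"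
      using r by (intro tendsto_sum tendsto_powr' tendsto_mult tendsto_norm tendsto_diff coord tendsto_const) (auto intro!: always_eventually mult_nonneg_nonneg N0)
    then have lim: "((\<lambda>c. \<Sum>k<n. (cmod (c k - c0 k) * N (x k)) powr r) \<longlongrightarrow> 0) (at c0)" by simp
    have "((\<lambda>c. N (f c) powr r - N (f c0) powr r) \<longlongrightarrow> 0) (at c0)"
    proof (rule Lim_null_comparison[OF _ lim], intro always_eventually allI)
      fix c
      have "\<bar>N (f c) powr r - N (f c0) powr r\<bar> \<le> N (f c - f c0) powr r" by (rule Ndiff)
      also have "\<dots> \<le> (\<Sum>k<n. (cmod (c k - c0 k) * N (x k)) powr r)" unfolding fdiff by (rule f_le)
      finally show "norm (N (f c) powr r - N (f c0) powr r) \<le> (\<Sum>k<n. (cmod (c k - c0 k) * N (x k)) powr r)" by simp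
    qed
    then show "isCont (\<lambda>c. N (f c) powr r) c0"
      unfolding isCont_def by (rule Lim_null[THEN iffD2])
  qed
  have "continuous_on UNIV (\<lambda>c. (N (f c) powr r) powr (1 / r))"
    using r by (intro continuous_on_powr' cont continuous_on_const) auto
  moreover have "(N (f c) powr r) powr (1 / r) = N (f c)" for c
    using r N0 by (simp add: powr_powr)
  ultimately show ?thesis unfolding f_def by simp
qed

text \<open>
  A pointwise bound by an average of translates of \<open>\<phi>\<close> becomes a bound between \<open>L\<^sub>P\<close> norms. Jensen's
  inequality raises the exponent from \<open>q\<close> to \<open>P\<close>, and measure preserving maps do not change the integral.
\<close>

lemma nn_integral_domination:
  fixes \<phi> \<psi> :: "'h \<Rightarrow> real"
  assumes meas: "\<phi> \<in> borel_measurable \<nu>" and nn: "\<And>h. 0 \<le> \<phi> h" "\<And>h. 0 \<le> \<psi> h"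
    and \<theta>: "\<And>d. d < L \<Longrightarrow> \<theta> d \<in> measurable \<nu> \<nu>" "\<And>d. d < L \<Longrightarrow> distr \<nu> \<nu> (\<theta> d) = \<nu>"
    and m: "\<And>d. d < L \<Longrightarrow> 0 \<le> m d" "(\<Sum>d<L. m d) = 1"
    and dom: "\<And>h. h \<in> space \<nu> \<Longrightarrow> \<psi> h powr q \<le> C * (\<Sum>d<L. m d * \<phi> (\<theta> d h) powr q)"
    and q: "0 < q" "q \<le> P" and C: "0 < C"
  shows "(\<integral>\<^sup>+ h. ennreal (\<psi> h powr P) \<partial>\<nu>) \<le> ennreal (C powr (P / q)) * (\<integral>\<^sup>+ h. ennreal (\<phi> h powr P) \<partial>\<nu>)"
proof -
  have pt: "\<psi> h powr P \<le> C powr (P / q) * (\<Sum>d<L. m d * \<phi> (\<theta> d h) powr P)" if h: "h \<in> space \<nu>" for h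
  proof -
    have "(\<Sum>d<L. m d * \<phi> (\<theta> d h) powr q) = (\<Sum>d<L. m d * (\<phi> (\<theta> d h) powr P) powr (q / P))"
      using q by (intro sum.cong) (auto simp: powr_powr)
    also have "\<dots> \<le> (\<Sum>d<L. m d * \<phi> (\<theta> d h) powr P) powr (q / P)"
      using m q by (intro powr_jensen) auto
    finally have "\<psi> h powr q \<le> C * (\<Sum>d<L. m d * \<phi> (\<theta> d h) powr P) powr (q / P)"
      using dom[OF h] C by (smt (verit) mult_left_mono)
    then have "(\<psi> h powr q) powr (P / q) \<le> (C * (\<Sum>d<L. m d * \<phi> (\<theta> d h) powr P) powr (q / P)) powr (P / q)"
      using q by (intro powr_mono2) auto
    moreover have "0 \<le> (\<Sum>d<L. m d * \<phi> (\<theta> d h) powr P)"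
      using m by (intro sum_nonneg mult_nonneg_nonneg) auto
    ultimately show ?thesis using q C by (simp add: powr_powr powr_mult)
  qed
  have "(\<integral>\<^sup>+ h. ennreal (\<psi> h powr P) \<partial>\<nu>)
     \<le> (\<integral>\<^sup>+ h. (\<Sum>d<L. ennreal (C powr (P / q) * m d) * ennreal (\<phi> (\<theta> d h) powr P)) \<partial>\<nu>)"
  proof (rule nn_integral_mono)
    fix h assume "h \<in> space \<nu>"
    then have "ennreal (\<psi> h powr P) \<le> ennreal (\<Sum>d<L. (C powr (P / q) * m d) * \<phi> (\<theta> d h) powr P)"
      using pt by (intro ennreal_leI) (simp add: sum_distrib_left mult.assoc)
    also have "\<dots> = (\<Sum>d<L. ennreal ((C powr (P / q) * m d) * \<phi> (\<theta> d h) powr P))"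
      using m by (intro sum_ennreal[symmetric]) auto
    also have "\<dots> = (\<Sum>d<L. ennreal (C powr (P / q) * m d) * ennreal (\<phi> (\<theta> d h) powr P))"
      using m by (intro sum.cong ennreal_mult) auto
    finally show "ennreal (\<psi> h powr P) \<le> \<dots>" .
  qed
  also have "\<dots> = (\<Sum>d<L. ennreal (C powr (P / q) * m d) * (\<integral>\<^sup>+ h. ennreal (\<phi> (\<theta> d h) powr P) \<partial>\<nu>))"
  proof (subst nn_integral_sum)
    fix d assume "d \<in> {..<L}"
    then have [measurable]: "\<theta> d \<in> measurable \<nu> \<nu>" using \<theta> by simp
    note meas[measurable]
    show "(\<lambda>h. ennreal (C powr (P / q) * m d) * ennreal (\<phi> (\<theta> d h) powr P)) \<in> borel_measurable \<nu>" by measurable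
  next
    show "(\<Sum>d<L. \<integral>\<^sup>+ h. ennreal (C powr (P / q) * m d) * ennreal (\<phi> (\<theta> d h) powr P) \<partial>\<nu>)
      = (\<Sum>d<L. ennreal (C powr (P / q) * m d) * (\<integral>\<^sup>+ h. ennreal (\<phi> (\<theta> d h) powr P) \<partial>\<nu>))"
    proof (intro sum.cong refl nn_integral_cmult)
      fix d assume "d \<in> {..<L}"
      then have [measurable]: "\<theta> d \<in> measurable \<nu> \<nu>" using \<theta> by simp
      note meas[measurable]
      show "(\<lambda>h. ennreal (\<phi> (\<theta> d h) powr P)) \<in> borel_measurable \<nu>" by measurable
    qed
  qed
  also have "\<dots> = (\<Sum>d<L. ennreal (C powr (P / q) * m d) * (\<integral>\<^sup>+ h. ennreal (\<phi> h powr P) \<partial>\<nu>))"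
  proof (intro sum.cong refl arg_cong2[of _ _ _ _ times])
    fix d assume d: "d \<in> {..<L}"
    note meas[measurable]
    have "(\<integral>\<^sup>+ h. ennreal (\<phi> h powr P) \<partial>\<nu>) = (\<integral>\<^sup>+ h. ennreal (\<phi> h powr P) \<partial>(distr \<nu> \<nu> (\<theta> d)))"
      using \<theta>(2) d by simp
    also have "\<dots> = (\<integral>\<^sup>+ h. ennreal (\<phi> (\<theta> d h) powr P) \<partial>\<nu>)"
      using \<theta>(1) d by (intro nn_integral_distr) auto
    finally show "(\<integral>\<^sup>+ h. ennreal (\<phi> (\<theta> d h) powr P) \<partial>\<nu>) = (\<integral>\<^sup>+ h. ennreal (\<phi> h powr P) \<partial>\<nu>)" ..
  qed
  also have "\<dots> = ennreal (C powr (P / q)) * (\<integral>\<^sup>+ h. ennreal (\<phi> h powr P) \<partial>\<nu>)"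
  proof -
    have "(\<Sum>d<L. ennreal (C powr (P / q) * m d)) = ennreal (\<Sum>d<L. C powr (P / q) * m d)"
      using m by (intro sum_ennreal) auto
    also have "\<dots> = ennreal (C powr (P / q))" by (simp add: sum_distrib_left[symmetric] m(2))
    finally show ?thesis by (simp add: sum_distrib_right[symmetric])
  qed
  finally show ?thesis .
qed

lemma esssup_translates_attained:
  fixes \<phi> :: "'h \<Rightarrow> real"
  assumes "prob_space \<nu>" and meas: "\<phi> \<in> borel_measurable \<nu>"
    and \<theta>: "\<And>d. d < L \<Longrightarrow> \<theta> d \<in> measurable \<nu> \<nu>" "\<And>d. d < L \<Longrightarrow> distr \<nu> \<nu> (\<theta> d) = \<nu>"
  shows "\<exists>h\<in>space \<nu>. \<forall>d<(L::nat). ennreal (\<phi> (\<theta> d h)) \<le> esssup \<nu> (\<lambda>h. ennreal (\<phi> h))"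
proof -
  interpret prob_space \<nu> by fact
  note meas[measurable]
  let ?B = "esssup \<nu> (\<lambda>h. ennreal (\<phi> h))"
  have "AE h in \<nu>. ennreal (\<phi> (\<theta> d h)) \<le> ?B" if "d < L" for d
  proof -
    have "AE h in distr \<nu> \<nu> (\<theta> d). ennreal (\<phi> h) \<le> ?B"
      unfolding \<theta>(2)[OF that] by (rule esssup_AE)
    then show ?thesis
      using \<theta>(1)[OF that] by (subst (asm) AE_distr_iff) auto
  qed
  then have "AE h in \<nu>. \<forall>d\<in>{..<L}. ennreal (\<phi> (\<theta> d h)) \<le> ?B"
    by (intro AE_finite_allI) auto
  then have AE: "AE h in \<nu>. \<forall>d<L. ennreal (\<phi> (\<theta> d h)) \<le> ?B"
    by (rule eventually_mono) auto
  show ?thesis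
  proof (rule ccontr)
    assume no: "\<not> ?thesis"
    have "AE h in \<nu>. h \<in> space \<nu>" by (rule AE_space)
    with AE have "AE h in \<nu>. False"
      by eventually_elim (use no in blast)
    then show False using AE_False by blast
  qed
qed

text \<open>
  Here the weights in \<open>dom\<close> may depend on both points. Almost every \<open>h\<close> has all its finitely many translates
  below the essential supremum of \<open>\<phi>\<close>, and a single such \<open>h\<close> bounds \<open>\<psi>\<close> everywhere.
\<close>

lemma esssup_domination:
  fixes \<phi> :: "'h \<Rightarrow> real" and \<psi> :: "'i \<Rightarrow> real" and L :: nat
  assumes "prob_space \<nu>" and meas: "\<phi> \<in> borel_measurable \<nu>" "\<psi> \<in> borel_measurable \<nu>'"
    and nn: "\<And>h. 0 \<le> \<phi> h" "\<And>h. 0 \<le> \<psi> h"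
    and \<theta>: "\<And>d. d < L \<Longrightarrow> \<theta> d \<in> measurable \<nu> \<nu>" "\<And>d. d < L \<Longrightarrow> distr \<nu> \<nu> (\<theta> d) = \<nu>"
    and dom: "\<And>h h'. h \<in> space \<nu> \<Longrightarrow> h' \<in> space \<nu>' \<Longrightarrow>
      \<exists>m. (\<forall>d<L. 0 \<le> m d) \<and> (\<Sum>d<L. m d) = 1 \<and> \<psi> h' powr q \<le> C * (\<Sum>d<L. m d * \<phi> (\<theta> d h) powr q)"
    and q: "0 < q" and C: "0 < C"
  shows "esssup \<nu>' (\<lambda>h. ennreal (\<psi> h)) \<le> ennreal (C powr (1 / q)) * esssup \<nu> (\<lambda>h. ennreal (\<phi> h))"
proof -
  let ?B = "esssup \<nu> (\<lambda>h. ennreal (\<phi> h))"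
  obtain h where h: "h \<in> space \<nu>" "\<And>d. d < L \<Longrightarrow> ennreal (\<phi> (\<theta> d h)) \<le> ?B"
    using esssup_translates_attained[where \<nu> = \<nu> and \<phi> = \<phi> and \<theta> = \<theta> and L = L, OF assms(1) meas(1)] \<theta> by blast
  have "ennreal (\<psi> h') \<le> ennreal (C powr (1 / q)) * ?B" if h': "h' \<in> space \<nu>'" for h'
  proof (cases "?B = \<infinity>")
    case True
    then show ?thesis using C by (simp add: ennreal_mult_top)
  next
    case False
    then obtain b where b: "?B = ennreal b" "0 \<le> b" by (cases ?B) auto
    obtain m where m: "\<forall>d<L. 0 \<le> m d" "(\<Sum>d<L. m d) = 1" "\<psi> h' powr q \<le> C * (\<Sum>d<L. m d * \<phi> (\<theta> d h) powr q)"
      using dom[OF h(1) h'] by blast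
    have "(\<Sum>d<L. m d * \<phi> (\<theta> d h) powr q) \<le> (\<Sum>d<L. m d * b powr q)"
      using h(2) m(1) b q nn by (intro sum_mono mult_left_mono powr_mono2) (auto simp: ennreal_le_iff)
    also have "\<dots> = b powr q" by (simp add: sum_distrib_right[symmetric] m(2))
    finally have "\<psi> h' powr q \<le> C * b powr q" using m(3) C by (smt (verit) mult_left_mono)
    then have "(\<psi> h' powr q) powr (1 / q) \<le> (C * b powr q) powr (1 / q)"
      using q by (intro powr_mono2) auto
    then have "\<psi> h' \<le> C powr (1 / q) * b"
      using q b nn by (simp add: powr_mult powr_powr)
    then show ?thesis unfolding b by (simp add: ennreal_mult[symmetric] b(2) ennreal_leI)
  qed
  then show ?thesis using meas(2) by (intro esssup_I) auto
qed

lemma Lp_quasinorm_le: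
  assumes p: "p \<noteq> \<infinity>" "0 < p" and K: "0 < K"
    and le: "(\<integral>\<^sup>+ g. ennreal (N (f g) powr enn2real p) \<partial>\<mu>) \<le> ennreal K * (\<integral>\<^sup>+ g. ennreal (N' (f' g) powr enn2real p) \<partial>\<mu>')"
  shows "Lp_quasinorm p \<mu> N f \<le> ennreal (K powr (1 / enn2real p)) * Lp_quasinorm p \<mu>' N' f'"
proof -
  define P where "P = enn2real p"
  have P: "0 < P" using p by (cases p) (auto simp: P_def)
  define I where "I = (\<integral>\<^sup>+ g. ennreal (N (f g) powr P) \<partial>\<mu>)"
  define I' where "I' = (\<integral>\<^sup>+ g. ennreal (N' (f' g) powr P) \<partial>\<mu>')"
  have L: "Lp_quasinorm p \<mu> N f = (if I = \<infinity> then \<infinity> else ennreal (enn2real I powr (1 / P)))"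
    "Lp_quasinorm p \<mu>' N' f' = (if I' = \<infinity> then \<infinity> else ennreal (enn2real I' powr (1 / P)))"
    using p by (simp_all add: Lp_quasinorm_def I_def I'_def P_def Let_def)
  have le': "I \<le> ennreal K * I'" using le by (simp add: I_def I'_def P_def)
  show ?thesis
  proof (cases "I' = \<infinity>")
    case True
    then show ?thesis unfolding L using K by (simp add: ennreal_mult_top P_def)
  next
    case False
    then obtain b where b: "I' = ennreal b" "0 \<le> b" by (cases I') auto
    then have "I \<le> ennreal (K * b)" using le' K by (simp add: ennreal_mult)
    then obtain a where a: "I = ennreal a" "0 \<le> a" "a \<le> K * b"
      using K b by (cases I) (auto simp: ennreal_le_iff top_unique)
    have "a powr (1 / P) \<le> (K * b) powr (1 / P)" using a P by (intro powr_mono2) auto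
    also have "\<dots> = K powr (1 / P) * b powr (1 / P)" using K b by (simp add: powr_mult)
    finally show ?thesis unfolding L a(1) b(1) using a b K
      by (simp add: ennreal_mult[symmetric] ennreal_leI P_def)
  qed
qed

lemma measurable_cantor_coordinate: "(\<lambda>t. t k) \<in> borel_measurable cantor_haar"
proof -
  have "(\<lambda>t :: nat \<Rightarrow> real. t k) \<in> borel_measurable (restrict_space borel cantor_group)"
    by (intro measurable_restrict_space1 borel_measurable_continuous_onI continuous_on_product_coordinates)
  then show ?thesis using measurable_cong_sets[OF sets_cantor_haar refl] by blast
qed

lemma measurable_cantor_multiplication:
  assumes "\<sigma> \<in> cantor_group"
  shows "(\<lambda>t k. \<sigma> k * t k) \<in> measurable cantor_haar cantor_haar"
proof -
  have "(\<lambda>t k. \<sigma> k * t k) \<in> measurable cantor_haar (restrict_space borel cantor_group)"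
  proof (rule measurable_restrict_space2)
    have "\<sigma> k * t k \<in> {-1, 1}" if "t \<in> cantor_group" for t k
    proof -
      have "\<sigma> k \<in> {-1, 1}" "t k \<in> {-1, 1}" using assms that by (auto simp: cantor_group_def PiE_iff)
      then show ?thesis by auto
    qed
    then show "(\<lambda>t k. \<sigma> k * t k) \<in> space cantor_haar \<rightarrow> cantor_group"
      unfolding space_cantor_haar by (auto simp: cantor_group_def PiE_iff)
    note measurable_cantor_coordinate[measurable]
    show "(\<lambda>t k. \<sigma> k * t k) \<in> measurable cantor_haar borel"
      by (rule measurable_coordinatewise_then_product) measurable
  qed
  then show ?thesis using measurable_cong_sets[OF refl sets_cantor_haar] by blast
qed

text \<open>
  With \<open>t k * \<gamma> k g\<close> as coefficients, domination by points of the group, applied to \<open>w = t\<close>, compares for each fixed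
  \<open>t\<close> the integrals over the group with and without the signs \<open>t\<close>. Domination by signs, applied to characters or
  their conjugates, compares for each fixed \<open>g\<close> the integrals over the Cantor group with and without the
  characters. Integrating over both groups combines the two comparisons. If \<open>p = \<infinity>\<close>, one application in each
  direction is enough, with coefficients \<open>w\<close> that exchange the characters at \<open>g\<close> and the signs \<open>t\<close>.
\<close>

lemma Lp_comparison:
  fixes \<Theta> :: "(nat \<Rightarrow> complex) \<Rightarrow> real" and \<mu> :: "'g::{topological_ab_group_add,t2_space} measure"
    and e :: "nat \<Rightarrow> 'g" and \<sigma> :: "nat \<Rightarrow> nat \<Rightarrow> real" and L L' :: nat
  assumes haar: "normalized_haar \<mu>"
    and \<Theta>: "\<Theta> \<in> borel_measurable borel" "\<And>c. 0 \<le> \<Theta> c"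
    and \<gamma>: "\<And>k. \<gamma> k \<in> dual_group"
    and \<sigma>: "\<And>d. \<sigma> d \<in> cantor_group"
    and domG: "\<And>w. (\<And>k. cmod (w k) = 1) \<Longrightarrow>
        dominated_on_average L CG (\<lambda>d b. \<Theta> (\<lambda>k. \<gamma> k (e d) * b k) powr q) (\<lambda>b. \<Theta> (\<lambda>k. w k * b k) powr q)"
    and domD: "\<And>w. (\<And>k. cmod (w k) = 1) \<Longrightarrow>
        dominated_on_average L' CD (\<lambda>d b. \<Theta> (\<lambda>k. complex_of_real (\<sigma> d k) * b k) powr q)
          (\<lambda>b. \<Theta> (\<lambda>k. w k * b k) powr q)"
    and q: "0 < q" "p \<noteq> \<infinity> \<Longrightarrow> q \<le> enn2real p" and p: "0 < p" and C: "1 \<le> CG" "1 \<le> CD"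
  defines "X \<equiv> Lp_quasinorm p \<mu> \<Theta> (\<lambda>g k. \<gamma> k g)"
    and "Y \<equiv> Lp_quasinorm p cantor_haar \<Theta> (\<lambda>t k. complex_of_real (t k))"
    and "K \<equiv> (CG * CD) powr (1 / q)"
  shows "X \<le> ennreal K * Y" "Y \<le> ennreal K * X"
proof -
  have mu: "prob_space \<mu>" "sets \<mu> = sets borel" and inv: "\<And>a. distr \<mu> borel (\<lambda>x. a + x) = \<mu>"
    using haar by (auto simp: normalized_haar_def)
  interpret M: prob_space \<mu> by (rule mu)
  interpret D: prob_space cantor_haar by (rule prob_space_cantor_haar)
  interpret P: pair_sigma_finite cantor_haar \<mu> ..
  have spD: "space cantor_haar = cantor_group" by (rule space_cantor_haar)
  have spM: "space \<mu> = UNIV" using sets_eq_imp_space_eq[OF mu(2)] by simp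
  have \<gamma>_add: "\<gamma> k (a + g) = \<gamma> k a * \<gamma> k g" and \<gamma>_norm: "cmod (\<gamma> k g) = 1" and \<gamma>_cont: "continuous_on UNIV (\<gamma> k)" for k a g
    using \<gamma>[of k] by (auto simp: dual_group_def)
  have \<gamma>_cnj: "cnj (\<gamma> k g) * \<gamma> k g = 1" for k g
    using complex_norm_square[of "\<gamma> k g"] by (simp add: \<gamma>_norm mult.commute)
  have tt: "t k * t k = 1" "\<bar>t k\<bar> = 1" if "t \<in> cantor_group" for t k
  proof -
    have "t k \<in> {-1, 1}" using that by (auto simp: cantor_group_def PiE_iff)
    then show "t k * t k = 1" "\<bar>t k\<bar> = 1" by auto
  qed
  have \<gamma>_meas [measurable]: "\<gamma> k \<in> borel_measurable \<mu>" for k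
    using borel_measurable_continuous_onI[OF \<gamma>_cont[of k]] measurable_cong_sets[OF mu(2) refl] by blast
  note measurable_cantor_coordinate[measurable] \<Theta>(1)[measurable]
  define U where "U t g = \<Theta> (\<lambda>k. complex_of_real (t k) * \<gamma> k g)" for t g
  define u0 where "u0 t = \<Theta> (\<lambda>k. complex_of_real (t k))" for t
  define u1 where "u1 g = \<Theta> (\<lambda>k. \<gamma> k g)" for g
  have u0_meas [measurable]: "u0 \<in> borel_measurable cantor_haar"
    unfolding u0_def by (rule measurable_compose[OF measurable_coordinatewise_then_product \<Theta>(1)]) measurable
  have u1_meas [measurable]: "u1 \<in> borel_measurable \<mu>"
    unfolding u1_def by (rule measurable_compose[OF measurable_coordinatewise_then_product \<Theta>(1)]) measurable
  have Ut_meas: "U t \<in> borel_measurable \<mu>" for t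
    unfolding U_def by (rule measurable_compose[OF measurable_coordinatewise_then_product \<Theta>(1)]) measurable
  have Ug_meas: "(\<lambda>t. U t g) \<in> borel_measurable cantor_haar" for g
    unfolding U_def by (rule measurable_compose[OF measurable_coordinatewise_then_product \<Theta>(1)]) measurable
  have U_meas [measurable]: "(\<lambda>z. U (fst z) (snd z)) \<in> borel_measurable (cantor_haar \<Otimes>\<^sub>M \<mu>)"
  proof -
    have [measurable]: "(\<lambda>z. fst z k) \<in> borel_measurable (cantor_haar \<Otimes>\<^sub>M \<mu>)" for k
      by (rule measurable_compose[OF measurable_fst measurable_cantor_coordinate])
    have [measurable]: "(\<lambda>z. \<gamma> k (snd z)) \<in> borel_measurable (cantor_haar \<Otimes>\<^sub>M \<mu>)" for k
      by (rule measurable_compose[OF measurable_snd \<gamma>_meas])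
    show ?thesis
      unfolding U_def by (rule measurable_compose[OF measurable_coordinatewise_then_product \<Theta>(1)]) measurable
  qed
  have U0: "0 \<le> U t g" "0 \<le> u0 t" "0 \<le> u1 g" for t g by (simp_all add: U_def u0_def u1_def \<Theta>)
  let ?G = "\<lambda>d g. e d + g" and ?D = "\<lambda>d (t :: nat \<Rightarrow> real) k. \<sigma> d k * t k"
  have G: "?G d \<in> measurable \<mu> \<mu>" "distr \<mu> \<mu> (?G d) = \<mu>" for d
  proof -
    have "?G d \<in> borel_measurable borel"
      by (intro borel_measurable_continuous_onI continuous_intros)
    then show "?G d \<in> measurable \<mu> \<mu>" using measurable_cong_sets[OF mu(2) mu(2)] by blast
    show "distr \<mu> \<mu> (?G d) = \<mu>" using inv[of "e d"] distr_cong[OF refl mu(2)] by metis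
  qed
  have D: "?D d \<in> measurable cantor_haar cantor_haar" "distr cantor_haar cantor_haar (?D d) = cantor_haar" for d
    by (rule measurable_cantor_multiplication[OF \<sigma>], rule cantor_haar_invariant[OF \<sigma>])
  have CG0: "0 < CG" "0 < CD" using C by auto
  have K0: "0 < K" using CG0 by (simp add: K_def)
  have "X \<le> ennreal K * Y \<and> Y \<le> ennreal K * X"
  proof (cases "p = \<infinity>")
    case True
    have XY: "X = esssup \<mu> (\<lambda>g. ennreal (u1 g))" "Y = esssup cantor_haar (\<lambda>t. ennreal (u0 t))"
      by (simp_all add: X_def Y_def Lp_quasinorm_def True u1_def u0_def)
    have "X \<le> ennreal (CD powr (1 / q)) * Y"
      unfolding XY
    proof (rule esssup_domination[where \<theta> = ?D and L = L', OF D.prob_space_axioms u0_meas u1_meas U0(2,3) D _ q(1) CG0(2)])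
      fix t g assume t: "t \<in> space cantor_haar"
      have nw: "cmod (\<gamma> k g * t k) = 1" for k using t by (auto simp: norm_mult \<gamma>_norm tt spD)
      from domD[of "\<lambda>k. \<gamma> k g * t k", OF nw, unfolded dominated_on_average_def]
      obtain m where m0: "\<forall>d<L'. 0 \<le> m d" and m1: "(\<Sum>d<L'. m d) = 1"
        and m2: "\<forall>b. \<Theta> (\<lambda>k. (\<gamma> k g * t k) * b k) powr q \<le> CD * (\<Sum>d<L'. m d * \<Theta> (\<lambda>k. complex_of_real (\<sigma> d k) * b k) powr q)"
        by (elim exE conjE)
      note m = m0[rule_format] m1 m2[rule_format]
      have "(\<lambda>k. (\<gamma> k g * t k) * t k) = (\<lambda>k. \<gamma> k g)"
        using tt(1)[of t] t by (simp add: spD mult.assoc flip: of_real_mult)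
      then have "u1 g powr q \<le> CD * (\<Sum>d<L'. m d * u0 (?D d t) powr q)"
        using m(3)[of "\<lambda>k. of_real (t k)"] by (simp add: u1_def u0_def)
      then show "\<exists>m. (\<forall>d<L'. 0 \<le> m d) \<and> (\<Sum>d<L'. m d) = 1 \<and> u1 g powr q \<le> CD * (\<Sum>d<L'. m d * u0 (?D d t) powr q)"
        using m0 m1 by blast
    qed
    also have "\<dots> \<le> ennreal K * Y"
      unfolding K_def using C q by (intro mult_right_mono ennreal_leI powr_mono2) auto
    finally have 1: "X \<le> ennreal K * Y" .
    have "Y \<le> ennreal (CG powr (1 / q)) * X"
      unfolding XY
    proof (rule esssup_domination[where \<theta> = ?G and L = L, OF M.prob_space_axioms u1_meas u0_meas U0(3,2) G _ q(1) CG0(1)])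
      fix g t assume t: "t \<in> space cantor_haar"
      have nw: "cmod (t k * cnj (\<gamma> k g)) = 1" for k using t by (auto simp: norm_mult \<gamma>_norm tt spD)
      from domG[of "\<lambda>k. t k * cnj (\<gamma> k g)", OF nw, unfolded dominated_on_average_def]
      obtain m where m0: "\<forall>d<L. 0 \<le> m d" and m1: "(\<Sum>d<L. m d) = 1"
        and m2: "\<forall>b. \<Theta> (\<lambda>k. (t k * cnj (\<gamma> k g)) * b k) powr q \<le> CG * (\<Sum>d<L. m d * \<Theta> (\<lambda>k. \<gamma> k (e d) * b k) powr q)"
        by (elim exE conjE)
      note m = m0[rule_format] m1 m2[rule_format]
      have "u0 t powr q \<le> CG * (\<Sum>d<L. m d * u1 (?G d g) powr q)"
        using m(3)[of "\<lambda>k. \<gamma> k g"] by (simp add: u1_def u0_def mult.assoc \<gamma>_cnj \<gamma>_add)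
      then show "\<exists>m. (\<forall>d<L. 0 \<le> m d) \<and> (\<Sum>d<L. m d) = 1 \<and> u0 t powr q \<le> CG * (\<Sum>d<L. m d * u1 (?G d g) powr q)"
        using m0 m1 by blast
    qed
    also have "\<dots> \<le> ennreal K * X"
      unfolding K_def using C q by (intro mult_right_mono ennreal_leI powr_mono2) auto
    finally show ?thesis using 1 by blast
  next
    case False
    define R where "R = enn2real p"
    have R: "0 < R" using p False by (cases p) (auto simp: R_def)
    have qR: "q \<le> R" using q(2) False by (simp add: R_def)
    define A where "A = (\<integral>\<^sup>+ g. ennreal (u1 g powr R) \<partial>\<mu>)"
    define B where "B = (\<integral>\<^sup>+ t. ennreal (u0 t powr R) \<partial>cantor_haar)"
    define a where "a t = (\<integral>\<^sup>+ g. ennreal (U t g powr R) \<partial>\<mu>)" for t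
    define b where "b g = (\<integral>\<^sup>+ t. ennreal (U t g powr R) \<partial>cantor_haar)" for g
    define KG where "KG = CG powr (R / q)"
    define KD where "KD = CD powr (R / q)"
    have a1: "a t \<le> ennreal KG * A" and a2: "A \<le> ennreal KG * a t" if t: "t \<in> cantor_group" for t
    proof -
      have nw: "cmod (t k) = 1" for k using t by (auto simp: tt)
      from domG[of "\<lambda>k. complex_of_real (t k)", OF nw, unfolded dominated_on_average_def]
      obtain m where m0: "\<forall>d<L. 0 \<le> m d" and m1: "(\<Sum>d<L. m d) = 1"
        and m2: "\<forall>b. \<Theta> (\<lambda>k. complex_of_real (t k) * b k) powr q \<le> CG * (\<Sum>d<L. m d * \<Theta> (\<lambda>k. \<gamma> k (e d) * b k) powr q)"
        by (elim exE conjE)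
      note m = m0[rule_format] m1 m2[rule_format]
      show "a t \<le> ennreal KG * A"
        unfolding a_def A_def KG_def
      proof (rule nn_integral_domination[where \<theta> = ?G and L = L, OF u1_meas U0(3,1) G m(1,2) _ q(1) qR CG0(1)])
        show "U t g powr q \<le> CG * (\<Sum>d<L. m d * u1 (?G d g) powr q)" for g
          using m(3)[of "\<lambda>k. \<gamma> k g"] by (simp add: U_def u1_def \<gamma>_add)
      qed
      show "A \<le> ennreal KG * a t"
        unfolding a_def A_def KG_def
      proof (rule nn_integral_domination[where \<theta> = ?G and L = L, OF Ut_meas U0(1,3) G m(1,2) _ q(1) qR CG0(1)])
        fix g
        have "(\<lambda>k. t k * (t k * \<gamma> k g)) = (\<lambda>k. \<gamma> k g)"
          using tt(1)[OF t] by (simp flip: of_real_mult mult.assoc)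
        moreover have "(\<lambda>k. \<gamma> k (e d) * (t k * \<gamma> k g)) = (\<lambda>k. t k * \<gamma> k (e d + g))" for d
          by (simp add: \<gamma>_add mult_ac)
        ultimately show "u1 g powr q \<le> CG * (\<Sum>d<L. m d * U t (?G d g) powr q)"
          using m(3)[of "\<lambda>k. t k * \<gamma> k g"] by (simp add: U_def u1_def)
      qed
    qed
    have b1: "b g \<le> ennreal KD * B" for g
    proof -
      have nw: "cmod (\<gamma> k g) = 1" for k by (auto simp: \<gamma>_norm)
      from domD[of "\<lambda>k. \<gamma> k g", OF nw, unfolded dominated_on_average_def]
      obtain m where m0: "\<forall>d<L'. 0 \<le> m d" and m1: "(\<Sum>d<L'. m d) = 1"
        and m2: "\<forall>b. \<Theta> (\<lambda>k. \<gamma> k g * b k) powr q \<le> CD * (\<Sum>d<L'. m d * \<Theta> (\<lambda>k. complex_of_real (\<sigma> d k) * b k) powr q)"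
        by (elim exE conjE)
      note m = m0[rule_format] m1 m2[rule_format]
      show ?thesis
        unfolding b_def B_def KD_def
      proof (rule nn_integral_domination[where \<theta> = ?D and L = L', OF u0_meas U0(2,1) D m(1,2) _ q(1) qR CG0(2)])
        show "U t g powr q \<le> CD * (\<Sum>d<L'. m d * u0 (?D d t) powr q)" for t
          using m(3)[of "\<lambda>k. t k"] by (simp add: U_def u0_def mult.commute)
      qed
    qed
    have b2: "B \<le> ennreal KD * b g" for g
    proof -
      have nw: "cmod (cnj (\<gamma> k g)) = 1" for k by (auto simp: \<gamma>_norm)
      from domD[of "\<lambda>k. cnj (\<gamma> k g)", OF nw, unfolded dominated_on_average_def]
      obtain m where m0: "\<forall>d<L'. 0 \<le> m d" and m1: "(\<Sum>d<L'. m d) = 1"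
        and m2: "\<forall>b. \<Theta> (\<lambda>k. cnj (\<gamma> k g) * b k) powr q \<le> CD * (\<Sum>d<L'. m d * \<Theta> (\<lambda>k. complex_of_real (\<sigma> d k) * b k) powr q)"
        by (elim exE conjE)
      note m = m0[rule_format] m1 m2[rule_format]
      show ?thesis
        unfolding b_def B_def KD_def
      proof (rule nn_integral_domination[where \<theta> = ?D and L = L', OF Ug_meas U0(1,2) D m(1,2) _ q(1) qR CG0(2)])
        fix t :: "nat \<Rightarrow> real"
        have "(\<lambda>k. cnj (\<gamma> k g) * (\<gamma> k g * t k)) = (\<lambda>k. of_real (t k))"
          by (simp add: \<gamma>_cnj flip: mult.assoc)
        moreover have "(\<lambda>k. complex_of_real (\<sigma> d k) * (\<gamma> k g * t k)) = (\<lambda>k. of_real (\<sigma> d k * t k) * \<gamma> k g)" for d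
          by (simp add: mult_ac)
        ultimately show "u0 t powr q \<le> CD * (\<Sum>d<L'. m d * U (?D d t) g powr q)"
          using m(3)[of "\<lambda>k. \<gamma> k g * t k"] by (simp add: U_def u0_def)
      qed
    qed
    have fubini: "(\<integral>\<^sup>+ t. a t \<partial>cantor_haar) = (\<integral>\<^sup>+ g. b g \<partial>\<mu>)"
      unfolding a_def b_def by (rule P.Fubini'[symmetric]) (simp add: case_prod_unfold)
    have [measurable]: "a \<in> borel_measurable cantor_haar" "b \<in> borel_measurable \<mu>"
    proof -
      show "a \<in> borel_measurable cantor_haar" unfolding a_def
        by (rule M.borel_measurable_nn_integral) (simp add: case_prod_unfold)
      have "(\<lambda>z. ennreal (U (snd z) (fst z) powr R)) \<in> borel_measurable (\<mu> \<Otimes>\<^sub>M cantor_haar)"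
        using measurable_pair_swap[of "\<lambda>z. ennreal (U (fst z) (snd z) powr R)" cantor_haar \<mu> borel] by (simp add: case_prod_unfold)
      then show "b \<in> borel_measurable \<mu>" unfolding b_def
        by (intro D.borel_measurable_nn_integral) (simp add: case_prod_unfold)
    qed
    have K': "(KG * KD) powr (1 / R) = K" using CG0 R q
      by (simp add: KG_def KD_def K_def powr_mult powr_powr)
    have KK: "0 < KG * KD" using CG0 by (simp add: KG_def KD_def)
    have "A = (\<integral>\<^sup>+ t. A \<partial>cantor_haar)" by (simp add: D.emeasure_space_1)
    also have "\<dots> \<le> (\<integral>\<^sup>+ t. ennreal KG * a t \<partial>cantor_haar)" using a2 by (intro nn_integral_mono) (simp add: spD)
    also have "\<dots> = ennreal KG * (\<integral>\<^sup>+ g. b g \<partial>\<mu>)" by (simp add: nn_integral_cmult fubini)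
    also have "\<dots> \<le> ennreal KG * (\<integral>\<^sup>+ g. ennreal KD * B \<partial>\<mu>)" using b1 by (intro mult_left_mono nn_integral_mono) auto
    also have "\<dots> = ennreal (KG * KD) * B"
      by (simp add: M.emeasure_space_1 ennreal_mult KG_def KD_def mult.assoc)
    finally have 1: "A \<le> ennreal (KG * KD) * B" .
    have "B = (\<integral>\<^sup>+ g. B \<partial>\<mu>)" by (simp add: M.emeasure_space_1)
    also have "\<dots> \<le> (\<integral>\<^sup>+ g. ennreal KD * b g \<partial>\<mu>)" using b2 by (intro nn_integral_mono) simp
    also have "\<dots> = ennreal KD * (\<integral>\<^sup>+ t. a t \<partial>cantor_haar)" by (simp add: nn_integral_cmult fubini)
    also have "\<dots> \<le> ennreal KD * (\<integral>\<^sup>+ t. ennreal KG * A \<partial>cantor_haar)" using a1 by (intro mult_left_mono nn_integral_mono) (auto simp: spD)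
    also have "\<dots> = ennreal (KG * KD) * A"
      by (simp add: D.emeasure_space_1 ennreal_mult KG_def KD_def mult_ac)
    finally have 2: "B \<le> ennreal (KG * KD) * A" .
    show ?thesis
      using Lp_quasinorm_le[where N = \<Theta> and f = "\<lambda>g k. \<gamma> k g" and \<mu> = \<mu> and N' = \<Theta>
          and f' = "\<lambda>t k. complex_of_real (t k)" and \<mu>' = cantor_haar, OF False p KK]
        Lp_quasinorm_le[where N' = \<Theta> and f' = "\<lambda>g k. \<gamma> k g" and \<mu>' = \<mu> and N = \<Theta>
          and f = "\<lambda>t k. complex_of_real (t k)" and \<mu> = cantor_haar, OF False p KK] 1 2
      unfolding X_def Y_def A_def B_def u0_def u1_def R_def[symmetric] K' by blast
  qed
  then show "X \<le> ennreal K * Y" "Y \<le> ennreal K * X" by blast+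
qed

section \<open>Sidon sets in natural spaces\<close>

theorem theorem4:
  fixes s :: "complex \<Rightarrow> 'x::ab_group_add \<Rightarrow> 'x"
    and N :: "'x \<Rightarrow> real"
    and NY :: "'y::{ordered_real_vector,lattice} \<Rightarrow> real"
    and \<mu> :: "'g::{topological_ab_group_add,t2_space} measure"
    and E :: "('g \<Rightarrow> complex) set"
    and p :: ennreal
  assumes "quasi_banach s N"
    and "natural_via NY s N"
    and "0 < p"
    and "compact (UNIV :: 'g set)"
    and "normalized_haar \<mu>"
    and "sidon_set E"
  shows "property_C p \<mu> s N E"
proof -
  have vs: "vector_space s" and N0: "\<And>x. 0 \<le> N x" using assms(1) by (auto simp: quasi_banach_def)
  interpret vector_space s by (rule vs)
  obtain M where M: "1 \<le> M" "\<And>n (\<gamma> :: nat \<Rightarrow> 'g \<Rightarrow> complex) q. inj_on \<gamma> {..<n} \<Longrightarrow> \<gamma> ` {..<n} \<subseteq> E \<Longrightarrow> 0 < q \<Longrightarrow> q \<le> 1 \<Longrightarrow>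
      \<exists>L (e :: nat \<Rightarrow> 'g). norming_matrix n L (\<lambda>d k. \<gamma> k (e d)) M q"
    using sidon_norming[OF assms(4,6)] by blast
  obtain q0 where q0: "0 < q0" and dom: "\<forall>q M. 0 < q \<longrightarrow> q \<le> q0 \<longrightarrow> q \<le> 1 \<longrightarrow> 1 \<le> M \<longrightarrow> (\<exists>C\<ge>1. \<forall>n L v w x.
     norming_matrix n L v M q \<longrightarrow> (\<forall>k<n. cmod (w k) \<le> 1) \<longrightarrow>
     dominated_on_average L C (\<lambda>d b. N (\<Sum>k<n. s (v d k * b k) (x k)) powr q)
       (\<lambda>b. N (\<Sum>k<n. s (w k * b k) (x k)) powr q))"
    using natural_domination[OF assms(1,2)] by (elim exE conjE)
  \<comment> \<open>\<open>q \<le> p\<close> is needed to pass from \<open>q\<close>-th to \<open>p\<close>-th powers by Jensen; any positive value will do for \<open>p = \<infinity>\<close>\<close>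
  define P where "P = (if p = \<infinity> then 1 else enn2real p)"
  have P: "0 < P" using assms(3) by (cases p) (auto simp: P_def)
  define q where "q = min (min q0 1) P"
  have q: "0 < q" "q \<le> q0" "q \<le> 1" "p \<noteq> \<infinity> \<Longrightarrow> q \<le> enn2real p" using q0 P by (auto simp: q_def P_def)
  note dom = dom[THEN spec[of _ q], THEN spec, THEN mp, THEN mp, THEN mp, THEN mp, OF q(1-3)]
  obtain CG where CG: "1 \<le> CG" and CG_dom: "\<forall>n L v w x. norming_matrix n L v M q \<longrightarrow> (\<forall>k<n. cmod (w k) \<le> 1) \<longrightarrow>
     dominated_on_average L CG (\<lambda>d b. N (\<Sum>k<n. s (v d k * b k) (x k)) powr q)
       (\<lambda>b. N (\<Sum>k<n. s (w k * b k) (x k)) powr q)"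
    using dom[OF M(1)] by (elim exE conjE)
  have two: "(1::real) \<le> 2" by simp
  obtain CD where CD: "1 \<le> CD" and CD_dom: "\<forall>n L v w x. norming_matrix n L v 2 q \<longrightarrow> (\<forall>k<n. cmod (w k) \<le> 1) \<longrightarrow>
     dominated_on_average L CD (\<lambda>d b. N (\<Sum>k<n. s (v d k * b k) (x k)) powr q)
       (\<lambda>b. N (\<Sum>k<n. s (w k * b k) (x k)) powr q)"
    using dom[OF two] by (elim exE conjE)
  define K where "K = (CG * CD) powr (1 / q)"
  have K: "0 < K" using CG CD by (simp add: K_def)
  show ?thesis
    unfolding property_C_def
  proof (rule exI[of _ K], intro conjI allI impI K)
    fix n :: nat and \<gamma> :: "nat \<Rightarrow> 'g \<Rightarrow> complex" and x :: "nat \<Rightarrow> 'x"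
    assume \<gamma>: "inj_on \<gamma> {..<n} \<and> \<gamma> ` {..<n} \<subseteq> E"
    define \<Theta> where "\<Theta> c = N (\<Sum>k<n. s (c k) (x k))" for c :: "nat \<Rightarrow> complex"
    \<comment> \<open>trivial characters in the places from \<open>n\<close> on turn the finite family into a sequence\<close>
    define \<gamma>' where "\<gamma>' k = (if k < n then \<gamma> k else (\<lambda>_. 1))" for k
    obtain L and e :: "nat \<Rightarrow> 'g" where e: "norming_matrix n L (\<lambda>d k. \<gamma> k (e d)) M q"
      using M(2)[of \<gamma> n q] \<gamma> q by blast
    define \<sigma> where "\<sigma> d k = (if k \<in> set_decode d then 1 else - 1 :: real)" for d k :: nat
    let ?X = "Lp_quasinorm p \<mu> N (\<lambda>g. \<Sum>k<n. s (\<gamma> k g) (x k))"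
    let ?Y = "Lp_quasinorm p cantor_haar N (\<lambda>t. \<Sum>k<n. s (complex_of_real (t k)) (x k))"
    have XY: "Lp_quasinorm p \<mu> \<Theta> (\<lambda>g k. \<gamma>' k g) = ?X"
      "Lp_quasinorm p cantor_haar \<Theta> (\<lambda>t k. complex_of_real (t k)) = ?Y"
      by (simp_all add: Lp_quasinorm_def \<Theta>_def \<gamma>'_def)
    have Theta_meas: "\<Theta> \<in> borel_measurable borel"
      unfolding \<Theta>_def by (rule borel_measurable_continuous_onI[OF quasinorm_combination_continuous[OF assms(1)]])
    have Theta_nonneg: "0 \<le> \<Theta> c" for c by (simp add: \<Theta>_def N0)
    have chars: "\<gamma>' k \<in> dual_group" for k
    proof (cases "k < n")
      case True
      then have "\<gamma> k \<in> E" using \<gamma> by auto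
      then show ?thesis using assms(6) True by (auto simp: sidon_set_def \<gamma>'_def)
    qed (auto simp: \<gamma>'_def dual_group_def)
    have signs: "\<sigma> d \<in> cantor_group" for d
      unfolding cantor_group_def by (rule PiE_I) (auto simp: \<sigma>_def)
    have dom_chars: "dominated_on_average L CG (\<lambda>d b. \<Theta> (\<lambda>k. \<gamma>' k (e d) * b k) powr q) (\<lambda>b. \<Theta> (\<lambda>k. w k * b k) powr q)"
      if "\<And>k. cmod (w k) = 1" for w
    proof -
      have w: "\<forall>k<n. cmod (w k) \<le> 1" using that by simp
      show ?thesis
        using CG_dom[THEN spec, THEN spec, THEN spec, THEN spec, THEN spec[of _ x], THEN mp, THEN mp, OF e w]
        by (simp add: \<Theta>_def \<gamma>'_def)
    qed
    have dom_signs: "dominated_on_average (2 ^ n) CD (\<lambda>d b. \<Theta> (\<lambda>k. complex_of_real (\<sigma> d k) * b k) powr q)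
        (\<lambda>b. \<Theta> (\<lambda>k. w k * b k) powr q)"
      if "\<And>k. cmod (w k) = 1" for w
    proof -
      have sg: "complex_of_real (\<sigma> d k) = sgn_of (set_decode d) k" for d k by (simp add: \<sigma>_def sgn_of_def)
      have w: "\<forall>k<n. cmod (w k) \<le> 1" using that by simp
      show ?thesis
        using CD_dom[THEN spec, THEN spec, THEN spec, THEN spec, THEN spec[of _ x], THEN mp, THEN mp,
            OF signs_norming[OF q(1,3), of n] w]
        by (simp add: \<Theta>_def sg)
    qed
    note le = Lp_comparison[OF assms(5) Theta_meas Theta_nonneg chars signs dom_chars dom_signs q(1,4) assms(3) CG CD, folded K_def, unfolded XY]
    show "?X \<le> ennreal K * ?Y" by (rule le(1))
    have "ennreal (inverse K) * ?Y \<le> ennreal (inverse K) * (ennreal K * ?X)"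
      by (intro mult_left_mono le(2) zero_le)
    also have "\<dots> = ?X"
      using K by (simp add: mult.assoc[symmetric] ennreal_mult[symmetric])
    finally show "ennreal (inverse K) * ?Y \<le> ?X" .
  qed
qed

end
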